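(* Let $K$ be a field and let $A$ be an affine cellular $K$-algebra with cell chain $0=J_0\subset J_1\subset\cdots\subset J_m=A$, whose $j$-th layer $J_j/J_{j-1}$ has data $(V_j,B_j,\phi_j)$ for $1\le j\le m$. Then $A$ is semisimple if and only if both of the following hold: (1) $Spec[A]$ is a reduced $0$-dimensional scheme; (2) $\phi_j$ is invertible for each $j\in\{1,2,\dots,m\}$.
   Context: A ring is semisimple if it is semisimple as a left module over itself. Affine algebras and involutions. An affine $K$-algebra is a commutative algebra of the form $K[x_1,\dots,x_t]/I$ with $I$ an ideal. A $K$-involution $\ast$ on a $K$-algebra is a $K$-linear anti-automorphism with $(a^\ast)^\ast=a$ for all $a$. Affine cell ideals. Let $A$ be a unital $K$-algebra with $K$-involution $\ast$. A two-sided ideal $J$ of $A$ is an affine cell ideal if the following data are given and conditions hold: (1) $J^\ast=J$; (2) there are a free $K$-module $V$ of finite rank and an affine $K$-algebra $B$ with identity and a $K$-involution $\sigma$ such that $\Delta:=V\otimes_K B$ is an $A$-$B$-bimodule, whose right $B$-module structure is induced by right multiplication on $B$; (3) there is an $A$-$A$-bimodule isomorphism $\alpha:J\to\Delta\otimes_B\Delta'$, where $\Delta'=B\otimes_K V$ is the $B$-$A$-bimodule with left $B$-structure induced by left multiplication on $B$ and right $A$-structure $(b\otimes v)a:=\tau(a^\ast(v\otimes b))$, with $\tau$ the switch map $V\otimes_K B\to B\otimes_K V$, $v\otimes b\mapsto b\otimes v$, such that if $\alpha(x)=\sum v_1\otimes b_1\otimes_B b_2\otimes v_2$ then $\alpha(x^\ast)=\sum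 v_2\otimes\sigma(b_2)\otimes_B\sigma(b_1)\otimes v_1$. Affine cellular algebras. The algebra $A$ (with $\ast$) is affine cellular if there is a $K$-module decomposition $A=J_1'\oplus\cdots\oplus J_m'$ with $(J_j')^\ast=J_j'$ for each $j$, such that $J_j:=\bigoplus_{l=1}^{j}J_l'$ gives a chain of two-sided ideals $0=J_0\subset J_1\subset\cdots\subset J_m=A$, and each layer $J_j'=J_j/J_{j-1}$ is an affine cell ideal of $A/J_{j-1}$ with respect to the induced involution, with associated free module $V_j$ of rank $n_j$ and affine algebra $B_j$. Bilinear forms. Identifying $J_j/J_{j-1}$ with $V_j\otimes_K B_j\otimes_K V_j$, there is a $K$-linear map $\phi_j:V_j\otimes_K V_j\to B_j$ with $(u\otimes b\otimes v)(u'\otimes b'\otimes v')=u\otimes b\,\phi_j(v,u')\,b'\otimes v'$. Fixing a basis $v_1,\dots,v_{n_j}$ of $V_j$, $\phi_j$ is identified with the matrix $(\phi_j(v_s,v_t))_{s,t}\in M_{n_j}(B_j)$; invertibility of $\phi_j$ refers to this matrix in $M_{n_j}(B_j)$. Associated scheme. $Spec[A]:=Spec(\prod_{j=1}^m B_j)$. An affine scheme $Spec(R)$ is called reduced if the ring $R$ is reduced (no nonzero nilpotents), and its dimension is the Krull dimension of $R$. *)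

theory Defs
  imports "HOL-Algebra.Algebra" "HOL-Library.Extended_Real"
begin

section \<open>Modules, algebras and semisimplicity\<close>

text \<open>The library locale \<^locale>\<open>module\<close> asks for a commutative scalar ring; the following is the
  same list of axioms for left modules over an arbitrary unital ring.\<close>

locale left_module = A?: ring A + M?: abelian_group M
  for A :: "('a, 'z) ring_scheme" (structure)
    and M :: "('a, 'b, 'y) module_scheme" (structure) +
  assumes smult_closed:
      "\<lbrakk>a \<in> carrier A; x \<in> carrier M\<rbrakk> \<Longrightarrow> a \<odot>\<^bsub>M\<^esub> x \<in> carrier M"
    and smult_l_distr:
      "\<lbrakk>a \<in> carrier A; b \<in> carrier A; x \<in> carrier M\<rbrakk> \<Longrightarrow>
        (a \<oplus>\<^bsub>A\<^esub> b) \<odot>\<^bsub>M\<^esub> x = a \<odot>\<^bsub>M\<^esub> x \<oplus>\<^bsub>M\<^esub> b \<odot>\<^bsub>M\<^esub> x"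
    and smult_r_distr:
      "\<lbrakk>a \<in> carrier A; x \<in> carrier M; y \<in> carrier M\<rbrakk> \<Longrightarrow>
        a \<odot>\<^bsub>M\<^esub> (x \<oplus>\<^bsub>M\<^esub> y) = a \<odot>\<^bsub>M\<^esub> x \<oplus>\<^bsub>M\<^esub> a \<odot>\<^bsub>M\<^esub> y"
    and smult_assoc1:
      "\<lbrakk>a \<in> carrier A; b \<in> carrier A; x \<in> carrier M\<rbrakk> \<Longrightarrow>
        (a \<otimes>\<^bsub>A\<^esub> b) \<odot>\<^bsub>M\<^esub> x = a \<odot>\<^bsub>M\<^esub> (b \<odot>\<^bsub>M\<^esub> x)"
    and smult_one:
      "x \<in> carrier M \<Longrightarrow> \<one>\<^bsub>A\<^esub> \<odot>\<^bsub>M\<^esub> x = x"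

definition with_smult :: "('b, 'z) ring_scheme \<Rightarrow> ('a \<Rightarrow> 'b \<Rightarrow> 'b) \<Rightarrow> ('a, 'b) module" where
  "with_smult M s = \<lparr>carrier = carrier M, monoid.mult = monoid.mult M, one = one M,
     ring.zero = ring.zero M, ring.add = ring.add M, smult = s\<rparr>"

definition regular_module :: "('a, 'z) ring_scheme \<Rightarrow> ('a, 'a) module" where
  "regular_module A = with_smult A (monoid.mult A)"

definition simple_module :: "('a, 'z) ring_scheme \<Rightarrow> ('a, 'b, 'y) module_scheme \<Rightarrow> bool" where
  "simple_module A M \<longleftrightarrow> left_module A M \<and> carrier M \<noteq> {\<zero>\<^bsub>M\<^esub>} \<and>
     (\<forall>H. submodule H A M \<longrightarrow> H = {\<zero>\<^bsub>M\<^esub>} \<or> H = carrier M)"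

text \<open>The sum of a family of additive subgroups, and internal direct sums.\<close>

definition sum_of :: "('b, 'z) ring_scheme \<Rightarrow> 'i set \<Rightarrow> ('i \<Rightarrow> 'b set) \<Rightarrow> 'b set" where
  "sum_of M I N = generate (add_monoid M) (\<Union>i\<in>I. N i)"

definition is_direct_sum :: "('b, 'z) ring_scheme \<Rightarrow> 'i set \<Rightarrow> ('i \<Rightarrow> 'b set) \<Rightarrow> bool" where
  "is_direct_sum M I N \<longleftrightarrow> carrier M = sum_of M I N \<and>
     (\<forall>i\<in>I. N i \<inter> sum_of M (I - {i}) N = {\<zero>\<^bsub>M\<^esub>})"

definition semisimple_module :: "('a, 'z) ring_scheme \<Rightarrow> ('a, 'b, 'y) module_scheme \<Rightarrow> bool" where
  "semisimple_module A M \<longleftrightarrow> left_module A M \<and>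
     (\<exists>S. (\<forall>N\<in>S. submodule N A M \<and> simple_module A (M\<lparr>carrier := N\<rparr>)) \<and>
          is_direct_sum M S (\<lambda>N. N))"

definition semisimple_ring :: "('a, 'z) ring_scheme \<Rightarrow> bool" where
  "semisimple_ring A \<longleftrightarrow> semisimple_module A (regular_module A)"

text \<open>Unital associative, not necessarily commutative algebras; the library locale
  \<^locale>\<open>algebra\<close> describes the commutative ones.\<close>

locale assoc_algebra = module K A + ring A
  for K :: "('k, 'z) ring_scheme" and A :: "('k, 'a, 'y) module_scheme" +
  assumes smult_mult_left:
      "\<lbrakk>k \<in> carrier K; x \<in> carrier A; y \<in> carrier A\<rbrakk> \<Longrightarrow> (k \<odot>\<^bsub>A\<^esub> x) \<otimes>\<^bsub>A\<^esub> y = k \<odot>\<^bsub>A\<^esub> (x \<otimes>\<^bsub>A\<^esub> y)"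
    and smult_mult_right:
      "\<lbrakk>k \<in> carrier K; x \<in> carrier A; y \<in> carrier A\<rbrakk> \<Longrightarrow> x \<otimes>\<^bsub>A\<^esub> (k \<odot>\<^bsub>A\<^esub> y) = k \<odot>\<^bsub>A\<^esub> (x \<otimes>\<^bsub>A\<^esub> y)"

definition linear_maps ::
  "('k, 'z) ring_scheme \<Rightarrow> ('k, 'a, 'y) module_scheme \<Rightarrow> ('k, 'b, 'x) module_scheme \<Rightarrow> ('a \<Rightarrow> 'b) set" where
  "linear_maps K M N = {h \<in> carrier M \<rightarrow> carrier N.
     (\<forall>x\<in>carrier M. \<forall>y\<in>carrier M. h (x \<oplus>\<^bsub>M\<^esub> y) = h x \<oplus>\<^bsub>N\<^esub> h y) \<and>
     (\<forall>k\<in>carrier K. \<forall>x\<in>carrier M. h (k \<odot>\<^bsub>M\<^esub> x) = k \<odot>\<^bsub>N\<^esub> h x)}"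

definition K_involution :: "('k, 'z) ring_scheme \<Rightarrow> ('k, 'a, 'y) module_scheme \<Rightarrow> ('a \<Rightarrow> 'a) \<Rightarrow> bool" where
  "K_involution K A star \<longleftrightarrow> star \<in> linear_maps K A A \<and>
     star \<one>\<^bsub>A\<^esub> = \<one>\<^bsub>A\<^esub> \<and>
     (\<forall>x\<in>carrier A. \<forall>y\<in>carrier A. star (x \<otimes>\<^bsub>A\<^esub> y) = star y \<otimes>\<^bsub>A\<^esub> star x) \<and>
     (\<forall>x\<in>carrier A. star (star x) = x)"

text \<open>\<open>v 1, \<dots>, v n\<close> is a basis of the \<open>K\<close>-module \<open>V\<close>.\<close>

definition is_basis ::
  "('k, 'z) ring_scheme \<Rightarrow> ('k, 'v, 'y) module_scheme \<Rightarrow> nat \<Rightarrow> (nat \<Rightarrow> 'v) \<Rightarrow> bool" where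
  "is_basis K V n v \<longleftrightarrow> module K V \<and> v \<in> {1..n} \<rightarrow> carrier V \<and>
     (\<forall>x\<in>carrier V. \<exists>!c. c \<in> {1..n} \<rightarrow>\<^sub>E carrier K \<and> x = (\<Oplus>\<^bsub>V\<^esub>i\<in>{1..n}. c i \<odot>\<^bsub>V\<^esub> v i))"

definition free_of_finite_rank :: "('k, 'z) ring_scheme \<Rightarrow> ('k, 'v, 'y) module_scheme \<Rightarrow> bool" where
  "free_of_finite_rank K V \<longleftrightarrow> (\<exists>n v. is_basis K V n v)"

text \<open>The quotient of a module by a submodule, or of an algebra by an ideal: the library quotient
  \<^const>\<open>FactRing\<close> together with the induced scalar multiplication.\<close>

definition quot_module :: "('k, 'a, 'y) module_scheme \<Rightarrow> 'a set \<Rightarrow> ('k, 'a set) module" where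
  "quot_module M N = with_smult (M Quot N) (\<lambda>k C. (\<Union>x\<in>C. N +>\<^bsub>M\<^esub> (k \<odot>\<^bsub>M\<^esub> x)))"

section \<open>Affine algebras\<close>

text \<open>The polynomial algebra over \<open>K\<close> in \<open>t\<close> variables. Monomials are multisets over \<open>{1..t}\<close>, as in
  the library theory of indexed polynomials, which provides the carrier and the addition.\<close>

definition mpoly_algebra :: "('k, 'z) ring_scheme \<Rightarrow> nat \<Rightarrow> ('k, nat multiset \<Rightarrow> 'k) module" where
  "mpoly_algebra K t = \<lparr>
     carrier = ring.indexed_pset K {1..t} (carrier K),
     monoid.mult = (\<lambda>p q m. \<Oplus>\<^bsub>K\<^esub>a\<in>{a. a \<subseteq># m}. p a \<otimes>\<^bsub>K\<^esub> q (m - a)),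
     one = ring.indexed_const K \<one>\<^bsub>K\<^esub>,
     ring.zero = ring.indexed_const K \<zero>\<^bsub>K\<^esub>,
     ring.add = ring.indexed_padd K,
     smult = (\<lambda>k p m. k \<otimes>\<^bsub>K\<^esub> p m)\<rparr>"

definition affine_algebra :: "('k, 'z) ring_scheme \<Rightarrow> ('k, 'b, 'y) module_scheme \<Rightarrow> bool" where
  "affine_algebra K B \<longleftrightarrow> algebra K B \<and>
     (\<exists>t I h. ideal I (mpoly_algebra K t) \<and>
        h \<in> ring_iso (quot_module (mpoly_algebra K t) I) B \<and>
        h \<in> linear_maps K (quot_module (mpoly_algebra K t) I) B)"

section \<open>Tensor products over commutative rings\<close>

text \<open>\<open>M \<otimes>\<^sub>R N\<close> is the free \<open>R\<close>-module on the set \<open>M \<times> N\<close> (finitely supported functions) modulo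
  the submodule generated by the bilinearity relations.\<close>

definition free_module :: "('r, 'z) ring_scheme \<Rightarrow> 's set \<Rightarrow> ('r, 's \<Rightarrow> 'r) module" where
  "free_module R S = \<lparr>
     carrier = {p. (\<forall>s. p s \<in> carrier R) \<and> (\<forall>s. s \<notin> S \<longrightarrow> p s = \<zero>\<^bsub>R\<^esub>) \<and> finite {s. p s \<noteq> \<zero>\<^bsub>R\<^esub>}},
     monoid.mult = undefined,
     one = undefined,
     ring.zero = (\<lambda>_. \<zero>\<^bsub>R\<^esub>),
     ring.add = (\<lambda>p q s. p s \<oplus>\<^bsub>R\<^esub> q s),
     smult = (\<lambda>r p s. r \<otimes>\<^bsub>R\<^esub> p s)\<rparr>"

definition free_gen :: "('r, 'z) ring_scheme \<Rightarrow> 's \<Rightarrow> 's \<Rightarrow> 'r" where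
  "free_gen R s = (\<lambda>s'. if s' = s then \<one>\<^bsub>R\<^esub> else \<zero>\<^bsub>R\<^esub>)"

definition tensor_relations ::
  "('r, 'z) ring_scheme \<Rightarrow> ('r, 'm, 'y) module_scheme \<Rightarrow> ('r, 'n, 'x) module_scheme \<Rightarrow> ('m \<times> 'n \<Rightarrow> 'r) set" where
  "tensor_relations R M N = (let F = free_module R (carrier M \<times> carrier N); e = free_gen R in
     {e (x \<oplus>\<^bsub>M\<^esub> x', y) \<ominus>\<^bsub>F\<^esub> (e (x, y) \<oplus>\<^bsub>F\<^esub> e (x', y)) | x x' y.
        x \<in> carrier M \<and> x' \<in> carrier M \<and> y \<in> carrier N} \<union>
     {e (x, y \<oplus>\<^bsub>N\<^esub> y') \<ominus>\<^bsub>F\<^esub> (e (x, y) \<oplus>\<^bsub>F\<^esub> e (x, y')) | x y y'.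
        x \<in> carrier M \<and> y \<in> carrier N \<and> y' \<in> carrier N} \<union>
     {e (r \<odot>\<^bsub>M\<^esub> x, y) \<ominus>\<^bsub>F\<^esub> r \<odot>\<^bsub>F\<^esub> e (x, y) | r x y.
        r \<in> carrier R \<and> x \<in> carrier M \<and> y \<in> carrier N} \<union>
     {e (x, r \<odot>\<^bsub>N\<^esub> y) \<ominus>\<^bsub>F\<^esub> r \<odot>\<^bsub>F\<^esub> e (x, y) | r x y.
        r \<in> carrier R \<and> x \<in> carrier M \<and> y \<in> carrier N})"

definition tensor_submodule ::
  "('r, 'z) ring_scheme \<Rightarrow> ('r, 'm, 'y) module_scheme \<Rightarrow> ('r, 'n, 'x) module_scheme \<Rightarrow> ('m \<times> 'n \<Rightarrow> 'r) set" where
  "tensor_submodule R M N =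
     \<Inter>{H. submodule H R (free_module R (carrier M \<times> carrier N)) \<and> tensor_relations R M N \<subseteq> H}"

definition tensor ::
  "('r, 'z) ring_scheme \<Rightarrow> ('r, 'm, 'y) module_scheme \<Rightarrow> ('r, 'n, 'x) module_scheme \<Rightarrow>
   ('r, ('m \<times> 'n \<Rightarrow> 'r) set) module" where
  "tensor R M N = quot_module (free_module R (carrier M \<times> carrier N)) (tensor_submodule R M N)"

text \<open>The elementary tensor \<open>x \<otimes> y\<close>.\<close>

definition pure_tensor ::
  "('r, 'z) ring_scheme \<Rightarrow> ('r, 'm, 'y) module_scheme \<Rightarrow> ('r, 'n, 'x) module_scheme \<Rightarrow>
   'm \<Rightarrow> 'n \<Rightarrow> ('m \<times> 'n \<Rightarrow> 'r) set" where
  "pure_tensor R M N x y =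
     tensor_submodule R M N +>\<^bsub>free_module R (carrier M \<times> carrier N)\<^esub> free_gen R (x, y)"

text \<open>The linear map \<open>M \<otimes>\<^sub>R N \<rightarrow> P\<close>, \<open>x \<otimes> y \<mapsto> f x y\<close>, for an \<open>R\<close>-bilinear \<open>f\<close>. It is computed on a
  representative; for bilinear \<open>f\<close> the choice does not matter.\<close>

definition tensor_lift ::
  "('r, 'm, 'y) module_scheme \<Rightarrow> ('r, 'n, 'x) module_scheme \<Rightarrow> ('r, 'p, 'w) module_scheme \<Rightarrow>
   ('r, 'z) ring_scheme \<Rightarrow> ('m \<Rightarrow> 'n \<Rightarrow> 'p) \<Rightarrow> ('m \<times> 'n \<Rightarrow> 'r) set \<Rightarrow> 'p" where
  "tensor_lift M N P R f C = (let p = SOME p. p \<in> C in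
     \<Oplus>\<^bsub>P\<^esub>s\<in>{s. p s \<noteq> \<zero>\<^bsub>R\<^esub>}. p s \<odot>\<^bsub>P\<^esub> f (fst s) (snd s))"

section \<open>Affine cell ideals\<close>

text \<open>The \<open>B\<close>-modules \<open>\<Delta> = V \<otimes>\<^sub>K B\<close> and \<open>\<Delta>' = B \<otimes>\<^sub>K V\<close>, with \<open>(v \<otimes> c) b = v \<otimes> c b\<close> and
  \<open>b (c \<otimes> v) = b c \<otimes> v\<close>. As \<open>B\<close> is commutative, the right \<open>B\<close>-module \<open>\<Delta>\<close> is recorded as a module
  in the sense of the library, i.e. \<open>\<Delta> b\<close> is written \<open>b \<odot> \<Delta>\<close>, and \<open>\<Delta> \<otimes>\<^sub>B \<Delta>'\<close> is \<^const>\<open>tensor\<close>.\<close>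

definition cell_Delta ::
  "('k, 'z) ring_scheme \<Rightarrow> ('k, 'v) module \<Rightarrow> ('k, 'b) module \<Rightarrow> ('b, ('v \<times> 'b \<Rightarrow> 'k) set) module" where
  "cell_Delta K V B = with_smult (tensor K V B)
     (\<lambda>b. tensor_lift V B (tensor K V B) K (\<lambda>v c. pure_tensor K V B v (c \<otimes>\<^bsub>B\<^esub> b)))"

definition cell_Delta' ::
  "('k, 'z) ring_scheme \<Rightarrow> ('k, 'v) module \<Rightarrow> ('k, 'b) module \<Rightarrow> ('b, ('b \<times> 'v \<Rightarrow> 'k) set) module" where
  "cell_Delta' K V B = with_smult (tensor K B V)
     (\<lambda>b. tensor_lift B V (tensor K B V) K (\<lambda>c v. pure_tensor K B V (b \<otimes>\<^bsub>B\<^esub> c) v))"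

type_synonym ('k, 'v, 'b) cell_tensor =
  "(('v \<times> 'b \<Rightarrow> 'k) set \<times> ('b \<times> 'v \<Rightarrow> 'k) set \<Rightarrow> 'b) set"

definition cell_tensor ::
  "('k, 'z) ring_scheme \<Rightarrow> ('k, 'v) module \<Rightarrow> ('k, 'b) module \<Rightarrow> ('b, ('k, 'v, 'b) cell_tensor) module" where
  "cell_tensor K V B = tensor B (cell_Delta K V B) (cell_Delta' K V B)"

text \<open>\<open>v\<^sub>1 \<otimes> b\<^sub>1 \<otimes>\<^sub>B b\<^sub>2 \<otimes> v\<^sub>2\<close>\<close>

definition cell_elem ::
  "('k, 'z) ring_scheme \<Rightarrow> ('k, 'v) module \<Rightarrow> ('k, 'b) module \<Rightarrow> 'v \<Rightarrow> 'b \<Rightarrow> 'b \<Rightarrow> 'v \<Rightarrow>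
   ('k, 'v, 'b) cell_tensor" where
  "cell_elem K V B v1 b1 b2 v2 = pure_tensor B (cell_Delta K V B) (cell_Delta' K V B)
     (pure_tensor K V B v1 b1) (pure_tensor K B V b2 v2)"

definition switch_map ::
  "('k, 'z) ring_scheme \<Rightarrow> ('k, 'v) module \<Rightarrow> ('k, 'b) module \<Rightarrow>
   ('v \<times> 'b \<Rightarrow> 'k) set \<Rightarrow> ('b \<times> 'v \<Rightarrow> 'k) set" where
  "switch_map K V B = tensor_lift V B (tensor K B V) K (\<lambda>v b. pure_tensor K B V b v)"

text \<open>The right action of \<open>a\<close> on \<open>\<Delta>'\<close>, \<open>(b \<otimes> v) a = \<tau> (a\<^sup>* (v \<otimes> b))\<close>, for a left action \<open>act\<close> on \<open>\<Delta>\<close>.\<close>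

definition cell_Delta'_ract ::
  "('k, 'z) ring_scheme \<Rightarrow> ('k, 'v) module \<Rightarrow> ('k, 'b) module \<Rightarrow> ('a \<Rightarrow> 'a) \<Rightarrow>
   ('a \<Rightarrow> ('v \<times> 'b \<Rightarrow> 'k) set \<Rightarrow> ('v \<times> 'b \<Rightarrow> 'k) set) \<Rightarrow>
   'a \<Rightarrow> ('b \<times> 'v \<Rightarrow> 'k) set \<Rightarrow> ('b \<times> 'v \<Rightarrow> 'k) set" where
  "cell_Delta'_ract K V B star act a = tensor_lift B V (tensor K B V) K
     (\<lambda>b v. switch_map K V B (act (star a) (pure_tensor K V B v b)))"

text \<open>The two actions of \<open>a\<close> on \<open>\<Delta> \<otimes>\<^sub>B \<Delta>'\<close>.\<close>

definition cell_tensor_lact ::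
  "('k, 'z) ring_scheme \<Rightarrow> ('k, 'v) module \<Rightarrow> ('k, 'b) module \<Rightarrow>
   ('a \<Rightarrow> ('v \<times> 'b \<Rightarrow> 'k) set \<Rightarrow> ('v \<times> 'b \<Rightarrow> 'k) set) \<Rightarrow>
   'a \<Rightarrow> ('k, 'v, 'b) cell_tensor \<Rightarrow> ('k, 'v, 'b) cell_tensor" where
  "cell_tensor_lact K V B act a =
     tensor_lift (cell_Delta K V B) (cell_Delta' K V B) (cell_tensor K V B) B
       (\<lambda>d d'. pure_tensor B (cell_Delta K V B) (cell_Delta' K V B) (act a d) d')"

definition cell_tensor_ract ::
  "('k, 'z) ring_scheme \<Rightarrow> ('k, 'v) module \<Rightarrow> ('k, 'b) module \<Rightarrow> ('a \<Rightarrow> 'a) \<Rightarrow>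
   ('a \<Rightarrow> ('v \<times> 'b \<Rightarrow> 'k) set \<Rightarrow> ('v \<times> 'b \<Rightarrow> 'k) set) \<Rightarrow>
   'a \<Rightarrow> ('k, 'v, 'b) cell_tensor \<Rightarrow> ('k, 'v, 'b) cell_tensor" where
  "cell_tensor_ract K V B star act a =
     tensor_lift (cell_Delta K V B) (cell_Delta' K V B) (cell_tensor K V B) B
       (\<lambda>d d'. pure_tensor B (cell_Delta K V B) (cell_Delta' K V B) d
                 (cell_Delta'_ract K V B star act a d'))"

text \<open>\<open>act\<close> makes \<open>\<Delta>\<close> an \<open>A\<close>-\<open>B\<close>-bimodule. Bimodules over \<open>K\<close>-algebras are \<open>K\<close>-central: the two
  actions of \<open>K\<close>, through \<open>A\<close> and through \<open>B\<close>, agree.\<close>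

definition cell_bimodule ::
  "('k, 'z) ring_scheme \<Rightarrow> ('k, 'a) module \<Rightarrow> ('k, 'v) module \<Rightarrow> ('k, 'b) module \<Rightarrow>
   ('a \<Rightarrow> ('v \<times> 'b \<Rightarrow> 'k) set \<Rightarrow> ('v \<times> 'b \<Rightarrow> 'k) set) \<Rightarrow> bool" where
  "cell_bimodule K A V B act \<longleftrightarrow>
     left_module A (with_smult (tensor K V B) act) \<and>
     module B (cell_Delta K V B) \<and>
     (\<forall>a\<in>carrier A. \<forall>b\<in>carrier B. \<forall>d\<in>carrier (tensor K V B).
        act a (b \<odot>\<^bsub>cell_Delta K V B\<^esub> d) = b \<odot>\<^bsub>cell_Delta K V B\<^esub> act a d) \<and>
     (\<forall>k\<in>carrier K. \<forall>a\<in>carrier A. \<forall>d\<in>carrier (tensor K V B).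
        act (k \<odot>\<^bsub>A\<^esub> a) d = k \<odot>\<^bsub>tensor K V B\<^esub> act a d)"

text \<open>\<open>J\<close> is an affine cell ideal of \<open>A\<close>, with the data \<open>V, B, \<sigma>\<close>, the left action \<open>act\<close> of \<open>A\<close> on
  \<open>\<Delta>\<close>, and \<open>\<alpha>\<close>.\<close>

definition affine_cell_ideal ::
  "('k, 'z) ring_scheme \<Rightarrow> ('k, 'a) module \<Rightarrow> ('a \<Rightarrow> 'a) \<Rightarrow> 'a set \<Rightarrow>
   ('k, 'v) module \<Rightarrow> ('k, 'b) module \<Rightarrow> ('b \<Rightarrow> 'b) \<Rightarrow>
   ('a \<Rightarrow> ('v \<times> 'b \<Rightarrow> 'k) set \<Rightarrow> ('v \<times> 'b \<Rightarrow> 'k) set) \<Rightarrow>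
   ('a \<Rightarrow> ('k, 'v, 'b) cell_tensor) \<Rightarrow> bool" where
  "affine_cell_ideal K A star J V B \<sigma> act \<alpha> \<longleftrightarrow>
     ideal J A \<and>
     star ` J = J \<and>
     free_of_finite_rank K V \<and> affine_algebra K B \<and> K_involution K B \<sigma> \<and>
     cell_bimodule K A V B act \<and>
     bij_betw \<alpha> J (carrier (cell_tensor K V B)) \<and>
     (\<forall>x\<in>J. \<forall>y\<in>J. \<alpha> (x \<oplus>\<^bsub>A\<^esub> y) = \<alpha> x \<oplus>\<^bsub>cell_tensor K V B\<^esub> \<alpha> y) \<and>
     (\<forall>a\<in>carrier A. \<forall>x\<in>J. \<alpha> (a \<otimes>\<^bsub>A\<^esub> x) = cell_tensor_lact K V B act a (\<alpha> x)) \<and>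
     (\<forall>a\<in>carrier A. \<forall>x\<in>J. \<alpha> (x \<otimes>\<^bsub>A\<^esub> a) = cell_tensor_ract K V B star act a (\<alpha> x)) \<and>
     (\<forall>x\<in>J. \<forall>(l::nat) v1 b1 b2 v2.
        v1 \<in> {..<l} \<rightarrow> carrier V \<and> b1 \<in> {..<l} \<rightarrow> carrier B \<and>
        b2 \<in> {..<l} \<rightarrow> carrier B \<and> v2 \<in> {..<l} \<rightarrow> carrier V \<and>
        \<alpha> x = (\<Oplus>\<^bsub>cell_tensor K V B\<^esub>i\<in>{..<l}. cell_elem K V B (v1 i) (b1 i) (b2 i) (v2 i)) \<longrightarrow>
        \<alpha> (star x) =
          (\<Oplus>\<^bsub>cell_tensor K V B\<^esub>i\<in>{..<l}. cell_elem K V B (v2 i) (\<sigma> (b2 i)) (\<sigma> (b1 i)) (v1 i)))"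

section \<open>Affine cellular algebras\<close>

definition cell_chain :: "('k, 'a) module \<Rightarrow> (nat \<Rightarrow> 'a set) \<Rightarrow> nat \<Rightarrow> 'a set" where
  "cell_chain A J' j = sum_of A {1..j} J'"

text \<open>The layer \<open>J\<^sub>j / J\<^sub>j\<^sub>-\<^sub>1\<close> as a subset of \<open>A / J\<^sub>j\<^sub>-\<^sub>1\<close>.\<close>

definition layer_algebra :: "('k, 'a) module \<Rightarrow> (nat \<Rightarrow> 'a set) \<Rightarrow> nat \<Rightarrow> ('k, 'a set) module" where
  "layer_algebra A J' j = quot_module A (cell_chain A J' (j - 1))"

definition layer_ideal :: "('k, 'a) module \<Rightarrow> (nat \<Rightarrow> 'a set) \<Rightarrow> nat \<Rightarrow> 'a set set" where
  "layer_ideal A J' j = (\<lambda>x. cell_chain A J' (j - 1) +>\<^bsub>A\<^esub> x) ` cell_chain A J' j"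

text \<open>\<open>A\<close> is affine cellular with respect to \<open>star\<close>, with the decomposition \<open>A = J' 1 \<oplus> \<dots> \<oplus> J' m\<close>
  and the cell data \<open>V j, B j, \<sigma> j, act j, \<alpha> j\<close> of the \<open>j\<close>-th layer. The inclusions in the chain are
  strict. The involution induced on a quotient of \<open>A\<close> maps a coset to its image under \<open>star\<close>.\<close>

definition affine_cellular ::
  "('k, 'z) ring_scheme \<Rightarrow> ('k, 'a) module \<Rightarrow> ('a \<Rightarrow> 'a) \<Rightarrow> nat \<Rightarrow> (nat \<Rightarrow> 'a set) \<Rightarrow>
   (nat \<Rightarrow> ('k, 'v) module) \<Rightarrow> (nat \<Rightarrow> ('k, 'b) module) \<Rightarrow> (nat \<Rightarrow> 'b \<Rightarrow> 'b) \<Rightarrow>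
   (nat \<Rightarrow> 'a set \<Rightarrow> ('v \<times> 'b \<Rightarrow> 'k) set \<Rightarrow> ('v \<times> 'b \<Rightarrow> 'k) set) \<Rightarrow>
   (nat \<Rightarrow> 'a set \<Rightarrow> ('k, 'v, 'b) cell_tensor) \<Rightarrow> bool" where
  "affine_cellular K A star m J' V B \<sigma> act \<alpha> \<longleftrightarrow>
     assoc_algebra K A \<and> K_involution K A star \<and> 1 \<le> m \<and>
     (\<forall>j\<in>{1..m}. submodule (J' j) K A \<and> star ` J' j = J' j) \<and>
     is_direct_sum A {1..m} J' \<and>
     (\<forall>j\<in>{1..m}. ideal (cell_chain A J' j) A \<and> cell_chain A J' (j - 1) \<subset> cell_chain A J' j \<and>
        affine_cell_ideal K (layer_algebra A J' j) ((`) star) (layer_ideal A J' j)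
          (V j) (B j) (\<sigma> j) (act j) (\<alpha> j))"

text \<open>\<open>\<phi> : V \<otimes>\<^sub>K V \<rightarrow> B\<close> is the \<open>K\<close>-linear map that describes the multiplication of a cell ideal \<open>J\<close>
  of \<open>A\<close>. The element \<open>u \<otimes> b \<otimes> v\<close> of \<open>V \<otimes>\<^sub>K B \<otimes>\<^sub>K V\<close> corresponds to \<open>u \<otimes> b \<otimes>\<^sub>B 1 \<otimes> v\<close> in
  \<open>\<Delta> \<otimes>\<^sub>B \<Delta>'\<close>.\<close>

definition is_cell_form ::
  "('k, 'z) ring_scheme \<Rightarrow> ('k, 'a) module \<Rightarrow> 'a set \<Rightarrow> ('k, 'v) module \<Rightarrow> ('k, 'b) module \<Rightarrow>
   ('a \<Rightarrow> ('k, 'v, 'b) cell_tensor) \<Rightarrow> (('v \<times> 'v \<Rightarrow> 'k) set \<Rightarrow> 'b) \<Rightarrow> bool" where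
  "is_cell_form K A J V B \<alpha> \<phi> \<longleftrightarrow>
     \<phi> \<in> linear_maps K (tensor K V V) B \<and>
     (\<forall>x\<in>J. \<forall>y\<in>J. \<forall>u\<in>carrier V. \<forall>v\<in>carrier V. \<forall>u'\<in>carrier V. \<forall>v'\<in>carrier V.
        \<forall>b\<in>carrier B. \<forall>b'\<in>carrier B.
        \<alpha> x = cell_elem K V B u b \<one>\<^bsub>B\<^esub> v \<and> \<alpha> y = cell_elem K V B u' b' \<one>\<^bsub>B\<^esub> v' \<longrightarrow>
        \<alpha> (x \<otimes>\<^bsub>A\<^esub> y) =
          cell_elem K V B u (b \<otimes>\<^bsub>B\<^esub> \<phi> (pure_tensor K V V v u') \<otimes>\<^bsub>B\<^esub> b') \<one>\<^bsub>B\<^esub> v')"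

definition matrix_ring :: "('b, 'z) ring_scheme \<Rightarrow> nat \<Rightarrow> (nat \<times> nat \<Rightarrow> 'b) ring" where
  "matrix_ring B n = \<lparr>
     carrier = {1..n} \<times> {1..n} \<rightarrow>\<^sub>E carrier B,
     monoid.mult = (\<lambda>C D. restrict (\<lambda>(i, k). \<Oplus>\<^bsub>B\<^esub>j\<in>{1..n}. C (i, j) \<otimes>\<^bsub>B\<^esub> D (j, k)) ({1..n} \<times> {1..n})),
     one = restrict (\<lambda>(i, k). if i = k then \<one>\<^bsub>B\<^esub> else \<zero>\<^bsub>B\<^esub>) ({1..n} \<times> {1..n}),
     ring.zero = restrict (\<lambda>_. \<zero>\<^bsub>B\<^esub>) ({1..n} \<times> {1..n}),
     ring.add = (\<lambda>C D. restrict (\<lambda>s. C s \<oplus>\<^bsub>B\<^esub> D s) ({1..n} \<times> {1..n}))\<rparr>"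

definition form_matrix ::
  "('k, 'z) ring_scheme \<Rightarrow> ('k, 'v) module \<Rightarrow> nat \<Rightarrow> (nat \<Rightarrow> 'v) \<Rightarrow>
   (('v \<times> 'v \<Rightarrow> 'k) set \<Rightarrow> 'b) \<Rightarrow> nat \<times> nat \<Rightarrow> 'b" where
  "form_matrix K V n v \<phi> =
     restrict (\<lambda>(s, t). \<phi> (pure_tensor K V V (v s) (v t))) ({1..n} \<times> {1..n})"

section \<open>Spectra\<close>

definition Spec :: "('b, 'z) ring_scheme \<Rightarrow> 'b set set" where
  "Spec R = {P. primeideal P R}"

definition reduced_ring :: "('b, 'z) ring_scheme \<Rightarrow> bool" where
  "reduced_ring R \<longleftrightarrow> (\<forall>x\<in>carrier R. \<forall>l::nat. x [^]\<^bsub>R\<^esub> l = \<zero>\<^bsub>R\<^esub> \<longrightarrow> x = \<zero>\<^bsub>R\<^esub>)"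

text \<open>The supremum is taken in the extended reals, so the zero ring has dimension \<open>-\<infinity>\<close>.\<close>

definition krull_dim :: "('b, 'z) ring_scheme \<Rightarrow> ereal" where
  "krull_dim R = Sup {ereal (real l) | l P.
     (\<forall>i\<le>l. P i \<in> Spec R) \<and> (\<forall>i<l. P i \<subset> P (Suc i))}"

text \<open>The product \<open>B\<^sub>1 \<times> \<dots> \<times> B\<^sub>m\<close>, whose spectrum is \<open>Spec[A]\<close>.\<close>

definition spec_algebra :: "nat \<Rightarrow> (nat \<Rightarrow> ('k, 'b) module) \<Rightarrow> 'b list ring" where
  "spec_algebra m B = RDirProd_list (map B [1..<Suc m])"

end

theory Submission
  imports Defs
begin

text \<open>
  Write \<open>\<Phi>\<close> for the matrix of \<open>\<phi>\<^sub>j\<close> and \<open>n\<close>, \<open>B\<close> for the rank and the algebra of the \<open>j\<close>-th layer. In the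
  basis \<open>v\<^sub>1, \<dots>, v\<^sub>n\<close> the layer \<open>J\<^sub>j / J\<^sub>j\<^sub>-\<^sub>1\<close> becomes the set of \<open>n \<times> n\<close> matrices over \<open>B\<close> with the
  multiplication \<open>X \<Phi> Y\<close> (locale \<open>matrix_layer\<close>, theorem \<open>cell_layer_matrix_layer\<close>). Semisimplicity
  is compared with von Neumann regularity, the property that every \<open>x\<close> has some \<open>y\<close> with \<open>x y x = x\<close>,
  and with the property that every left ideal contains a right identity of itself.

  Let \<open>A\<close> be semisimple. The left ideal \<open>A a\<close> has a complement, so \<open>A\<close> is von Neumann regular
  (\<open>semisimple_imp_vn_regular\<close>). Regularity passes to the layers, where it says that each matrix \<open>X\<close>
  is of the form \<open>X \<Phi> Y \<Phi> X\<close>. For \<open>X = 1\<close> this is \<open>1 = \<Phi> Y \<Phi>\<close>, so \<open>\<Phi>\<close> is invertible; for \<open>X\<close> with the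
  only entry \<open>b\<close> it shows that \<open>B\<close> is regular. A commutative ring is regular and nonzero if and only
  if it is reduced of dimension \<open>0\<close> (\<open>reduced_dim_0_iff_vn_regular\<close>), and a product of rings is
  regular if and only if the factors are.

  For the converse let every \<open>B\<close> be regular and every \<open>\<Phi>\<close> invertible. By Hilbert's basis theorem \<open>B\<close>
  is Noetherian, and in a regular Noetherian ring every ideal contains an identity of itself. Between
  \<open>J\<^sub>j\<^sub>-\<^sub>1\<close> and \<open>J\<^sub>j\<close> lie the left ideals of those elements whose matrices live in the first \<open>k\<close> columns.
  A left ideal \<open>L\<close> of \<open>A\<close> contained in the \<open>k\<close>-th of them induces a set of \<open>k\<close>-th columns; as \<open>\<Phi>\<close> is
  invertible, this set is stable under all of \<open>M\<^sub>n(B)\<close>, so it consists of all columns with entries in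
  some ideal of \<open>B\<close>. The identity of that ideal gives an element of \<open>L\<close> that is a right identity of
  \<open>L\<close> modulo the previous left ideal (\<open>right_ones_lift\<close>), and such approximate right identities
  can be glued along the chain (\<open>right_one_step\<close>). Hence every left ideal of \<open>A\<close> has a right identity. Then
  ascending chains of left ideals are stationary and every left ideal has a complement, from which a
  decomposition into minimal left ideals is obtained (\<open>right_ones_imp_semisimple\<close>).
\<close>

section \<open>Regular commutative rings and dimension zero\<close>

definition vn_regular :: "('a, 'z) ring_scheme \<Rightarrow> bool" where
  "vn_regular R \<longleftrightarrow> (\<forall>x\<in>carrier R. \<exists>y\<in>carrier R. x \<otimes>\<^bsub>R\<^esub> y \<otimes>\<^bsub>R\<^esub> x = x)"

lemma (in cring) mem_add_principal_ideal:
  assumes "ideal P R" "a \<in> carrier R"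
  shows "z \<in> P <+>\<^bsub>R\<^esub> PIdl a \<longleftrightarrow> (\<exists>p\<in>P. \<exists>r\<in>carrier R. z = p \<oplus> r \<otimes> a)"
  unfolding set_add_def' cgenideal_def by auto

lemma (in cring) ideal_add_principal:
  assumes "ideal P R" "a \<in> carrier R"
  shows "ideal (P <+>\<^bsub>R\<^esub> PIdl a) R" "P \<subseteq> P <+>\<^bsub>R\<^esub> PIdl a" "a \<in> P <+>\<^bsub>R\<^esub> PIdl a"
proof -
  interpret P: ideal P R by fact
  show "ideal (P <+>\<^bsub>R\<^esub> PIdl a) R"
    using add_ideals[OF assms(1) cgenideal_ideal[OF assms(2)]] .
  show "P \<subseteq> P <+>\<^bsub>R\<^esub> PIdl a"
  proof
    fix p assume "p \<in> P"
    then have "p = p \<oplus> \<zero> \<otimes> a" using assms(2) P.a_Hcarr by simp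
    with \<open>p \<in> P\<close> show "p \<in> P <+>\<^bsub>R\<^esub> PIdl a"
      unfolding mem_add_principal_ideal[OF assms] by blast
  qed
  have "a = \<zero> \<oplus> \<one> \<otimes> a" using assms(2) by simp
  moreover have "\<zero> \<in> P" by (rule additive_subgroup.zero_closed[OF P.is_additive_subgroup])
  ultimately show "a \<in> P <+>\<^bsub>R\<^esub> PIdl a"
    unfolding mem_add_principal_ideal[OF assms] by blast
qed

text \<open>An ideal \<open>P\<close> that is maximal among those that contain \<open>I\<close> and miss \<open>S\<close> is prime: if \<open>a\<close> and
  \<open>b\<close> lie outside \<open>P\<close>, then \<open>P + (a)\<close> and \<open>P + (b)\<close> both meet \<open>S\<close>, and the product of an element of
  \<open>S\<close> in the one and an element of \<open>S\<close> in the other lies in \<open>P + (a b)\<close>.\<close>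

lemma (in cring) prime_avoiding_multiplicative_set:
  assumes I: "ideal I R" and S: "S \<subseteq> carrier R" "\<one> \<in> S" "\<And>x y. \<lbrakk>x \<in> S; y \<in> S\<rbrakk> \<Longrightarrow> x \<otimes> y \<in> S"
    and "I \<inter> S = {}"
  obtains P where "primeideal P R" "I \<subseteq> P" "P \<inter> S = {}"
proof -
  define F where "F = {J. ideal J R \<and> I \<subseteq> J \<and> J \<inter> S = {}}"
  have "\<exists>M\<in>F. \<forall>Y\<in>F. M \<subseteq> Y \<longrightarrow> Y = M"
  proof (rule subset_Zorn_nonempty)
    show "F \<noteq> {}" using assms unfolding F_def by blast
    fix C assume C: "C \<noteq> {}" "subset.chain F C"
    then have "subset.chain {J. ideal J R} C" unfolding pred_on.chain_def F_def by blast
    then have "ideal (\<Union>C) R" using chain_Union_is_ideal[of C] C(1) by simp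
    moreover have "I \<subseteq> \<Union>C" "\<Union>C \<inter> S = {}"
      using C unfolding pred_on.chain_def F_def by blast+
    ultimately show "\<Union>C \<in> F" unfolding F_def by blast
  qed
  then obtain P where P: "P \<in> F" and max: "\<And>Y. \<lbrakk>Y \<in> F; P \<subseteq> Y\<rbrakk> \<Longrightarrow> Y = P" by blast
  then have iP: "ideal P R" and IP: "I \<subseteq> P" and PS: "P \<inter> S = {}" unfolding F_def by auto
  interpret P: ideal P R by fact
  have meets: "\<exists>p\<in>P. \<exists>r\<in>carrier R. p \<oplus> r \<otimes> a \<in> S" if a: "a \<in> carrier R" "a \<notin> P" for a
  proof -
    have "P <+>\<^bsub>R\<^esub> PIdl a \<noteq> P" using ideal_add_principal[OF iP a(1)] a(2) by blast
    then have "P <+>\<^bsub>R\<^esub> PIdl a \<notin> F" using max ideal_add_principal[OF iP a(1)] by blast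
    then have "(P <+>\<^bsub>R\<^esub> PIdl a) \<inter> S \<noteq> {}"
      using ideal_add_principal[OF iP a(1)] IP unfolding F_def by blast
    then obtain z where "z \<in> P <+>\<^bsub>R\<^esub> PIdl a" "z \<in> S" by blast
    then show ?thesis unfolding mem_add_principal_ideal[OF iP a(1)] by blast
  qed
  have "primeideal P R"
  proof (rule primeidealI[OF iP is_cring])
    show "carrier R \<noteq> P" using S(2) PS by auto
    fix a b assume a: "a \<in> carrier R" and b: "b \<in> carrier R" and ab: "a \<otimes> b \<in> P"
    show "a \<in> P \<or> b \<in> P"
    proof (rule ccontr)
      assume "\<not> (a \<in> P \<or> b \<in> P)"
      then obtain p r q s where pq: "p \<in> P" "q \<in> P" "r \<in> carrier R" "s \<in> carrier R"
        and S': "p \<oplus> r \<otimes> a \<in> S" "q \<oplus> s \<otimes> b \<in> S" using meets[OF a] meets[OF b] by blast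
      have carr: "p \<in> carrier R" "q \<in> carrier R" using pq P.a_Hcarr by auto
      have "(p \<oplus> r \<otimes> a) \<otimes> (q \<oplus> s \<otimes> b) = p \<otimes> (q \<oplus> s \<otimes> b) \<oplus> ((r \<otimes> a) \<otimes> q \<oplus> (r \<otimes> s) \<otimes> (a \<otimes> b))"
        using carr pq a b by algebra
      also have "\<dots> \<in> P"
        using pq carr a b ab by (intro P.a_closed) (auto intro: P.I_l_closed P.I_r_closed)
      finally show False using S(3)[OF S'] PS by blast
    qed
  qed
  with IP PS that show thesis by blast
qed

text \<open>If \<open>x = x y x\<close>, then \<open>x (1 - x y) = 0\<close> lies in every prime. A prime that does not contain \<open>x\<close>
  therefore contains \<open>1 - x y\<close>, and no proper ideal above it can contain \<open>x\<close>.\<close>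

lemma (in cring) vn_regular_prime_not_less:
  assumes "vn_regular R" "primeideal P R" "primeideal Q R"
  shows "\<not> P \<subset> Q"
proof
  assume PQ: "P \<subset> Q"
  interpret P: primeideal P R by fact
  interpret Q: primeideal Q R by fact
  obtain x where x: "x \<in> Q" "x \<notin> P" using PQ by blast
  then have xc: "x \<in> carrier R" using Q.a_Hcarr by blast
  then obtain y where y: "y \<in> carrier R" "x \<otimes> y \<otimes> x = x" using assms(1) unfolding vn_regular_def by blast
  have "x \<otimes> (\<one> \<ominus> x \<otimes> y) = x \<ominus> x \<otimes> y \<otimes> x" using xc y by algebra
  also have "\<dots> = \<zero>" using xc y by (simp add: r_neg minus_eq)
  finally have "\<one> \<ominus> x \<otimes> y \<in> P" using P.I_prime[OF xc, of "\<one> \<ominus> x \<otimes> y"] x xc y by auto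
  then have 1: "\<one> \<ominus> x \<otimes> y \<in> Q" using PQ by blast
  have "x \<otimes> y \<in> Q" using Q.I_r_closed x y by blast
  then have "(\<one> \<ominus> x \<otimes> y) \<oplus> x \<otimes> y \<in> Q" using 1 by blast
  moreover have "(\<one> \<ominus> x \<otimes> y) \<oplus> x \<otimes> y = \<one>" using xc y by algebra
  ultimately show False using Q.I_notcarr Q.I_l_closed
    by (metis Q.a_subset r_one subsetI subset_antisym)
qed

text \<open>Iterating \<open>x = x y x\<close> gives \<open>x = x\<^sup>k y\<^sup>k x\<close> for every \<open>k\<close>.\<close>

lemma (in cring) vn_regular_reduced:
  assumes "vn_regular R" shows "reduced_ring R"
  unfolding reduced_ring_def
proof (intro ballI allI impI)
  fix x and l :: nat assume x: "x \<in> carrier R" and l: "x [^] l = \<zero>"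
  obtain y where y: "y \<in> carrier R" "x \<otimes> y \<otimes> x = x" using assms x unfolding vn_regular_def by blast
  have "x = x [^] k \<otimes> y [^] k \<otimes> x" for k :: nat
  proof (induct k)
    case 0 show ?case using x by simp
  next
    case (Suc k)
    have "x = x [^] k \<otimes> y [^] k \<otimes> (x \<otimes> y \<otimes> x)" using Suc y(2) by simp
    also have "\<dots> = (x [^] k \<otimes> x) \<otimes> (y [^] k \<otimes> y) \<otimes> x"
      using x y(1) nat_pow_closed[OF x, of k] nat_pow_closed[OF y(1), of k] by algebra
    finally show ?case by simp
  qed
  from this[of l] show "x = \<zero>" using l x y(1) by simp
qed

text \<open>Fix \<open>x\<close> and consider the multiplicative set of all \<open>x\<^sup>k (1 - x b)\<close>. Let \<open>P\<close> be a prime that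
  misses it. Then \<open>P + (x)\<close> is proper, since \<open>1 = p + r x\<close> would put \<open>p = 1 - x r\<close> into the set, so
  \<open>P\<close> lies strictly below a prime that contains \<open>x\<close>. If there are no inclusions among primes, the set
  therefore contains \<open>0\<close>, and in a reduced ring \<open>x\<^sup>k (1 - x b) = 0\<close> implies \<open>x (1 - x b) = 0\<close>.\<close>

lemma (in cring) reduced_zero_dimensional_imp_vn_regular:
  assumes red: "reduced_ring R"
    and dim: "\<And>P Q. \<lbrakk>primeideal P R; primeideal Q R\<rbrakk> \<Longrightarrow> \<not> P \<subset> Q"
  shows "vn_regular R"
  unfolding vn_regular_def
proof
  fix x assume x: "x \<in> carrier R"
  define S where "S = {x [^] k \<otimes> (\<one> \<ominus> x \<otimes> b) | k b. k \<in> (UNIV :: nat set) \<and> b \<in> carrier R}"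
  have mult: "(p \<otimes> (\<one> \<ominus> x \<otimes> b)) \<otimes> (q \<otimes> (\<one> \<ominus> x \<otimes> c)) = (p \<otimes> q) \<otimes> (\<one> \<ominus> x \<otimes> (b \<oplus> c \<ominus> x \<otimes> b \<otimes> c))"
    if "p \<in> carrier R" "q \<in> carrier R" "b \<in> carrier R" "c \<in> carrier R" for p q b c
    using that x by algebra
  have "\<zero> \<in> S"
  proof (rule ccontr)
    assume "\<zero> \<notin> S"
    then have "{\<zero>} \<inter> S = {}" by simp
    moreover have "\<one> \<in> S"
    proof -
      have "\<one> = x [^] (0::nat) \<otimes> (\<one> \<ominus> x \<otimes> \<zero>)" using x by (simp add: minus_eq)
      then show ?thesis unfolding S_def by blast
    qed
    moreover have "u \<otimes> v \<in> S" if "u \<in> S" "v \<in> S" for u v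
    proof -
      from that obtain k b l c where u: "u = x [^] k \<otimes> (\<one> \<ominus> x \<otimes> b)" "b \<in> carrier R"
        and v: "v = x [^] l \<otimes> (\<one> \<ominus> x \<otimes> c)" "c \<in> carrier R"
        and kl: "k \<in> (UNIV :: nat set)" "l \<in> (UNIV :: nat set)"
        unfolding S_def by auto
      have "u \<otimes> v = (x [^] k \<otimes> x [^] l) \<otimes> (\<one> \<ominus> x \<otimes> (b \<oplus> c \<ominus> x \<otimes> b \<otimes> c))"
        unfolding u v by (rule mult[OF _ _ u(2) v(2)]) (use x in auto)
      also have "x [^] k \<otimes> x [^] l = x [^] (k + l)" using x by (simp add: nat_pow_mult)
      finally show ?thesis unfolding S_def using x u(2) v(2) by blast
    qed
    moreover have "S \<subseteq> carrier R" unfolding S_def using x by auto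
    ultimately obtain P where P: "primeideal P R" "P \<inter> S = {}"
      using prime_avoiding_multiplicative_set[OF zeroideal, of S] by metis
    interpret P: primeideal P R by fact
    have iP: "ideal P R" by (rule P.is_ideal)
    have xP: "x \<notin> P"
    proof
      assume "x \<in> P"
      then have "x [^] (1::nat) \<otimes> (\<one> \<ominus> x \<otimes> \<zero>) \<in> P" using x by (simp add: minus_eq)
      moreover have "x [^] (1::nat) \<otimes> (\<one> \<ominus> x \<otimes> \<zero>) \<in> S" unfolding S_def by blast
      ultimately show False using P(2) by blast
    qed
    have "\<one> \<notin> P <+>\<^bsub>R\<^esub> PIdl x"
    proof
      assume "\<one> \<in> P <+>\<^bsub>R\<^esub> PIdl x"
      then obtain p r where pr: "p \<in> P" "r \<in> carrier R" "\<one> = p \<oplus> r \<otimes> x"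
        using mem_add_principal_ideal[OF iP x] by blast
      have pc: "p \<in> carrier R" using pr(1) P.a_Hcarr by blast
      have "p = (p \<oplus> r \<otimes> x) \<ominus> x \<otimes> r" using pc pr(2) x by algebra
      also have "\<dots> = x [^] (0::nat) \<otimes> (\<one> \<ominus> x \<otimes> r)" unfolding pr(3)[symmetric] using pr(2) x
        by (metis l_one m_closed minus_closed nat_pow_0 one_closed)
      finally have "p \<in> S" unfolding S_def using pr(2) by blast
      then show False using pr(1) P(2) by blast
    qed
    then have "(P <+>\<^bsub>R\<^esub> PIdl x) \<inter> {\<one>} = {}" by blast
    then obtain Q where Q: "primeideal Q R" "P <+>\<^bsub>R\<^esub> PIdl x \<subseteq> Q"
      using prime_avoiding_multiplicative_set[OF ideal_add_principal(1)[OF iP x], of "{\<one>}"] by auto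
    then have "P \<subset> Q" using ideal_add_principal(2,3)[OF iP x] xP by blast
    then show False using dim[OF P(1) Q(1)] by blast
  qed
  then obtain k b where kb: "b \<in> carrier R" "x [^] (k::nat) \<otimes> (\<one> \<ominus> x \<otimes> b) = \<zero>"
    unfolding S_def by auto
  let ?z = "x \<otimes> (\<one> \<ominus> x \<otimes> b)"
  have "?z [^] Suc k = x [^] Suc k \<otimes> (\<one> \<ominus> x \<otimes> b) [^] Suc k"
    using x kb(1) by (intro nat_pow_distrib) auto
  also have "\<dots> = (x [^] k \<otimes> (\<one> \<ominus> x \<otimes> b)) \<otimes> (x \<otimes> (\<one> \<ominus> x \<otimes> b) [^] k)"
    using x kb(1) nat_pow_closed[OF x, of k] nat_pow_closed[of "\<one> \<ominus> x \<otimes> b" k]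
    by (simp add: m_ac)
  also have "\<dots> = \<zero>" using kb x by simp
  finally have "?z = \<zero>" using red x kb(1) unfolding reduced_ring_def by blast
  moreover have "x \<otimes> b \<otimes> x = x \<ominus> ?z" using x kb(1) by algebra
  ultimately have "x \<otimes> b \<otimes> x = x" using x by (simp add: minus_eq)
  then show "\<exists>y\<in>carrier R. x \<otimes> y \<otimes> x = x" using kb(1) by blast
qed

text \<open>Dimension \<open>0\<close> includes the existence of a prime, because the supremum over no chains at all is
  \<open>-\<infinity>\<close>.\<close>

lemma krull_dim_eq_0_iff:
  "krull_dim R = 0 \<longleftrightarrow> Spec R \<noteq> {} \<and> (\<forall>P\<in>Spec R. \<forall>Q\<in>Spec R. \<not> P \<subset> Q)"
proof
  let ?L = "{ereal (real l) | l P. (\<forall>i\<le>l. P i \<in> Spec R) \<and> (\<forall>i<l. P i \<subset> P (Suc i))}"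
  assume k: "krull_dim R = 0"
  have "Spec R \<noteq> {}"
  proof
    assume "Spec R = {}"
    then have "?L = {}" by auto
    then have "Sup ?L = -\<infinity>" by (simp only: Sup_empty bot_ereal_def)
    then show False using k unfolding krull_dim_def by simp
  qed
  moreover have "\<not> P \<subset> Q" if "P \<in> Spec R" "Q \<in> Spec R" for P Q
  proof
    assume "P \<subset> Q"
    then have "ereal (real 1) \<in> ?L" using that
      by (intro CollectI exI[of _ 1] exI[of _ "\<lambda>i. if i = 0 then P else Q"]) (auto simp: le_Suc_eq)
    then have "ereal (real 1) \<le> Sup ?L" by (rule Sup_upper)
    then show False using k unfolding krull_dim_def by simp
  qed
  ultimately show "Spec R \<noteq> {} \<and> (\<forall>P\<in>Spec R. \<forall>Q\<in>Spec R. \<not> P \<subset> Q)" by blast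
next
  let ?L = "{ereal (real l) | l P. (\<forall>i\<le>l. P i \<in> Spec R) \<and> (\<forall>i<l. P i \<subset> P (Suc i))}"
  assume a: "Spec R \<noteq> {} \<and> (\<forall>P\<in>Spec R. \<forall>Q\<in>Spec R. \<not> P \<subset> Q)"
  then obtain P0 where P0: "P0 \<in> Spec R" by blast
  have "?L = {0}"
  proof (intro subset_antisym subsetI)
    fix z assume "z \<in> ?L"
    then obtain l and P :: "nat \<Rightarrow> _" where lP: "z = ereal (real l)" "\<forall>i\<le>l. P i \<in> Spec R" "\<forall>i<l. P i \<subset> P (Suc i)"
      by auto
    have "l = 0"
    proof (rule ccontr)
      assume "l \<noteq> 0"
      then have "P 0 \<in> Spec R" "P 1 \<in> Spec R" "P 0 \<subset> P 1" using lP by auto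
      then show False using a by blast
    qed
    then show "z \<in> {0}" using lP(1) by simp
  next
    fix z :: ereal assume "z \<in> {0}"
    then show "z \<in> ?L" using P0 by (intro CollectI exI[of _ 0] exI[of _ "\<lambda>_. P0"]) auto
  qed
  then show "krull_dim R = 0" unfolding krull_dim_def by simp
qed

proposition (in cring) reduced_dim_0_iff_vn_regular:
  "reduced_ring R \<and> krull_dim R = 0 \<longleftrightarrow> vn_regular R \<and> carrier R \<noteq> {\<zero>}"
proof
  assume a: "reduced_ring R \<and> krull_dim R = 0"
  then have "vn_regular R"
    by (intro reduced_zero_dimensional_imp_vn_regular) (simp_all add: krull_dim_eq_0_iff Spec_def)
  moreover obtain P where "primeideal P R" using a unfolding krull_dim_eq_0_iff Spec_def by blast
  then interpret P: primeideal P R .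
  have "\<zero> \<in> P" by (rule additive_subgroup.zero_closed[OF P.is_additive_subgroup])
  then have "carrier R \<noteq> {\<zero>}" using P.I_notcarr P.a_subset by (metis insert_absorb insert_not_empty subset_singletonD)
  ultimately show "vn_regular R \<and> carrier R \<noteq> {\<zero>}" by blast
next
  assume a: "vn_regular R \<and> carrier R \<noteq> {\<zero>}"
  then have "{\<zero>} \<inter> {\<one>} = {}" using carrier_one_zero by auto
  then obtain P where "primeideal P R"
    using prime_avoiding_multiplicative_set[OF zeroideal, of "{\<one>}"] by auto
  then have "Spec R \<noteq> {}" unfolding Spec_def by blast
  moreover have "\<forall>P\<in>Spec R. \<forall>Q\<in>Spec R. \<not> P \<subset> Q"
    using a vn_regular_prime_not_less unfolding Spec_def by simp
  ultimately have "krull_dim R = 0" unfolding krull_dim_eq_0_iff by (rule conjI)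
  with a show "reduced_ring R \<and> krull_dim R = 0" using vn_regular_reduced by simp
qed

lemma RDirProd_cring:
  assumes "cring R" "cring S" shows "cring (RDirProd R S)"
proof -
  interpret R: cring R by fact
  interpret S: cring S by fact
  show ?thesis
    by (intro cring.intro comm_monoid.intro comm_monoid_axioms.intro RDirProd_ring
          ring.is_monoid R.ring_axioms S.ring_axioms)
       (auto simp: RDirProd_def DirProd_def monoid.defs R.m_comm S.m_comm)
qed

lemma ring_iso_vn_regular:
  assumes "h \<in> ring_iso R S" "vn_regular R" "ring R" shows "vn_regular S"
  unfolding vn_regular_def
proof
  fix x' assume "x' \<in> carrier S"
  then obtain x where x: "x \<in> carrier R" "x' = h x"
    using assms(1) unfolding ring_iso_def bij_betw_def by blast
  then obtain y where y: "y \<in> carrier R" "x \<otimes>\<^bsub>R\<^esub> y \<otimes>\<^bsub>R\<^esub> x = x" and xy: "x \<otimes>\<^bsub>R\<^esub> y \<in> carrier R"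
    using assms(2,3) unfolding vn_regular_def by (blast intro: monoid.m_closed ring.is_monoid)
  note h = ring_iso_memE[OF assms(1)]
  have "x' \<otimes>\<^bsub>S\<^esub> h y \<otimes>\<^bsub>S\<^esub> x' = x'"
    using h(2)[OF x(1) y(1)] h(2)[OF xy x(1)] x(2) y(2) by simp
  then show "\<exists>y\<in>carrier S. x' \<otimes>\<^bsub>S\<^esub> y \<otimes>\<^bsub>S\<^esub> x' = x'" using h(1)[OF y(1)] by blast
qed

lemma RDirProd_vn_regular_iff:
  assumes "carrier R \<noteq> {}" "carrier S \<noteq> {}"
  shows "vn_regular (RDirProd R S) \<longleftrightarrow> vn_regular R \<and> vn_regular S"
proof -
  have "vn_regular (RDirProd R S) \<longleftrightarrow> (\<forall>x\<in>carrier R. \<forall>x'\<in>carrier S.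
      \<exists>y\<in>carrier R. \<exists>y'\<in>carrier S. x \<otimes>\<^bsub>R\<^esub> y \<otimes>\<^bsub>R\<^esub> x = x \<and> x' \<otimes>\<^bsub>S\<^esub> y' \<otimes>\<^bsub>S\<^esub> x' = x')"
    unfolding vn_regular_def RDirProd_def DirProd_def by (simp add: monoid.defs)
  moreover obtain r s where "r \<in> carrier R" "s \<in> carrier S" using assms by blast
  ultimately show ?thesis unfolding vn_regular_def by (meson)
qed

lemma RDirProd_list_vn_regular_iff:
  assumes "\<And>R. R \<in> set Rs \<Longrightarrow> cring R"
  shows "cring (RDirProd_list Rs) \<and> (vn_regular (RDirProd_list Rs) \<longleftrightarrow> (\<forall>R\<in>set Rs. vn_regular R))"
  using assms
proof (induct Rs)
  case Nil
  have "cring nil_ring" by (unfold_locales, auto simp add: monoid.defs Units_def)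
  then show ?case by (simp add: vn_regular_def monoid.defs)
next
  case (Cons R Rs)
  then interpret R: cring R by simp
  interpret S: cring "RDirProd_list Rs" using Cons by simp
  let ?P = "RDirProd R (RDirProd_list Rs)" and ?L = "RDirProd_list (R # Rs)"
  have "cring ?P" by (intro RDirProd_cring R.cring_axioms S.cring_axioms)
  then interpret P: cring ?P .
  have iso: "(\<lambda>(a, as). a # as) \<in> ring_iso ?P ?L" by (rule RDirProd_list_iso1)
  have "(\<lambda>(a, as). a # as) \<zero>\<^bsub>?P\<^esub> = \<zero>\<^bsub>?L\<^esub>"
    by (simp add: RDirProd_list_zero' RDirProd_def DirProd_def monoid.defs)
  then have "cring ?L" using P.ring_iso_imp_img_cring[OF iso] by simp
  have "vn_regular ?L \<longleftrightarrow> vn_regular ?P"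
    using ring_iso_vn_regular[OF iso _ P.ring_axioms] cring.axioms(1)[OF \<open>cring ?L\<close>]
      ring_iso_vn_regular[OF ring_iso_set_sym[OF P.ring_axioms iso]] by blast
  moreover have "vn_regular ?P \<longleftrightarrow> vn_regular R \<and> vn_regular (RDirProd_list Rs)"
    by (rule RDirProd_vn_regular_iff) blast+
  ultimately show ?case using Cons \<open>cring ?L\<close> by simp
qed

section \<open>Noetherian rings and affine algebras\<close>

text \<open>Linear combinations are generated inductively, so that no sums over index sets are needed.\<close>

inductive_set (in cring) lin_span :: "'a set \<Rightarrow> 'a set \<Rightarrow> 'a set" for S G where
  zero: "\<zero> \<in> lin_span S G"
| step: "\<lbrakk>s \<in> S; g \<in> G; x \<in> lin_span S G\<rbrakk> \<Longrightarrow> s \<otimes> g \<oplus> x \<in> lin_span S G"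

text \<open>Finite generation is asked for arbitrary subsets \<open>G\<close> instead of ideals, so that the generators can
  be taken from a given generating set of an ideal.\<close>

definition (in cring) noetherian_subring :: "'a set \<Rightarrow> bool" where
  "noetherian_subring S \<longleftrightarrow> (\<forall>G\<subseteq>S. \<exists>F. finite F \<and> F \<subseteq> G \<and> G \<subseteq> lin_span S F)"

text \<open>The values at \<open>x\<close> of the polynomials over \<open>S\<close> of degree less than \<open>n\<close>. As \<open>x\<close> need not be
  transcendental, an element can have several expressions; its degree is the least possible one.\<close>

primrec (in cring) poly_expr :: "'a set \<Rightarrow> 'a \<Rightarrow> nat \<Rightarrow> 'a set" where
  "poly_expr S x 0 = {\<zero>}"
| "poly_expr S x (Suc n) = {p \<oplus> s \<otimes> x [^] n | p s. p \<in> poly_expr S x n \<and> s \<in> S}"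

inductive_set (in cring) adjoin :: "'a set \<Rightarrow> 'a set \<Rightarrow> 'a set" for S Y where
  base: "s \<in> S \<Longrightarrow> s \<in> adjoin S Y"
| add: "\<lbrakk>a \<in> adjoin S Y; b \<in> adjoin S Y\<rbrakk> \<Longrightarrow> a \<oplus> b \<in> adjoin S Y"
| mult: "\<lbrakk>a \<in> adjoin S Y; y \<in> Y\<rbrakk> \<Longrightarrow> a \<otimes> y \<in> adjoin S Y"

context cring
begin

lemma lin_span_carrier:
  assumes "S \<subseteq> carrier R" "G \<subseteq> carrier R"
  shows "lin_span S G \<subseteq> carrier R"
proof
  fix x assume "x \<in> lin_span S G"
  then show "x \<in> carrier R" using assms by induct auto
qed

lemma lin_span_mono: "G \<subseteq> H \<Longrightarrow> lin_span S G \<subseteq> lin_span S H"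
proof
  fix x assume "G \<subseteq> H" "x \<in> lin_span S G"
  from this(2,1) show "x \<in> lin_span S H" by induct (auto intro: lin_span.intros)
qed

lemma lin_span_add:
  assumes "S \<subseteq> carrier R" "G \<subseteq> carrier R" "x \<in> lin_span S G" "y \<in> lin_span S G"
  shows "x \<oplus> y \<in> lin_span S G"
  using assms(3)
proof induct
  case zero
  then show ?case using assms lin_span_carrier[OF assms(1,2)] by auto
next
  case (step s g x)
  then have "(s \<otimes> g \<oplus> x) \<oplus> y = s \<otimes> g \<oplus> (x \<oplus> y)"
    using assms lin_span_carrier[OF assms(1,2)] by (intro a_assoc) auto
  with step show ?case by (simp add: lin_span.step)
qed

lemma lin_span_smult:
  assumes S: "subring S R" and G: "G \<subseteq> carrier R" and "s \<in> S" "x \<in> lin_span S G"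
  shows "s \<otimes> x \<in> lin_span S G"
  using assms(4)
proof induct
  note Sc = subringE(1)[OF S]
  case zero
  show ?case using assms(3) Sc by (simp add: lin_span.zero subset_iff)
next
  note Sc = subringE(1)[OF S]
  case (step t g x)
  then have c: "s \<in> carrier R" "t \<in> carrier R" "g \<in> carrier R" "x \<in> carrier R"
    using assms Sc lin_span_carrier[OF Sc G] by auto
  then have "s \<otimes> (t \<otimes> g \<oplus> x) = (s \<otimes> t) \<otimes> g \<oplus> s \<otimes> x" by algebra
  with step show ?case using subringE(6)[OF S assms(3) step(1)] by (simp add: lin_span.step)
qed

lemma lin_span_base:
  assumes S: "subring S R" and G: "G \<subseteq> carrier R" and "g \<in> G"
  shows "g \<in> lin_span S G"
proof -
  have "\<one> \<otimes> g \<oplus> \<zero> \<in> lin_span S G" using assms subringE(3)[OF S] by (blast intro: lin_span.intros)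
  then show ?thesis using assms by auto
qed

lemma lin_span_trans:
  assumes S: "subring S R" and G: "G \<subseteq> carrier R" and H: "H \<subseteq> lin_span S G"
  shows "lin_span S H \<subseteq> lin_span S G"
proof
  fix x assume "x \<in> lin_span S H"
  then show "x \<in> lin_span S G"
    by induct (use assms in \<open>auto intro!: lin_span.zero lin_span_add lin_span_smult dest: subringE(1)\<close>)
qed

lemma lin_span_finite_support:
  assumes "finite F" "F \<subseteq> lin_span S G"
  shows "\<exists>F'. finite F' \<and> F' \<subseteq> G \<and> F \<subseteq> lin_span S F'"
  using assms
proof induct
  case empty
  then show ?case by blast
next
  have single: "\<exists>F'. finite F' \<and> F' \<subseteq> G \<and> x \<in> lin_span S F'" if "x \<in> lin_span S G" for x
    using that
  proof induct
    case zero
    then show ?case by (auto intro: lin_span.zero)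
  next
    case (step s g x)
    then obtain F' where F': "finite F'" "F' \<subseteq> G" "x \<in> lin_span S F'" by blast
    then have "s \<otimes> g \<oplus> x \<in> lin_span S (insert g F')"
      using step lin_span_mono[of F' "insert g F'"] by (blast intro: lin_span.step)
    then show ?case using F' step by (meson finite.insertI insert_subset)
  qed
  case (insert x F)
  then obtain F1 F2 where "finite F1" "F1 \<subseteq> G" "F \<subseteq> lin_span S F1"
    and "finite F2" "F2 \<subseteq> G" "x \<in> lin_span S F2" using single[of x] by auto
  moreover have "lin_span S F1 \<subseteq> lin_span S (F1 \<union> F2)" "lin_span S F2 \<subseteq> lin_span S (F1 \<union> F2)"
    by (intro lin_span_mono; blast)+
  ultimately show ?case by (intro exI[of _ "F1 \<union> F2"]) auto
qed

lemma poly_expr_carrier: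
  assumes "S \<subseteq> carrier R" "x \<in> carrier R" shows "poly_expr S x n \<subseteq> carrier R"
  using assms by (induct n) auto

lemma poly_expr_zero:
  assumes "subring S R" "x \<in> carrier R" shows "\<zero> \<in> poly_expr S x n"
proof (induct n)
  case (Suc n)
  moreover have "\<zero> = \<zero> \<oplus> \<zero> \<otimes> x [^] n" using assms by simp
  ultimately show ?case using subringE(2)[OF assms(1)] by auto
qed simp

lemma poly_expr_Suc:
  assumes "subring S R" "x \<in> carrier R" shows "poly_expr S x n \<subseteq> poly_expr S x (Suc n)"
proof
  fix p assume p: "p \<in> poly_expr S x n"
  then have "p = p \<oplus> \<zero> \<otimes> x [^] n"
    using poly_expr_carrier[OF subringE(1)[OF assms(1)] assms(2), of n] assms(2) by auto
  then show "p \<in> poly_expr S x (Suc n)" using p subringE(2)[OF assms(1)] by auto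
qed

lemma poly_expr_mono:
  assumes "subring S R" "x \<in> carrier R" "m \<le> n" shows "poly_expr S x m \<subseteq> poly_expr S x n"
  using assms(3) by (rule lift_Suc_mono_le[rotated]) (rule poly_expr_Suc[OF assms(1,2)])

lemma poly_expr_add:
  assumes S: "subring S R" and x: "x \<in> carrier R"
    and "p \<in> poly_expr S x n" "q \<in> poly_expr S x n"
  shows "p \<oplus> q \<in> poly_expr S x n"
  using assms(3,4)
proof (induct n arbitrary: p q)
  case (Suc n)
  from Suc.prems obtain p' s q' t where pq: "p = p' \<oplus> s \<otimes> x [^] n" "q = q' \<oplus> t \<otimes> x [^] n"
    "p' \<in> poly_expr S x n" "q' \<in> poly_expr S x n" "s \<in> S" "t \<in> S" by auto
  then have c: "p' \<in> carrier R" "q' \<in> carrier R" "s \<in> carrier R" "t \<in> carrier R" "x [^] n \<in> carrier R"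
    using poly_expr_carrier[OF subringE(1)[OF S] x] subringE(1)[OF S] x by auto
  have "p \<oplus> q = (p' \<oplus> q') \<oplus> (s \<oplus> t) \<otimes> x [^] n"
    unfolding pq using c by (simp add: l_distr a_ac)
  then show ?case using Suc.hyps[OF pq(3,4)] subringE(7)[OF S pq(5,6)] by auto
qed simp

lemma poly_expr_smult:
  assumes S: "subring S R" and x: "x \<in> carrier R" and s: "s \<in> S" and "p \<in> poly_expr S x n"
  shows "s \<otimes> p \<in> poly_expr S x n"
  using assms(4)
proof (induct n arbitrary: p)
  case 0
  then show ?case using s subringE(1)[OF S] by auto
next
  case (Suc n)
  then obtain p' t where p: "p = p' \<oplus> t \<otimes> x [^] n" "p' \<in> poly_expr S x n" "t \<in> S" by auto
  then have c: "p' \<in> carrier R" "s \<in> carrier R" "t \<in> carrier R" "x [^] n \<in> carrier R"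
    using poly_expr_carrier[OF subringE(1)[OF S] x] subringE(1)[OF S] x s by auto
  have "s \<otimes> p = s \<otimes> p' \<oplus> (s \<otimes> t) \<otimes> x [^] n"
    unfolding p using c by (simp add: r_distr m_assoc)
  then show ?case using Suc.hyps[OF p(2)] subringE(6)[OF S s p(3)] by auto
qed

lemma poly_expr_shift:
  assumes S: "subring S R" and x: "x \<in> carrier R" and "p \<in> poly_expr S x n"
  shows "p \<otimes> x \<in> poly_expr S x (Suc n)"
  using assms(3)
proof (induct n arbitrary: p)
  case 0
  then show ?case using x poly_expr_zero[OF S x, of "Suc 0"] by (simp del: poly_expr.simps(2))
next
  case (Suc n)
  then obtain p' t where p: "p = p' \<oplus> t \<otimes> x [^] n" "p' \<in> poly_expr S x n" "t \<in> S" by auto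
  then have c: "p' \<in> carrier R" "t \<in> carrier R" "x [^] n \<in> carrier R"
    using poly_expr_carrier[OF subringE(1)[OF S] x] subringE(1)[OF S] x by auto
  have "p \<otimes> x = p' \<otimes> x \<oplus> t \<otimes> x [^] Suc n"
    unfolding p using c x by (simp add: l_distr m_assoc)
  then show ?case using Suc.hyps[OF p(2)] p(3) by (subst poly_expr.simps) blast
qed

lemma poly_expr_shift_pow:
  assumes S: "subring S R" and x: "x \<in> carrier R" and "p \<in> poly_expr S x n"
  shows "p \<otimes> x [^] (k::nat) \<in> poly_expr S x (n + k)"
proof (induct k)
  case 0
  show ?case using assms(3) poly_expr_carrier[OF subringE(1)[OF S] x, of n] by (simp add: subset_iff)
next
  case (Suc k)
  have "p \<in> carrier R" using assms(3) poly_expr_carrier[OF subringE(1)[OF S] x] by auto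
  then have "p \<otimes> x [^] Suc k = (p \<otimes> x [^] k) \<otimes> x" using x by (simp add: m_assoc)
  then show ?case using poly_expr_shift[OF S x Suc] by simp
qed

text \<open>The ring \<open>T\<close> is \<open>S[x]\<close>. If the ideal \<open>I\<close> of \<open>T\<close> generated by \<open>G\<close> is not finitely generated,
  choose successively \<open>g\<^sub>n \<in> I\<close> of least degree outside the ideal generated by \<open>g\<^sub>0, \<dots>, g\<^sub>n\<^sub>-\<^sub>1\<close>. The
  degrees increase. As \<open>S\<close> is Noetherian, the leading coefficient of some \<open>g\<^sub>n\<close> is a combination of the
  earlier ones, so a combination of the earlier \<open>g\<^sub>i\<close>, shifted by powers of \<open>x\<close>, has the same leading
  term as \<open>g\<^sub>n\<close>. The difference has smaller degree and is still outside.\<close>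

lemma hilbert_basis_step:
  assumes S: "subring S R" and T: "subring T R" and ST: "S \<subseteq> T" and x: "x \<in> T"
    and Tx: "T \<subseteq> (\<Union>n. poly_expr S x n)" and noeth: "noetherian_subring S"
  shows "noetherian_subring T"
proof (rule ccontr)
  note Sc = subringE(1)[OF S] note Tc = subringE(1)[OF T]
  have xc: "x \<in> carrier R" using x Tc by blast
  assume "\<not> noetherian_subring T"
  then obtain G where "G \<subseteq> T \<and> \<not> (\<exists>F. finite F \<and> F \<subseteq> G \<and> G \<subseteq> lin_span T F)"
    unfolding noetherian_subring_def by auto
  then have G: "G \<subseteq> T" "\<And>F. \<lbrakk>finite F; F \<subseteq> G\<rbrakk> \<Longrightarrow> \<not> G \<subseteq> lin_span T F"
    by auto
  have Gc: "G \<subseteq> carrier R" using G Tc by blast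
  define I where "I = lin_span T G"
  have IT: "I \<subseteq> T"
  proof
    fix y assume "y \<in> I"
    then show "y \<in> T" unfolding I_def
      by induct (use G(1) subringE(2,6,7)[OF T] in auto)
  qed
  have not_fg: "\<exists>y\<in>I. y \<notin> lin_span T F" if F: "finite F" "F \<subseteq> I" for F
  proof (rule ccontr)
    assume "\<not> (\<exists>y\<in>I. y \<notin> lin_span T F)"
    then have "I \<subseteq> lin_span T F" by auto
    moreover have "G \<subseteq> I" unfolding I_def using lin_span_base[OF T Gc] by auto
    moreover obtain F' where F': "finite F'" "F' \<subseteq> G" "F \<subseteq> lin_span T F'"
      using lin_span_finite_support[OF F(1) F(2)[unfolded I_def]] by auto
    moreover have "lin_span T F \<subseteq> lin_span T F'"
      by (rule lin_span_trans[OF T _ F'(3)]) (use F'(2) Gc in blast)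
    ultimately show False using G(2)[OF F'(1,2)] by blast
  qed
  define deg where "deg y = (LEAST n. y \<in> poly_expr S x n)" for y
  have deg: "y \<in> poly_expr S x (deg y)" if "y \<in> T" for y
    unfolding deg_def by (rule LeastI_ex) (use that Tx in blast)
  have deg_le: "deg y \<le> n" if "y \<in> poly_expr S x n" for y n
    unfolding deg_def by (rule Least_le) (rule that)
  define good where "good f n r \<longleftrightarrow> r \<in> I \<and> r \<notin> lin_span T (f ` {..<n}) \<and>
      (\<forall>y\<in>I. y \<notin> lin_span T (f ` {..<n}) \<longrightarrow> deg r \<le> deg y)" for f and n :: nat and r
  have "\<exists>g. \<forall>n. good g n (g n)"
  proof (rule dependent_wellorder_choice)
    fix r and f f' :: "nat \<Rightarrow> 'a" and n :: nat
    assume "\<And>m. m < n \<Longrightarrow> f m = f' m"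
    then have "f ` {..<n} = f' ` {..<n}" by auto
    then show "good f n r = good f' n r" unfolding good_def by simp
  next
    fix n :: nat and f :: "nat \<Rightarrow> 'a" assume "\<And>m. m < n \<Longrightarrow> good f m (f m)"
    then have "f ` {..<n} \<subseteq> I" unfolding good_def by auto
    then obtain y where "y \<in> I \<and> y \<notin> lin_span T (f ` {..<n})" using not_fg[of "f ` {..<n}"] by auto
    from ex_has_least_nat[where P = "\<lambda>y. y \<in> I \<and> y \<notin> lin_span T (f ` {..<n})", OF this]
    obtain r where "r \<in> I \<and> r \<notin> lin_span T (f ` {..<n})"
      "\<forall>y. y \<in> I \<and> y \<notin> lin_span T (f ` {..<n}) \<longrightarrow> deg r \<le> deg y" by blast
    then show "\<exists>r. good f n r" unfolding good_def by auto
  qed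
  then obtain g where g: "\<And>n. good g n (g n)" by blast
  have gI: "g n \<in> I" and g_not: "g n \<notin> lin_span T (g ` {..<n})"
    and g_min: "\<And>y. \<lbrakk>y \<in> I; y \<notin> lin_span T (g ` {..<n})\<rbrakk> \<Longrightarrow> deg (g n) \<le> deg y" for n
    using g[of n] unfolding good_def by blast+
  have gc: "range g \<subseteq> carrier R" using gI IT Tc by blast
  have "\<exists>d p a. deg (g n) = Suc d \<and> p \<in> poly_expr S x d \<and> a \<in> S \<and> g n = p \<oplus> a \<otimes> x [^] d" for n
  proof (cases "deg (g n)")
    case 0
    then have "g n = \<zero>" using deg[of "g n"] gI IT by fastforce
    then show ?thesis using g_not[of n] lin_span.zero by metis
  next
    case (Suc d)
    then show ?thesis using deg[of "g n"] gI[of n] IT by auto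
  qed
  then obtain d p a where dpa: "\<And>n. deg (g n) = Suc (d n)" "\<And>n. p n \<in> poly_expr S x (d n)"
    "\<And>n. a n \<in> S" "\<And>n. g n = p n \<oplus> a n \<otimes> x [^] d n" by metis
  have d_mono: "d m \<le> d n" if "m \<le> n" for m n
  proof -
    have "g n \<notin> lin_span T (g ` {..<m})"
      using g_not[of n] lin_span_mono[OF image_mono, of "{..<m}" "{..<n}" T g] that by auto
    then show ?thesis using g_min[OF gI] dpa(1) by (metis Suc_le_mono)
  qed
  obtain F where F: "finite F" "F \<subseteq> range a" "range a \<subseteq> lin_span S F"
    using noeth dpa(3) unfolding noetherian_subring_def by (metis image_subsetI)
  then obtain N where N: "finite N" "F = a ` N" using finite_subset_image by metis
  \<comment> \<open>All indices of the finitely many leading coefficients that span the others lie below \<open>n\<close>.\<close>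
  define n where "n = Suc (Max (insert 0 N))"
  have Nn: "i < n" if "i \<in> N" for i
    unfolding n_def using N(1) that by (simp add: le_imp_less_Suc)
  have lift: "\<exists>h\<in>lin_span T (g ` N). \<exists>q\<in>poly_expr S x (d n). h = q \<oplus> c \<otimes> x [^] d n"
    if "c \<in> lin_span S (a ` N)" for c
    using that
  proof induct
    case zero
    show ?case
      by (rule bexI[of _ \<zero>], rule bexI[of _ \<zero>])
         (auto simp: xc intro: lin_span.zero poly_expr_zero[OF S xc])
  next
    case (step s b c)
    then obtain i where i: "i \<in> N" "b = a i" by blast
    obtain h q where hq: "h \<in> lin_span T (g ` N)" "q \<in> poly_expr S x (d n)" "h = q \<oplus> c \<otimes> x [^] d n"
      using step by blast
    define k where "k = d n - d i"
    have k: "d i + k = d n" unfolding k_def using d_mono[of i n] Nn[OF i(1)] by simp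
    have xk: "x [^] k \<in> T"
      by (induct k) (use subringE(3,6)[OF T] x in auto)
    have "a ` N \<subseteq> carrier R" using dpa(3) Sc by auto
    then have c: "s \<in> carrier R" "a i \<in> carrier R" "c \<in> carrier R" "q \<in> carrier R" "p i \<in> carrier R"
      using step(1,3) dpa(2)[of i] dpa(3)[of i] hq(2) Sc poly_expr_carrier[OF Sc xc, of "d n"]
        poly_expr_carrier[OF Sc xc, of "d i"] lin_span_carrier[OF Sc, of "a ` N"] by auto
    have pow: "x [^] d n = x [^] d i \<otimes> x [^] k" using k xc by (simp add: nat_pow_mult)
    have "(s \<otimes> x [^] k) \<otimes> g i \<oplus> h \<in> lin_span T (g ` N)"
      using hq(1) i(1) step(1) ST xk subringE(6)[OF T] by (intro lin_span.step) auto
    moreover have "s \<otimes> (p i \<otimes> x [^] k) \<oplus> q \<in> poly_expr S x (d n)"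
      using poly_expr_add[OF S xc poly_expr_smult[OF S xc step(1)] hq(2)]
        poly_expr_shift_pow[OF S xc dpa(2)[of i], of k] k by simp
    moreover have "(s \<otimes> x [^] k) \<otimes> g i \<oplus> h =
        (s \<otimes> (p i \<otimes> x [^] k) \<oplus> q) \<oplus> (s \<otimes> b \<oplus> c) \<otimes> x [^] d n"
    proof -
      have "x [^] k \<in> carrier R" "x [^] d i \<in> carrier R" using xc by auto
      then show ?thesis unfolding dpa(4)[of i] hq(3) pow i(2) using c
        by (simp add: l_distr r_distr m_ac a_ac)
    qed
    ultimately show ?case by blast
  qed
  have "a n \<in> lin_span S (a ` N)" using F N by blast
  then obtain h q where hq: "h \<in> lin_span T (g ` N)" "q \<in> poly_expr S x (d n)" "h = q \<oplus> a n \<otimes> x [^] d n"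
    using lift by blast
  have hspan: "h \<in> lin_span T (g ` {..<n})"
    using hq(1) lin_span_mono[OF image_mono, of N "{..<n}" T g] Nn by (auto simp: subset_iff)
  have gnc: "g ` {..<n} \<subseteq> carrier R" using gc by blast
  have hc: "h \<in> carrier R" using hspan lin_span_carrier[OF Tc gnc] by blast
  have m1T: "\<ominus> \<one> \<in> T" and m1S: "\<ominus> \<one> \<in> S" using subringE(3,5)[OF T] subringE(3,5)[OF S] by auto
  have neg: "\<ominus> u = \<ominus> \<one> \<otimes> u" if "u \<in> carrier R" for u using that by (simp add: l_minus)
  have hI: "h \<in> I" using hspan lin_span_trans[OF T Gc, of "g ` {..<n}"] gI unfolding I_def by blast
  have c: "p n \<in> carrier R" "q \<in> carrier R" "a n \<otimes> x [^] d n \<in> carrier R"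
    using hq dpa(2,3) poly_expr_carrier[OF Sc xc] Sc xc by (auto intro!: m_closed)
  have gnc': "g n \<in> carrier R" using gc by blast
  let ?y = "g n \<oplus> \<ominus> h"
  have "?y \<in> I" unfolding neg[OF hc]
    unfolding I_def by (intro lin_span_add[OF Tc Gc] lin_span_smult[OF T Gc m1T])
      (use gI hI I_def in auto)
  moreover have "?y \<notin> lin_span T (g ` {..<n})"
  proof
    assume "?y \<in> lin_span T (g ` {..<n})"
    then have "?y \<oplus> h \<in> lin_span T (g ` {..<n})" using hspan by (rule lin_span_add[OF Tc gnc])
    moreover have "?y \<oplus> h = g n" using hc gnc' by (simp add: a_assoc l_neg)
    ultimately show False using g_not[of n] by simp
  qed
  ultimately have "deg (g n) \<le> deg ?y" by (rule g_min)
  moreover have "?y \<in> poly_expr S x (d n)"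
  proof -
    have "?y = p n \<oplus> \<ominus> \<one> \<otimes> q"
      unfolding neg[OF c(2), symmetric] hq(3) dpa(4)[of n] using c
      by (simp add: minus_add a_ac r_neg r_neg1 r_neg2)
    also have "\<dots> \<in> poly_expr S x (d n)"
      by (intro poly_expr_add[OF S xc dpa(2)] poly_expr_smult[OF S xc m1S hq(2)])
    finally show ?thesis .
  qed
  ultimately show False using deg_le[of ?y "d n"] dpa(1)[of n] by simp
qed

lemma adjoin_carrier:
  assumes "S \<subseteq> carrier R" "Y \<subseteq> carrier R" shows "adjoin S Y \<subseteq> carrier R"
proof
  fix a assume "a \<in> adjoin S Y"
  then show "a \<in> carrier R" using assms by induct auto
qed

lemma adjoin_subring:
  assumes S: "subring S R" and Y: "Y \<subseteq> carrier R" shows "subring (adjoin S Y) R"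
proof -
  note Sc = subringE(1)[OF S] note ac = adjoin_carrier[OF Sc Y]
  have mult: "a \<otimes> b \<in> adjoin S Y" if a: "a \<in> adjoin S Y" and "b \<in> adjoin S Y" for a b
    using that(2)
  proof induct
    case (base s)
    from a show ?case
    proof induct
      case (base t)
      then show ?case using subringE(6)[OF S] \<open>s \<in> S\<close> by (blast intro: adjoin.base)
    next
      case (add b c)
      then have "(b \<oplus> c) \<otimes> s = b \<otimes> s \<oplus> c \<otimes> s" using ac Sc \<open>s \<in> S\<close> by (intro l_distr) auto
      with add show ?case by (simp add: adjoin.add)
    next
      case (mult b y)
      then have "(b \<otimes> y) \<otimes> s = (b \<otimes> s) \<otimes> y" using ac Sc \<open>s \<in> S\<close> Y by (simp add: m_ac subset_iff)
      with mult show ?case by (simp add: adjoin.mult)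
    qed
  next
    case (add b c)
    then have "a \<otimes> (b \<oplus> c) = a \<otimes> b \<oplus> a \<otimes> c" using ac a by (intro r_distr) auto
    with add show ?case by (simp add: adjoin.add)
  next
    case (mult b y)
    then have "a \<otimes> (b \<otimes> y) = (a \<otimes> b) \<otimes> y" using ac a Y by (simp add: m_assoc subset_iff)
    with mult show ?case by (simp add: adjoin.mult)
  qed
  have m1: "\<ominus> \<one> \<in> adjoin S Y" using subringE(3,5)[OF S] by (blast intro: adjoin.base)
  show ?thesis
  proof (rule subringI)
    show "adjoin S Y \<subseteq> carrier R" by (rule ac)
    show "\<one> \<in> adjoin S Y" using subringE(3)[OF S] by (rule adjoin.base)
    fix a b assume a: "a \<in> adjoin S Y" and b: "b \<in> adjoin S Y"
    show "a \<otimes> b \<in> adjoin S Y" by (rule mult[OF a b])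
    show "a \<oplus> b \<in> adjoin S Y" by (rule adjoin.add[OF a b])
    have "\<ominus> a = \<ominus> \<one> \<otimes> a" using a ac by (simp add: l_minus subset_iff)
    then show "\<ominus> a \<in> adjoin S Y" using mult[OF m1 a] by simp
  qed
qed

theorem hilbert_basis:
  assumes S: "subring S R" and "noetherian_subring S" and "finite Y" "Y \<subseteq> carrier R"
  shows "noetherian_subring (adjoin S Y)"
  using assms(3,4)
proof induct
  case empty
  have "adjoin S {} = S"
  proof
    show "adjoin S {} \<subseteq> S"
    proof
      fix a assume "a \<in> adjoin S {}"
      then show "a \<in> S" by induct (use subringE(7)[OF S] in auto)
    qed
  qed (auto intro: adjoin.base)
  then show ?case using assms(2) by simp
next
  case (insert x Y)
  then have xc: "x \<in> carrier R" and Yc: "Y \<subseteq> carrier R" and xYc: "insert x Y \<subseteq> carrier R" by auto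
  let ?S = "adjoin S Y" and ?T = "adjoin S (insert x Y)"
  have S': "subring ?S R" by (rule adjoin_subring[OF S Yc])
  have T': "subring ?T R" by (rule adjoin_subring[OF S xYc])
  have "?S \<subseteq> ?T"
  proof
    fix a assume "a \<in> ?S"
    then show "a \<in> ?T" by induct (auto intro: adjoin.intros)
  qed
  moreover have "x \<in> ?T"
  proof -
    have "\<one> \<otimes> x \<in> ?T" using subringE(3)[OF S] by (blast intro: adjoin.intros)
    then show ?thesis using xc by simp
  qed
  moreover have "?T \<subseteq> (\<Union>n. poly_expr ?S x n)"
  proof
    fix a assume "a \<in> ?T"
    then show "a \<in> (\<Union>n. poly_expr ?S x n)"
    proof induct
      case (base s)
      then have "s = \<zero> \<oplus> s \<otimes> x [^] (0::nat)" using subringE(1)[OF S] by auto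
      then have "s \<in> poly_expr ?S x (Suc 0)" using base by (auto intro: adjoin.base)
      then show ?case by blast
    next
      case (add a b)
      then obtain m n where "a \<in> poly_expr ?S x m" "b \<in> poly_expr ?S x n" by blast
      then have "a \<in> poly_expr ?S x (max m n)" "b \<in> poly_expr ?S x (max m n)"
        using poly_expr_mono[OF S' xc] by (meson max.cobounded1 max.cobounded2 subsetD)+
      then show ?case using poly_expr_add[OF S' xc] by blast
    next
      case (mult a y)
      then obtain n where n: "a \<in> poly_expr ?S x n" by blast
      then have ac: "a \<in> carrier R" using poly_expr_carrier[OF subringE(1)[OF S'] xc] by blast
      show ?case
      proof (cases "y = x")
        case True
        then show ?thesis using poly_expr_shift[OF S' xc n] by blast
      next
        case False
        then have "y \<in> Y" using mult by blast
        then have yc: "y \<in> carrier R" using Yc by blast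
        have "\<one> \<otimes> y \<in> ?S" using subringE(3)[OF S] \<open>y \<in> Y\<close> by (blast intro: adjoin.intros)
        then have "y \<otimes> a \<in> poly_expr ?S x n" using poly_expr_smult[OF S' xc _ n] yc by simp
        then show ?thesis using m_comm[OF ac yc] by auto
      qed
    qed
  qed
  ultimately show ?case using hilbert_basis_step[OF S' T'] insert Yc by blast
qed

text \<open>A set that contains a nonzero element is spanned by it. This covers fields and their images in
  other rings, including the zero ring.\<close>

lemma noetherian_subring_if_units:
  assumes S: "subring S R" and inv: "\<And>s. \<lbrakk>s \<in> S; s \<noteq> \<zero>\<rbrakk> \<Longrightarrow> \<exists>t\<in>S. t \<otimes> s = \<one>"
  shows "noetherian_subring S"
  unfolding noetherian_subring_def
proof (intro allI impI)
  fix G assume G: "G \<subseteq> S"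
  show "\<exists>F. finite F \<and> F \<subseteq> G \<and> G \<subseteq> lin_span S F"
  proof (cases "G \<subseteq> {\<zero>}")
    case True
    then show ?thesis by (intro exI[of _ "{}"]) (auto intro: lin_span.zero)
  next
    case False
    then obtain s where s: "s \<in> G" "s \<noteq> \<zero>" by blast
    then obtain t where t: "t \<in> S" "t \<otimes> s = \<one>" using inv G by blast
    have "G \<subseteq> lin_span S {s}"
    proof
      fix a assume a: "a \<in> G"
      then have c: "a \<in> carrier R" "s \<in> carrier R" "t \<in> carrier R"
        using s t G subringE(1)[OF S] by auto
      have "(a \<otimes> t) \<otimes> s \<oplus> \<zero> \<in> lin_span S {s}"
        using a t G subringE(6)[OF S] by (intro lin_span.intros) auto
      moreover have "(a \<otimes> t) \<otimes> s \<oplus> \<zero> = a" using c t(2) by (simp add: m_assoc)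
      ultimately show "a \<in> lin_span S {s}" by simp
    qed
    then show ?thesis using s by (intro exI[of _ "{s}"]) auto
  qed
qed

text \<open>One treats the generators one at a time. If \<open>e\<close> is an identity for the earlier ones and \<open>a\<close> is a
  further one, then \<open>c = a - a e\<close> satisfies \<open>c = c f\<close> for a multiple \<open>f\<close> of \<open>c\<close>, by regularity, and
  \<open>e + f - e f\<close> is an identity for \<open>a\<close> and for everything that \<open>e\<close> fixes.\<close>

lemma vn_regular_noetherian_ideal_has_one:
  assumes reg: "vn_regular R" and noeth: "noetherian_subring (carrier R)" and I: "ideal I R"
  shows "\<exists>e\<in>I. \<forall>b\<in>I. b \<otimes> e = b"
proof -
  interpret I: ideal I R by fact
  have "\<exists>F. finite F \<and> F \<subseteq> I \<and> I \<subseteq> lin_span (carrier R) F"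
    using noeth I.a_subset unfolding noetherian_subring_def by simp
  then obtain F where F: "finite F" "F \<subseteq> I" "I \<subseteq> lin_span (carrier R) F" by auto
  from F(1,2) have "\<exists>e\<in>I. \<forall>b\<in>F. b \<otimes> e = b"
  proof induct
    case empty
    then show ?case using additive_subgroup.zero_closed[OF I.is_additive_subgroup] by blast
  next
    case (insert a F)
    then obtain e where e: "e \<in> I" "\<And>b. b \<in> F \<Longrightarrow> b \<otimes> e = b" by auto
    have ec: "e \<in> carrier R" and ac: "a \<in> carrier R" using e insert I.a_Hcarr by auto
    define c where "c = a \<ominus> a \<otimes> e"
    have cc: "c \<in> carrier R" unfolding c_def using ac ec by simp
    obtain y where y: "y \<in> carrier R" "c \<otimes> y \<otimes> c = c" using reg cc unfolding vn_regular_def by blast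
    have cI: "c \<in> I" unfolding c_def minus_eq using insert e ac ec
      by (intro I.a_closed I.a_inv_closed I.I_r_closed) auto
    define f where "f = y \<otimes> c"
    have fI: "f \<in> I" unfolding f_def using cI y by (intro I.I_l_closed)
    then have fc: "f \<in> carrier R" using I.a_Hcarr by blast
    have cf: "c \<otimes> f = c" unfolding f_def using y cc by (simp add: m_assoc)
    let ?e = "e \<oplus> (f \<ominus> e \<otimes> f)"
    have "?e \<in> I" unfolding minus_eq using e fI ec fc
      by (intro I.a_closed I.a_inv_closed I.I_r_closed) auto
    moreover have "b \<otimes> ?e = b" if "b \<in> F" for b
    proof -
      have bc: "b \<in> carrier R" using that insert I.a_Hcarr by auto
      have "b \<otimes> ?e = b \<otimes> e \<oplus> (b \<otimes> f \<ominus> (b \<otimes> e) \<otimes> f)" using bc ec fc by algebra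
      then show ?thesis using e(2)[OF that] bc fc by (simp add: minus_eq r_neg)
    qed
    moreover have "a \<otimes> ?e = a"
    proof -
      have "a \<otimes> ?e = a \<otimes> e \<oplus> c \<otimes> f" unfolding c_def using ac ec fc by algebra
      also have "\<dots> = a" unfolding cf unfolding c_def using ac ec by algebra
      finally show ?thesis .
    qed
    ultimately show ?case by blast
  qed
  then obtain e where e: "e \<in> I" "\<And>b. b \<in> F \<Longrightarrow> b \<otimes> e = b" by blast
  have ec: "e \<in> carrier R" using e I.a_Hcarr by auto
  have Fc: "F \<subseteq> carrier R" using F(2) I.a_subset by blast
  have "b \<otimes> e = b" if "b \<in> lin_span (carrier R) F" for b
    using that
  proof induct
    case zero
    then show ?case using ec by simp
  next
    case (step s g x)
    then have "x \<in> carrier R" "g \<in> carrier R" using lin_span_carrier[OF _ Fc] Fc by auto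
    then show ?case using step e(2) ec by (simp add: l_distr m_assoc)
  qed
  then show ?thesis using e(1) F(3) by blast
qed

end

lemma finite_submultisets: "finite {a. a \<subseteq># m}"
proof (induct m)
  case (add x m)
  have "{a. a \<subseteq># add_mset x m} \<subseteq> {a. a \<subseteq># m} \<union> add_mset x ` {a. a \<subseteq># m}"
  proof
    fix a assume "a \<in> {a. a \<subseteq># add_mset x m}"
    then have a: "a \<subseteq># add_mset x m" by simp
    show "a \<in> {a. a \<subseteq># m} \<union> add_mset x ` {a. a \<subseteq># m}"
    proof (cases "x \<in># a")
      case True
      then obtain b where "a = add_mset x b" by (metis multi_member_split)
      with a show ?thesis by simp
    next
      case False
      have "count a y \<le> count m y" for y
        using a False by (cases "y = x") (auto simp: subseteq_mset_def not_in_iff split: if_splits)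
      then show ?thesis by (simp add: subseteq_mset_def)
    qed
  qed
  then show ?case by (rule finite_subset) (use add in simp)
qed simp

text \<open>This determines the products with constants (\<open>u\<close> empty) and with variables (\<open>u\<close> a singleton),
  which generate the polynomial algebra.\<close>

lemma mpoly_mult_monomial:
  assumes K: "ring K" and p: "\<And>m. p m \<in> carrier K" and c: "c \<in> carrier K"
  shows "p \<otimes>\<^bsub>mpoly_algebra K t\<^esub> (\<lambda>m. if m = u then c else \<zero>\<^bsub>K\<^esub>) =
         (\<lambda>m. if u \<subseteq># m then p (m - u) \<otimes>\<^bsub>K\<^esub> c else \<zero>\<^bsub>K\<^esub>)"
proof
  fix m :: "nat multiset"
  interpret K: ring K by fact
  have fin: "finite {a. a \<subseteq># m}" by (rule finite_submultisets)
  let ?f = "\<lambda>a. p a \<otimes>\<^bsub>K\<^esub> (if m - a = u then c else \<zero>\<^bsub>K\<^esub>)"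
  have "(p \<otimes>\<^bsub>mpoly_algebra K t\<^esub> (\<lambda>m. if m = u then c else \<zero>\<^bsub>K\<^esub>)) m = (\<Oplus>\<^bsub>K\<^esub>a\<in>{a. a \<subseteq># m}. ?f a)"
    by (simp add: mpoly_algebra_def)
  also have "\<dots> = (if u \<subseteq># m then p (m - u) \<otimes>\<^bsub>K\<^esub> c else \<zero>\<^bsub>K\<^esub>)"
  proof (cases "u \<subseteq># m")
    case True
    have "(\<Oplus>\<^bsub>K\<^esub>a\<in>{a. a \<subseteq># m}. ?f a) =
        (\<Oplus>\<^bsub>K\<^esub>a\<in>{a. a \<subseteq># m}. if m - u = a then p a \<otimes>\<^bsub>K\<^esub> c else \<zero>\<^bsub>K\<^esub>)"
    proof (rule K.finsum_cong')
      fix a assume "a \<in> {a. a \<subseteq># m}"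
      then have "m - a = u \<longleftrightarrow> m - u = a" using True
        by (auto simp: subset_mset.diff_diff_right)
      then show "?f a = (if m - u = a then p a \<otimes>\<^bsub>K\<^esub> c else \<zero>\<^bsub>K\<^esub>)" using p by simp
    qed (use p c in auto)
    also have "\<dots> = p (m - u) \<otimes>\<^bsub>K\<^esub> c"
      by (rule K.finsum_singleton) (use p c fin in auto)
    finally show ?thesis using True by simp
  next
    case False
    have "(\<Oplus>\<^bsub>K\<^esub>a\<in>{a. a \<subseteq># m}. ?f a) = \<zero>\<^bsub>K\<^esub>"
    proof (rule K.add.finprod_one_eqI)
      fix a assume "a \<in> {a. a \<subseteq># m}"
      then have "m - a \<noteq> u" using False by auto
      then show "?f a = \<zero>\<^bsub>K\<^esub>" using p by simp
    qed
    then show ?thesis using False by simp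
  qed
  finally show "(p \<otimes>\<^bsub>mpoly_algebra K t\<^esub> (\<lambda>m. if m = u then c else \<zero>\<^bsub>K\<^esub>)) m =
      (if u \<subseteq># m then p (m - u) \<otimes>\<^bsub>K\<^esub> c else \<zero>\<^bsub>K\<^esub>)" .
qed

text \<open>The algebra arises from the image of \<open>K\<close>, in which nonzero elements are invertible, by
  adjoining the images of the variables.\<close>

theorem affine_algebra_noetherian:
  assumes K: "field K" and B: "affine_algebra K B"
  shows "cring.noetherian_subring B (carrier B)"
proof -
  interpret K: field K by fact
  have "algebra K B" using B unfolding affine_algebra_def by blast
  then interpret B: cring B by (rule algebra.M_cring)
  from B obtain t I h where I: "ideal I (mpoly_algebra K t)"
    and h: "h \<in> ring_iso (quot_module (mpoly_algebra K t) I) B"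
    unfolding affine_algebra_def by blast
  let ?P = "mpoly_algebra K t"
  interpret I: ideal I ?P by fact
  define g where "g p = h (I +>\<^bsub>?P\<^esub> p)" for p
  have h': "h \<in> ring_iso (?P Quot I) B"
    using h unfolding quot_module_def with_smult_def ring_iso_def ring_hom_def by simp
  then have "h \<in> ring_hom (?P Quot I) B" unfolding ring_iso_def by blast
  then have "h \<circ> (+>\<^bsub>?P\<^esub>) I \<in> ring_hom ?P B" by (rule ring_hom_trans[OF I.rcos_ring_hom])
  then have g: "g \<in> ring_hom ?P B" unfolding g_def comp_def .
  have onto: "carrier B \<subseteq> g ` carrier ?P"
  proof
    fix b assume "b \<in> carrier B"
    then obtain C where C: "C \<in> carrier (?P Quot I)" "b = h C"
      using h' unfolding ring_iso_def bij_betw_def by blast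
    then obtain p where "p \<in> carrier ?P" "C = I +>\<^bsub>?P\<^esub> p"
      unfolding FactRing_def A_RCOSETS_def RCOSETS_def a_r_coset_def by auto
    then show "b \<in> g ` carrier ?P" using C(2) unfolding g_def by blast
  qed
  let ?const = "K.indexed_const :: _ \<Rightarrow> nat multiset \<Rightarrow> _"
  have Pcarr: "carrier ?P = K.indexed_pset {1..t} (carrier K)"
    and Padd: "p \<oplus>\<^bsub>?P\<^esub> q = K.indexed_padd p q" and Pone: "\<one>\<^bsub>?P\<^esub> = ?const \<one>\<^bsub>K\<^esub>"
    and Pzero: "\<zero>\<^bsub>?P\<^esub> = ?const \<zero>\<^bsub>K\<^esub>" for p q
    by (simp_all add: mpoly_algebra_def)
  have coeff: "p m \<in> carrier K" if "p \<in> carrier ?P" for p m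
    using K.carrier_coeffE[OF K.indexed_pset_in_carrier[OF subset_refl]] that unfolding Pcarr by blast
  have const: "?const k \<in> carrier ?P" if "k \<in> carrier K" for k
    using that unfolding Pcarr by (rule K.indexed_pset.indexed_const)
  have const_mult: "p \<otimes>\<^bsub>?P\<^esub> ?const k = (\<lambda>m. p m \<otimes>\<^bsub>K\<^esub> k)" if "p \<in> carrier ?P" "k \<in> carrier K" for p k
    unfolding K.indexed_const_def
    by (subst mpoly_mult_monomial[OF K.ring_axioms]) (use coeff that in auto)
  have const_const: "?const k \<otimes>\<^bsub>?P\<^esub> ?const l = ?const (k \<otimes>\<^bsub>K\<^esub> l)" if "k \<in> carrier K" "l \<in> carrier K" for k l
    using that by (simp add: const_mult const) (auto simp: K.indexed_const_def)
  have const_add: "?const k \<oplus>\<^bsub>?P\<^esub> ?const l = ?const (k \<oplus>\<^bsub>K\<^esub> l)" for k l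
    by (simp only: Padd K.indexed_padd_const)
  have var: "K.indexed_var i \<in> carrier ?P" if "i \<in> {1..t}" for i
    using that unfolding Pcarr K.indexed_var_def by (intro K.indexed_pset.intros) auto
  have var_mult: "p \<otimes>\<^bsub>?P\<^esub> K.indexed_var i = K.indexed_pmult p i" if "p \<in> carrier ?P" for p i
  proof -
    have "K.indexed_var i = (\<lambda>m. if m = {#i#} then \<one>\<^bsub>K\<^esub> else \<zero>\<^bsub>K\<^esub>)"
    proof
      fix m
      show "K.indexed_var i m = (if m = {#i#} then \<one>\<^bsub>K\<^esub> else \<zero>\<^bsub>K\<^esub>)"
        unfolding K.indexed_var_def K.indexed_pmult_def K.indexed_const_def
        by (cases "i \<in># m") (auto dest!: multi_member_split)
    qed
    then show ?thesis unfolding K.indexed_pmult_def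
      by (simp only:) (subst mpoly_mult_monomial[OF K.ring_axioms], use coeff[OF that] in auto)
  qed
  note gm = ring_hom_mult[OF g] ring_hom_add[OF g] ring_hom_one[OF g] ring_hom_closed[OF g]
  define S where "S = (\<lambda>k. g (?const k)) ` carrier K"
  define Y where "Y = (\<lambda>i. g (K.indexed_var i)) ` {1..t}"
  have gzero: "g \<zero>\<^bsub>?P\<^esub> = \<zero>\<^bsub>B\<^esub>" by (rule ring_hom_zero[OF g I.ring_axioms B.ring_axioms])
  have S: "subring S B"
  proof (rule B.subringI)
    show "S \<subseteq> carrier B" unfolding S_def using const gm(4) by auto
    show "\<one>\<^bsub>B\<^esub> \<in> S" unfolding S_def using gm(3) Pone by (metis K.one_closed image_eqI)
    fix a b assume "a \<in> S" "b \<in> S"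
    then obtain k l where kl: "k \<in> carrier K" "l \<in> carrier K" "a = g (?const k)" "b = g (?const l)"
      unfolding S_def by blast
    have "a \<otimes>\<^bsub>B\<^esub> b = g (?const (k \<otimes>\<^bsub>K\<^esub> l))"
      using kl gm(1)[OF const[OF kl(1)] const[OF kl(2)]] by (simp add: const_const)
    then show "a \<otimes>\<^bsub>B\<^esub> b \<in> S" unfolding S_def using kl by blast
    have "a \<oplus>\<^bsub>B\<^esub> b = g (?const (k \<oplus>\<^bsub>K\<^esub> l))"
      using kl gm(2)[OF const[OF kl(1)] const[OF kl(2)]] by (simp only: const_add)
    then show "a \<oplus>\<^bsub>B\<^esub> b \<in> S" unfolding S_def using kl by blast
    have "g (?const (\<ominus>\<^bsub>K\<^esub> k)) \<oplus>\<^bsub>B\<^esub> a = \<zero>\<^bsub>B\<^esub>"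
      using kl gm(2)[OF const[OF K.a_inv_closed[OF kl(1)]] const[OF kl(1)]] gzero
      by (simp add: const_add K.l_neg Pzero)
    then have "\<ominus>\<^bsub>B\<^esub> a = g (?const (\<ominus>\<^bsub>K\<^esub> k))"
      using kl const gm(4) by (intro B.minus_equality) auto
    then show "\<ominus>\<^bsub>B\<^esub> a \<in> S" unfolding S_def using kl by blast
  qed
  have "B.noetherian_subring S"
  proof (rule B.noetherian_subring_if_units[OF S])
    fix s assume "s \<in> S" "s \<noteq> \<zero>\<^bsub>B\<^esub>"
    then obtain k where k: "k \<in> carrier K" "s = g (?const k)" unfolding S_def by blast
    have "k \<noteq> \<zero>\<^bsub>K\<^esub>" using k \<open>s \<noteq> _\<close> gzero Pzero by auto
    then have inv: "inv\<^bsub>K\<^esub> k \<in> carrier K" "inv\<^bsub>K\<^esub> k \<otimes>\<^bsub>K\<^esub> k = \<one>\<^bsub>K\<^esub>"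
      using k K.field_Units by auto
    then have "g (?const (inv\<^bsub>K\<^esub> k)) \<otimes>\<^bsub>B\<^esub> s = \<one>\<^bsub>B\<^esub>"
      using k gm(1)[OF const[OF inv(1)] const[OF k(1)]] gm(3) inv by (simp add: const_const Pone)
    then show "\<exists>u\<in>S. u \<otimes>\<^bsub>B\<^esub> s = \<one>\<^bsub>B\<^esub>" unfolding S_def using inv by blast
  qed
  moreover have "finite Y" "Y \<subseteq> carrier B" unfolding Y_def using var gm(4) by auto
  ultimately have "B.noetherian_subring (B.adjoin S Y)" by (rule B.hilbert_basis[OF S])
  moreover have "carrier B \<subseteq> B.adjoin S Y"
  proof
    fix b assume "b \<in> carrier B"
    then obtain p where p: "p \<in> carrier ?P" "b = g p" using onto by blast
    from p(1) have "g p \<in> B.adjoin S Y" unfolding Pcarr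
    proof induct
      case (indexed_const k)
      then show ?case unfolding S_def by (intro B.adjoin.base) blast
    next
      case (indexed_padd p q)
      then show ?case using gm(2)[of p q] Padd[of p q] Pcarr by (simp add: B.adjoin.add)
    next
      case (indexed_pmult p i)
      then have "g (K.indexed_pmult p i) = g p \<otimes>\<^bsub>B\<^esub> g (K.indexed_var i)"
        using gm(1)[of p "K.indexed_var i"] var var_mult Pcarr by simp
      with indexed_pmult show ?case unfolding Y_def by (auto intro: B.adjoin.mult)
    qed
    then show "b \<in> B.adjoin S Y" using p by simp
  qed
  moreover have "B.adjoin S Y \<subseteq> carrier B"
    using B.adjoin_carrier[OF subringE(1)[OF S] \<open>Y \<subseteq> carrier B\<close>] .
  ultimately show ?thesis by (metis subset_antisym)
qed

section \<open>The universal property of tensor products\<close>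

lemma (in abelian_monoid) finsum_induct:
  assumes "finite A" "f \<in> A \<rightarrow> carrier G" "P \<zero>"
    and "\<And>a. a \<in> A \<Longrightarrow> P (f a)"
    and "\<And>x y. \<lbrakk>x \<in> carrier G; y \<in> carrier G; P x; P y\<rbrakk> \<Longrightarrow> P (x \<oplus> y)"
  shows "P (finsum G f A)"
  using assms(1,2,4)
proof (induct A)
  case empty
  then show ?case using assms(3) by simp
next
  case (insert a A)
  then have "finsum G f (insert a A) = f a \<oplus> finsum G f A" by (intro finsum_insert) auto
  moreover have "f a \<in> carrier G" "finsum G f A \<in> carrier G" using insert by (auto intro!: finsum_closed)
  ultimately show ?case using insert assms(5) by (simp add: Pi_def)
qed

lemma free_module_module:
  fixes R (structure) and S :: "'s set"
  assumes "cring R" shows "module R (free_module R S)"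
proof -
  interpret cring R by fact
  let ?F = "free_module R S"
  have fin: "finite {s. p s \<oplus> q s \<noteq> \<zero>}" if "finite {s. p s \<noteq> \<zero>}" "finite {s. q s \<noteq> \<zero>}" for p q :: "'s \<Rightarrow> _"
    by (rule finite_subset[OF _ finite_UnI[OF that]]) auto
  have fin': "finite {s. r \<otimes> p s \<noteq> \<zero>}" if "finite {s. p s \<noteq> \<zero>}" "r \<in> carrier R" for p :: "'s \<Rightarrow> _" and r
    by (rule finite_subset[OF _ that(1)]) (use that in auto)
  show ?thesis
  proof (rule moduleI)
    show "cring R" by fact
    show "abelian_group ?F"
    proof (rule abelian_groupI)
      fix p assume p: "p \<in> carrier ?F"
      then have "(\<lambda>s. \<ominus> p s) \<in> carrier ?F"
        unfolding free_module_def by (auto elim!: finite_subset[rotated])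
      moreover have "(\<lambda>s. \<ominus> p s) \<oplus>\<^bsub>?F\<^esub> p = \<zero>\<^bsub>?F\<^esub>"
        using p unfolding free_module_def by (auto simp: l_neg)
      ultimately show "\<exists>q\<in>carrier ?F. q \<oplus>\<^bsub>?F\<^esub> p = \<zero>\<^bsub>?F\<^esub>" by blast
    qed (auto simp: free_module_def a_ac fin)
  qed (auto simp: free_module_def l_distr r_distr m_assoc fin')
qed

lemma free_moduleD:
  assumes "p \<in> carrier (free_module R S)"
  shows "p s \<in> carrier R" "s \<notin> S \<Longrightarrow> p s = \<zero>\<^bsub>R\<^esub>" "finite {s. p s \<noteq> \<zero>\<^bsub>R\<^esub>}"
  using assms unfolding free_module_def by auto

lemma free_gen_carrier: "cring R \<Longrightarrow> s \<in> S \<Longrightarrow> free_gen R s \<in> carrier (free_module R S)"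
  unfolding free_gen_def free_module_def by (auto simp: cring.cring_simprules)

lemma quot_module_simps:
  assumes M: "module R M" and H: "submodule H R M"
  shows "carrier (quot_module M H) = (\<lambda>x. H +>\<^bsub>M\<^esub> x) ` carrier M"
    and "\<And>x y. \<lbrakk>x \<in> carrier M; y \<in> carrier M\<rbrakk> \<Longrightarrow>
      (H +>\<^bsub>M\<^esub> x) \<oplus>\<^bsub>quot_module M H\<^esub> (H +>\<^bsub>M\<^esub> y) = H +>\<^bsub>M\<^esub> (x \<oplus>\<^bsub>M\<^esub> y)"
    and "\<zero>\<^bsub>quot_module M H\<^esub> = H +>\<^bsub>M\<^esub> \<zero>\<^bsub>M\<^esub>"
    and "\<And>x y. \<lbrakk>x \<in> carrier M; y \<in> carrier M\<rbrakk> \<Longrightarrow>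
      H +>\<^bsub>M\<^esub> x = H +>\<^bsub>M\<^esub> y \<longleftrightarrow> x \<ominus>\<^bsub>M\<^esub> y \<in> H"
    and "\<And>r x. \<lbrakk>r \<in> carrier R; x \<in> carrier M\<rbrakk> \<Longrightarrow>
      r \<odot>\<^bsub>quot_module M H\<^esub> (H +>\<^bsub>M\<^esub> x) = H +>\<^bsub>M\<^esub> (r \<odot>\<^bsub>M\<^esub> x)"
proof -
  interpret M: module R M by fact
  have ag: "abelian_group M" by (rule M.M.abelian_group_axioms)
  have sub: "subgroup H (add_monoid M)" using H unfolding submodule_def by blast
  have as: "additive_subgroup H M" using sub by (rule additive_subgroupI)
  interpret H: abelian_subgroup H M by (rule abelian_subgroupI3[OF as ag])
  show "carrier (quot_module M H) = (\<lambda>x. H +>\<^bsub>M\<^esub> x) ` carrier M"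
    unfolding quot_module_def with_smult_def FactRing_def A_RCOSETS_def RCOSETS_def a_r_coset_def by auto
  show "(H +>\<^bsub>M\<^esub> x) \<oplus>\<^bsub>quot_module M H\<^esub> (H +>\<^bsub>M\<^esub> y) = H +>\<^bsub>M\<^esub> (x \<oplus>\<^bsub>M\<^esub> y)"
    if "x \<in> carrier M" "y \<in> carrier M" for x y
    using H.a_rcos_sum[OF that] unfolding quot_module_def with_smult_def FactRing_def by simp
  show "\<zero>\<^bsub>quot_module M H\<^esub> = H +>\<^bsub>M\<^esub> \<zero>\<^bsub>M\<^esub>"
    using M.M.a_coset_add_zero[OF H.a_subset] unfolding quot_module_def with_smult_def FactRing_def by simp
  show eq: "H +>\<^bsub>M\<^esub> x = H +>\<^bsub>M\<^esub> y \<longleftrightarrow> x \<ominus>\<^bsub>M\<^esub> y \<in> H"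
    if x: "x \<in> carrier M" and y: "y \<in> carrier M" for x y
  proof
    assume "H +>\<^bsub>M\<^esub> x = H +>\<^bsub>M\<^esub> y"
    then have "x \<in> H +>\<^bsub>M\<^esub> y" using H.a_rcos_self[OF x] by simp
    then show "x \<ominus>\<^bsub>M\<^esub> y \<in> H" using H.a_rcos_module_imp[OF y] by (simp add: M.M.minus_eq)
  next
    assume "x \<ominus>\<^bsub>M\<^esub> y \<in> H"
    then have "x \<in> H +>\<^bsub>M\<^esub> y" using H.a_rcos_module_rev[OF y x] by (simp add: M.M.minus_eq)
    then show "H +>\<^bsub>M\<^esub> x = H +>\<^bsub>M\<^esub> y" using H.a_repr_independence'[OF _ y] by simp
  qed
  show "r \<odot>\<^bsub>quot_module M H\<^esub> (H +>\<^bsub>M\<^esub> x) = H +>\<^bsub>M\<^esub> (r \<odot>\<^bsub>M\<^esub> x)"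
    if r: "r \<in> carrier R" and x: "x \<in> carrier M" for r x
  proof -
    have const: "H +>\<^bsub>M\<^esub> (r \<odot>\<^bsub>M\<^esub> z) = H +>\<^bsub>M\<^esub> (r \<odot>\<^bsub>M\<^esub> x)" if "z \<in> H +>\<^bsub>M\<^esub> x" for z
    proof -
      have z: "z \<in> carrier M" using that x H.a_elemrcos_carrier by blast
      have "z \<ominus>\<^bsub>M\<^esub> x \<in> H" using H.a_rcos_module_imp[OF x that] by (simp add: M.M.minus_eq)
      then have "r \<odot>\<^bsub>M\<^esub> (z \<ominus>\<^bsub>M\<^esub> x) \<in> H" using H r unfolding submodule_def submodule_axioms_def by blast
      then have "r \<odot>\<^bsub>M\<^esub> z \<ominus>\<^bsub>M\<^esub> r \<odot>\<^bsub>M\<^esub> x \<in> H"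
        using r x z by (simp add: M.M.minus_eq M.smult_r_distr M.smult_r_minus)
      then show ?thesis using eq r x z by simp
    qed
    have "(\<Union>z\<in>H +>\<^bsub>M\<^esub> x. H +>\<^bsub>M\<^esub> (r \<odot>\<^bsub>M\<^esub> z)) = H +>\<^bsub>M\<^esub> (r \<odot>\<^bsub>M\<^esub> x)"
      by (rule UN_constant_eq[OF H.a_rcos_self[OF x] ballI[OF const]])
    then show ?thesis unfolding quot_module_def with_smult_def by simp
  qed
qed

lemma quot_module_module:
  assumes M: "module R M" and H: "submodule H R M"
  shows "module R (quot_module M H)"
proof -
  interpret M: module R M by fact
  note s = quot_module_simps[OF M H]
  show ?thesis
  proof (rule moduleI)
    show "abelian_group (quot_module M H)"
    proof (rule abelian_groupI)
      fix C assume "C \<in> carrier (quot_module M H)"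
      then obtain x where x: "x \<in> carrier M" "C = H +>\<^bsub>M\<^esub> x" unfolding s by blast
      then have "(H +>\<^bsub>M\<^esub> (\<ominus>\<^bsub>M\<^esub> x)) \<oplus>\<^bsub>quot_module M H\<^esub> C = \<zero>\<^bsub>quot_module M H\<^esub>"
        by (simp add: s M.M.l_neg)
      moreover have "H +>\<^bsub>M\<^esub> (\<ominus>\<^bsub>M\<^esub> x) \<in> carrier (quot_module M H)" using x by (simp add: s)
      ultimately show "\<exists>D\<in>carrier (quot_module M H). D \<oplus>\<^bsub>quot_module M H\<^esub> C = \<zero>\<^bsub>quot_module M H\<^esub>" by blast
    qed (auto simp: s M.M.a_ac)
  qed (auto simp: s M.R.cring_axioms M.smult_l_distr M.smult_r_distr M.smult_assoc1)
qed

locale module_pair =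
  fixes R :: "('r, 'z) ring_scheme" and M :: "('r, 'm, 'y) module_scheme" and N :: "('r, 'n, 'x) module_scheme"
  assumes M: "module R M" and N: "module R N"
begin

abbreviation "FM \<equiv> free_module R (carrier M \<times> carrier N)"
abbreviation "TR \<equiv> tensor_submodule R M N"
abbreviation "TP \<equiv> tensor R M N"
abbreviation "pt \<equiv> pure_tensor R M N"

lemma R_cring: "cring R" using M unfolding module_def by blast

lemma FM_module: "module R FM" by (rule free_module_module[OF R_cring])

lemma gen_closed: "x \<in> carrier M \<Longrightarrow> y \<in> carrier N \<Longrightarrow> free_gen R (x, y) \<in> carrier FM"
  by (rule free_gen_carrier[OF R_cring]) simp

lemma tensor_relations_carrier: "tensor_relations R M N \<subseteq> carrier FM"
proof -
  interpret M: module R M by (rule M)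
  interpret N: module R N by (rule N)
  interpret F: module R FM by (rule FM_module)
  show ?thesis unfolding tensor_relations_def Let_def
    by (auto simp: gen_closed)
qed

lemma TR_submodule: "submodule TR R FM"
proof -
  interpret F: module R FM by (rule FM_module)
  let ?S = "{H. submodule H R FM \<and> tensor_relations R M N \<subseteq> H}"
  have c: "carrier FM \<in> ?S" using F.carrier_is_submodule tensor_relations_carrier by blast
  have H: "\<zero>\<^bsub>FM\<^esub> \<in> H" "\<And>a. a \<in> H \<Longrightarrow> \<ominus>\<^bsub>FM\<^esub> a \<in> H" "\<And>a b. a \<in> H \<Longrightarrow> b \<in> H \<Longrightarrow> a \<oplus>\<^bsub>FM\<^esub> b \<in> H"
    "\<And>r a. r \<in> carrier R \<Longrightarrow> a \<in> H \<Longrightarrow> r \<odot>\<^bsub>FM\<^esub> a \<in> H" if "H \<in> ?S" for H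
  proof -
    have s: "submodule H R FM" using that by blast
    show "\<zero>\<^bsub>FM\<^esub> \<in> H" using subgroup.one_closed[OF submodule.axioms(1)[OF s]] by simp
    show "\<ominus>\<^bsub>FM\<^esub> a \<in> H" if "a \<in> H" for a by (rule F.submoduleE(3)[OF s that])
    show "a \<oplus>\<^bsub>FM\<^esub> b \<in> H" if "a \<in> H" "b \<in> H" for a b by (rule F.submoduleE(5)[OF s that])
    show "r \<odot>\<^bsub>FM\<^esub> a \<in> H" if "r \<in> carrier R" "a \<in> H" for r a by (rule F.submoduleE(4)[OF s that])
  qed
  have "submodule (\<Inter>?S) R FM"
  proof (rule F.submoduleI)
    show "\<Inter>?S \<subseteq> carrier FM" using c by (rule Inter_lower)
    show "\<zero>\<^bsub>FM\<^esub> \<in> \<Inter>?S" by (rule InterI) (rule H(1))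
    fix a assume a: "a \<in> \<Inter>?S"
    show "\<ominus>\<^bsub>FM\<^esub> a \<in> \<Inter>?S" by (rule InterI) (rule H(2), assumption, rule InterD[OF a])
    show "r \<odot>\<^bsub>FM\<^esub> a \<in> \<Inter>?S" if "r \<in> carrier R" for r
      by (rule InterI) (rule H(4)[OF _ that], assumption, rule InterD[OF a])
    fix b assume b: "b \<in> \<Inter>?S"
    show "a \<oplus>\<^bsub>FM\<^esub> b \<in> \<Inter>?S"
      by (rule InterI) (rule H(3), assumption, rule InterD[OF a], assumption, rule InterD[OF b])
  qed
  then show ?thesis unfolding tensor_submodule_def .
qed

lemma TP_module: "module R TP"
  unfolding tensor_def by (rule quot_module_module[OF FM_module TR_submodule])

lemmas TP_simps = quot_module_simps[OF FM_module TR_submodule, folded tensor_def]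

lemma pure_closed [simp]: "x \<in> carrier M \<Longrightarrow> y \<in> carrier N \<Longrightarrow> pt x y \<in> carrier TP"
  unfolding pure_tensor_def TP_simps(1) by (intro imageI gen_closed)

lemma relations_TR: "tensor_relations R M N \<subseteq> TR" unfolding tensor_submodule_def by blast

lemma pure_add_left:
  assumes "x \<in> carrier M" "x' \<in> carrier M" "y \<in> carrier N"
  shows "pt (x \<oplus>\<^bsub>M\<^esub> x') y = pt x y \<oplus>\<^bsub>TP\<^esub> pt x' y"
proof -
  interpret M: module R M by (rule M)
  interpret F: module R FM by (rule FM_module)
  have "free_gen R (x \<oplus>\<^bsub>M\<^esub> x', y) \<ominus>\<^bsub>FM\<^esub> (free_gen R (x, y) \<oplus>\<^bsub>FM\<^esub> free_gen R (x', y)) \<in> TR"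
    by (rule subsetD[OF relations_TR]) (use assms in \<open>unfold tensor_relations_def Let_def, blast\<close>)
  then show ?thesis using assms unfolding pure_tensor_def by (simp add: TP_simps gen_closed)
qed

lemma pure_add_right:
  assumes "x \<in> carrier M" "y \<in> carrier N" "y' \<in> carrier N"
  shows "pt x (y \<oplus>\<^bsub>N\<^esub> y') = pt x y \<oplus>\<^bsub>TP\<^esub> pt x y'"
proof -
  interpret N: module R N by (rule N)
  interpret F: module R FM by (rule FM_module)
  have "free_gen R (x, y \<oplus>\<^bsub>N\<^esub> y') \<ominus>\<^bsub>FM\<^esub> (free_gen R (x, y) \<oplus>\<^bsub>FM\<^esub> free_gen R (x, y')) \<in> TR"
    by (rule subsetD[OF relations_TR]) (use assms in \<open>unfold tensor_relations_def Let_def, blast\<close>)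
  then show ?thesis using assms unfolding pure_tensor_def by (simp add: TP_simps gen_closed)
qed

lemma pure_smult_left:
  assumes "r \<in> carrier R" "x \<in> carrier M" "y \<in> carrier N"
  shows "pt (r \<odot>\<^bsub>M\<^esub> x) y = r \<odot>\<^bsub>TP\<^esub> pt x y"
proof -
  interpret M: module R M by (rule M)
  interpret F: module R FM by (rule FM_module)
  have "free_gen R (r \<odot>\<^bsub>M\<^esub> x, y) \<ominus>\<^bsub>FM\<^esub> r \<odot>\<^bsub>FM\<^esub> free_gen R (x, y) \<in> TR"
    by (rule subsetD[OF relations_TR]) (use assms in \<open>unfold tensor_relations_def Let_def, blast\<close>)
  then show ?thesis using assms unfolding pure_tensor_def by (simp add: TP_simps gen_closed)
qed

lemma pure_smult_right:
  assumes "r \<in> carrier R" "x \<in> carrier M" "y \<in> carrier N"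
  shows "pt x (r \<odot>\<^bsub>N\<^esub> y) = r \<odot>\<^bsub>TP\<^esub> pt x y"
proof -
  interpret N: module R N by (rule N)
  interpret F: module R FM by (rule FM_module)
  have "free_gen R (x, r \<odot>\<^bsub>N\<^esub> y) \<ominus>\<^bsub>FM\<^esub> r \<odot>\<^bsub>FM\<^esub> free_gen R (x, y) \<in> TR"
    by (rule subsetD[OF relations_TR]) (use assms in \<open>unfold tensor_relations_def Let_def, blast\<close>)
  then show ?thesis using assms unfolding pure_tensor_def by (simp add: TP_simps gen_closed)
qed

lemma pure_zero_left [simp]: "y \<in> carrier N \<Longrightarrow> pt \<zero>\<^bsub>M\<^esub> y = \<zero>\<^bsub>TP\<^esub>"
proof -
  assume y: "y \<in> carrier N"
  interpret M: module R M by (rule M)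
  interpret T: module R TP by (rule TP_module)
  show ?thesis using pure_smult_left[of "\<zero>\<^bsub>R\<^esub>" "\<zero>\<^bsub>M\<^esub>" y] y by simp
qed

lemma pure_zero_right [simp]: "x \<in> carrier M \<Longrightarrow> pt x \<zero>\<^bsub>N\<^esub> = \<zero>\<^bsub>TP\<^esub>"
proof -
  assume x: "x \<in> carrier M"
  interpret N: module R N by (rule N)
  interpret T: module R TP by (rule TP_module)
  show ?thesis using pure_smult_right[of "\<zero>\<^bsub>R\<^esub>" x "\<zero>\<^bsub>N\<^esub>"] x by simp
qed

text \<open>Scalar multiples of elementary tensors are elementary tensors, as is zero. So closure under
  addition is enough.\<close>

lemma tensor_induct [consumes 1, case_names pure add]:
  assumes "t \<in> carrier TP"
    and pure: "\<And>x y. \<lbrakk>x \<in> carrier M; y \<in> carrier N\<rbrakk> \<Longrightarrow> P (pt x y)"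
    and add: "\<And>s t. \<lbrakk>s \<in> carrier TP; t \<in> carrier TP; P s; P t\<rbrakk> \<Longrightarrow> P (s \<oplus>\<^bsub>TP\<^esub> t)"
  shows "P t"
proof -
  interpret R: cring R by (rule R_cring)
  interpret M: module R M by (rule M)
  interpret N: module R N by (rule N)
  interpret F: module R FM by (rule FM_module)
  interpret T: module R TP by (rule TP_module)
  have "P (TR +>\<^bsub>FM\<^esub> p)" if "finite A" "p \<in> carrier FM" "{s. p s \<noteq> \<zero>\<^bsub>R\<^esub>} \<subseteq> A" for p A
    using that
  proof (induct A arbitrary: p)
    case empty
    then have "p = \<zero>\<^bsub>FM\<^esub>" unfolding free_module_def by auto
    then have "TR +>\<^bsub>FM\<^esub> p = \<zero>\<^bsub>TP\<^esub>" using TP_simps(3) by simp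
    then show ?case using pure[of "\<zero>\<^bsub>M\<^esub>" "\<zero>\<^bsub>N\<^esub>"] by simp
  next
    case (insert s A)
    show ?case
    proof (cases "s \<in> carrier M \<times> carrier N")
      case False
      then have "p s = \<zero>\<^bsub>R\<^esub>" using free_moduleD(2)[OF insert(4)] by simp
      then have "{s. p s \<noteq> \<zero>\<^bsub>R\<^esub>} \<subseteq> A" using insert(5) by auto
      then show ?thesis by (rule insert.hyps(3)[OF insert(4)])
    next
      case True
      then obtain x y where xy: "s = (x, y)" "x \<in> carrier M" "y \<in> carrier N" by auto
      let ?q = "\<lambda>s'. if s' = s then \<zero>\<^bsub>R\<^esub> else p s'"
      have ps: "p s \<in> carrier R" by (rule free_moduleD(1)[OF insert(4)])
      have "finite {s'. ?q s' \<noteq> \<zero>\<^bsub>R\<^esub>}"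
        by (rule finite_subset[of _ "{s. p s \<noteq> \<zero>\<^bsub>R\<^esub>}"]) (use insert(4) in \<open>auto simp: free_module_def\<close>)
      then have q: "?q \<in> carrier FM" using insert(4) by (simp add: free_module_def)
      have g: "p s \<odot>\<^bsub>FM\<^esub> free_gen R s \<in> carrier FM" using gen_closed[OF xy(2,3)] xy(1) ps by simp
      have "p = p s \<odot>\<^bsub>FM\<^esub> free_gen R s \<oplus>\<^bsub>FM\<^esub> ?q"
        using free_moduleD(1)[OF insert(4)] by (intro ext) (simp add: free_module_def free_gen_def)
      then have "TR +>\<^bsub>FM\<^esub> p = (TR +>\<^bsub>FM\<^esub> (p s \<odot>\<^bsub>FM\<^esub> free_gen R s)) \<oplus>\<^bsub>TP\<^esub> (TR +>\<^bsub>FM\<^esub> ?q)"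
        using TP_simps(2)[OF g q] by simp
      also have "TR +>\<^bsub>FM\<^esub> (p s \<odot>\<^bsub>FM\<^esub> free_gen R s) = p s \<odot>\<^bsub>TP\<^esub> pt x y"
        unfolding pure_tensor_def xy(1)[symmetric] using TP_simps(5)[OF ps] gen_closed[OF xy(2,3)] xy(1) by simp
      also have "\<dots> = pt (p s \<odot>\<^bsub>M\<^esub> x) y" using pure_smult_left[OF ps xy(2,3)] by simp
      finally have eq: "TR +>\<^bsub>FM\<^esub> p = pt (p s \<odot>\<^bsub>M\<^esub> x) y \<oplus>\<^bsub>TP\<^esub> (TR +>\<^bsub>FM\<^esub> ?q)" .
      have "{s'. ?q s' \<noteq> \<zero>\<^bsub>R\<^esub>} \<subseteq> A" using insert(5) by auto
      then have "P (TR +>\<^bsub>FM\<^esub> ?q)" by (rule insert.hyps(3)[OF q])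
      moreover have "TR +>\<^bsub>FM\<^esub> ?q \<in> carrier TP" using q TP_simps(1) by blast
      ultimately show ?thesis unfolding eq using xy ps by (intro add pure pure_closed) simp_all
    qed
  qed
  then show ?thesis using assms(1) unfolding TP_simps(1) by (auto simp: free_module_def)
qed

end

definition bilinear_map ::
  "('r, 'z) ring_scheme \<Rightarrow> ('r, 'm, 'y) module_scheme \<Rightarrow> ('r, 'n, 'x) module_scheme \<Rightarrow>
   ('r, 'p, 'w) module_scheme \<Rightarrow> ('m \<Rightarrow> 'n \<Rightarrow> 'p) \<Rightarrow> bool" where
  "bilinear_map R M N P f \<longleftrightarrow>
     (\<forall>x\<in>carrier M. \<forall>y\<in>carrier N. f x y \<in> carrier P) \<and>
     (\<forall>x\<in>carrier M. \<forall>x'\<in>carrier M. \<forall>y\<in>carrier N. f (x \<oplus>\<^bsub>M\<^esub> x') y = f x y \<oplus>\<^bsub>P\<^esub> f x' y) \<and>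
     (\<forall>x\<in>carrier M. \<forall>y\<in>carrier N. \<forall>y'\<in>carrier N. f x (y \<oplus>\<^bsub>N\<^esub> y') = f x y \<oplus>\<^bsub>P\<^esub> f x y') \<and>
     (\<forall>r\<in>carrier R. \<forall>x\<in>carrier M. \<forall>y\<in>carrier N. f (r \<odot>\<^bsub>M\<^esub> x) y = r \<odot>\<^bsub>P\<^esub> f x y) \<and>
     (\<forall>r\<in>carrier R. \<forall>x\<in>carrier M. \<forall>y\<in>carrier N. f x (r \<odot>\<^bsub>N\<^esub> y) = r \<odot>\<^bsub>P\<^esub> f x y)"

lemma bilinear_mapD:
  assumes "bilinear_map R M N P f"
  shows "\<lbrakk>x \<in> carrier M; y \<in> carrier N\<rbrakk> \<Longrightarrow> f x y \<in> carrier P"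
    and "\<lbrakk>x \<in> carrier M; x' \<in> carrier M; y \<in> carrier N\<rbrakk> \<Longrightarrow> f (x \<oplus>\<^bsub>M\<^esub> x') y = f x y \<oplus>\<^bsub>P\<^esub> f x' y"
    and "\<lbrakk>x \<in> carrier M; y \<in> carrier N; y' \<in> carrier N\<rbrakk> \<Longrightarrow> f x (y \<oplus>\<^bsub>N\<^esub> y') = f x y \<oplus>\<^bsub>P\<^esub> f x y'"
    and "\<lbrakk>r \<in> carrier R; x \<in> carrier M; y \<in> carrier N\<rbrakk> \<Longrightarrow> f (r \<odot>\<^bsub>M\<^esub> x) y = r \<odot>\<^bsub>P\<^esub> f x y"
    and "\<lbrakk>r \<in> carrier R; x \<in> carrier M; y \<in> carrier N\<rbrakk> \<Longrightarrow> f x (r \<odot>\<^bsub>N\<^esub> y) = r \<odot>\<^bsub>P\<^esub> f x y"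
  using assms unfolding bilinear_map_def by simp_all

text \<open>The universal property. The linear extension \<open>L\<close> of \<open>f\<close> to the free module kills the bilinearity
  relations, hence the submodule that they generate, so that \<open>L\<close> has the same value at all
  representatives of a tensor, whichever of them is chosen.\<close>

theorem (in module_pair) tensor_lift:
  assumes P: "module R P" and f: "bilinear_map R M N P f"
  shows "\<And>x y. \<lbrakk>x \<in> carrier M; y \<in> carrier N\<rbrakk> \<Longrightarrow> tensor_lift M N P R f (pt x y) = f x y"
    and "\<And>t. t \<in> carrier TP \<Longrightarrow> tensor_lift M N P R f t \<in> carrier P"
    and "\<And>s t. \<lbrakk>s \<in> carrier TP; t \<in> carrier TP\<rbrakk> \<Longrightarrow>
      tensor_lift M N P R f (s \<oplus>\<^bsub>TP\<^esub> t) = tensor_lift M N P R f s \<oplus>\<^bsub>P\<^esub> tensor_lift M N P R f t"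
    and "\<And>r t. \<lbrakk>r \<in> carrier R; t \<in> carrier TP\<rbrakk> \<Longrightarrow>
      tensor_lift M N P R f (r \<odot>\<^bsub>TP\<^esub> t) = r \<odot>\<^bsub>P\<^esub> tensor_lift M N P R f t"
proof -
  interpret R: cring R by (rule R_cring)
  interpret M: module R M by (rule M)
  interpret N: module R N by (rule N)
  interpret F: module R FM by (rule FM_module)
  interpret T: module R TP by (rule TP_module)
  interpret P: module R P by (rule P)
  let ?S = "carrier M \<times> carrier N"
  let ?supp = "\<lambda>p. {s. p s \<noteq> \<zero>\<^bsub>R\<^esub>}"
  define f' where "f' s = f (fst s) (snd s)" for s
  have f'c: "f' s \<in> carrier P" if "s \<in> ?S" for s using bilinear_mapD(1)[OF f, of "fst s" "snd s"] that unfolding f'_def by (simp add: mem_Times_iff)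
  define L where "L p = (\<Oplus>\<^bsub>P\<^esub>s\<in>?supp p. p s \<odot>\<^bsub>P\<^esub> f' s)" for p
  have L: "L p = (\<Oplus>\<^bsub>P\<^esub>s\<in>A. p s \<odot>\<^bsub>P\<^esub> f' s)" if "p \<in> carrier FM" "finite A" "?supp p \<subseteq> A" "A \<subseteq> ?S" for p A
    unfolding L_def
  proof (rule P.M.add.finprod_mono_neutral_cong_left[OF that(2,3)])
    show "(\<lambda>s. p s \<odot>\<^bsub>P\<^esub> f' s) \<in> A \<rightarrow> carrier P"
    proof
      fix s assume "s \<in> A"
      then have "f' s \<in> carrier P" by (intro f'c subsetD[OF that(4)])
      then show "p s \<odot>\<^bsub>P\<^esub> f' s \<in> carrier P" using free_moduleD(1)[OF that(1)] by simp
    qed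
    fix s assume "s \<in> A - ?supp p"
    then have "p s = \<zero>\<^bsub>R\<^esub>" "f' s \<in> carrier P" using that(4) by (auto intro: f'c)
    then show "p s \<odot>\<^bsub>P\<^esub> f' s = \<zero>\<^bsub>P\<^esub>" by simp
  qed simp
  have supp: "finite (?supp p)" "?supp p \<subseteq> ?S" "\<And>s. p s \<in> carrier R" if "p \<in> carrier FM" for p
    using free_moduleD[OF that] by auto
  have Lc: "L p \<in> carrier P" if "p \<in> carrier FM" for p
    unfolding L_def using supp[OF that] f'c by (intro P.M.finsum_closed) (auto simp: subset_iff)
  have Ladd: "L (p \<oplus>\<^bsub>FM\<^esub> q) = L p \<oplus>\<^bsub>P\<^esub> L q" if p: "p \<in> carrier FM" and q: "q \<in> carrier FM" for p q
  proof -
    define A where "A = ?supp p \<union> ?supp q"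
    have A: "finite A" "A \<subseteq> ?S" and sA: "?supp p \<subseteq> A" "?supp q \<subseteq> A"
      unfolding A_def using supp(1,2)[OF p] supp(1,2)[OF q] by auto
    have f'A: "f' s \<in> carrier P" if "s \<in> A" for s using f'c subsetD[OF A(2) that] .
    have pq: "p \<oplus>\<^bsub>FM\<^esub> q \<in> carrier FM" "\<And>s. (p \<oplus>\<^bsub>FM\<^esub> q) s = p s \<oplus>\<^bsub>R\<^esub> q s"
      using p q by (simp, simp add: free_module_def)
    have "?supp (p \<oplus>\<^bsub>FM\<^esub> q) \<subseteq> A" unfolding pq(2) A_def by auto
    then have "L (p \<oplus>\<^bsub>FM\<^esub> q) = (\<Oplus>\<^bsub>P\<^esub>s\<in>A. (p \<oplus>\<^bsub>FM\<^esub> q) s \<odot>\<^bsub>P\<^esub> f' s)" by (rule L[OF pq(1) A(1) _ A(2)])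
    also have "\<dots> = (\<Oplus>\<^bsub>P\<^esub>s\<in>A. p s \<odot>\<^bsub>P\<^esub> f' s \<oplus>\<^bsub>P\<^esub> q s \<odot>\<^bsub>P\<^esub> f' s)"
      unfolding pq(2) using supp(3)[OF p] supp(3)[OF q] f'A
      by (intro P.M.finsum_cong') (simp_all add: P.smult_l_distr Pi_def)
    also have "\<dots> = (\<Oplus>\<^bsub>P\<^esub>s\<in>A. p s \<odot>\<^bsub>P\<^esub> f' s) \<oplus>\<^bsub>P\<^esub> (\<Oplus>\<^bsub>P\<^esub>s\<in>A. q s \<odot>\<^bsub>P\<^esub> f' s)"
      using supp(3)[OF p] supp(3)[OF q] f'A
      by (intro P.M.finsum_addf) (simp_all add: Pi_def)
    also have "\<dots> = L p \<oplus>\<^bsub>P\<^esub> L q" using L[OF p A(1) sA(1) A(2)] L[OF q A(1) sA(2) A(2)] by simp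
    finally show ?thesis .
  qed
  have Lsmult: "L (r \<odot>\<^bsub>FM\<^esub> p) = r \<odot>\<^bsub>P\<^esub> L p" if p: "p \<in> carrier FM" and r: "r \<in> carrier R" for p r
  proof -
    define A where "A = ?supp p"
    have A: "finite A" "A \<subseteq> ?S" unfolding A_def using supp(1,2)[OF p] by auto
    have f'A: "f' s \<in> carrier P" if "s \<in> A" for s using f'c subsetD[OF A(2) that] .
    have rp: "r \<odot>\<^bsub>FM\<^esub> p \<in> carrier FM" "\<And>s. (r \<odot>\<^bsub>FM\<^esub> p) s = r \<otimes>\<^bsub>R\<^esub> p s"
      using p r by (simp, simp add: free_module_def)
    have "?supp (r \<odot>\<^bsub>FM\<^esub> p) \<subseteq> A" unfolding rp(2) A_def using r by auto
    then have "L (r \<odot>\<^bsub>FM\<^esub> p) = (\<Oplus>\<^bsub>P\<^esub>s\<in>A. (r \<odot>\<^bsub>FM\<^esub> p) s \<odot>\<^bsub>P\<^esub> f' s)"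
      by (rule L[OF rp(1) A(1) _ A(2)])
    also have "\<dots> = (\<Oplus>\<^bsub>P\<^esub>s\<in>A. r \<odot>\<^bsub>P\<^esub> (p s \<odot>\<^bsub>P\<^esub> f' s))"
      unfolding rp(2) using supp(3)[OF p] f'A r
      by (intro P.M.finsum_cong') (simp_all add: P.smult_assoc1 Pi_def)
    also have "\<dots> = r \<odot>\<^bsub>P\<^esub> (\<Oplus>\<^bsub>P\<^esub>s\<in>A. p s \<odot>\<^bsub>P\<^esub> f' s)" using A supp(3)[OF p] f'A r
      by (intro P.finsum_smult_ldistr[symmetric]) (simp_all add: Pi_def)
    also have "\<dots> = r \<odot>\<^bsub>P\<^esub> L p" unfolding L_def A_def ..
    finally show ?thesis .
  qed
  have Lneg: "L (\<ominus>\<^bsub>FM\<^esub> p) = \<ominus>\<^bsub>P\<^esub> L p" if p: "p \<in> carrier FM" for p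
    using Lsmult[OF p, of "\<ominus>\<^bsub>R\<^esub> \<one>\<^bsub>R\<^esub>"] p Lc[OF p] F.smult_l_minus[of "\<one>\<^bsub>R\<^esub>" p]
      P.smult_l_minus[of "\<one>\<^bsub>R\<^esub>" "L p"] by simp
  have Lgen: "L (free_gen R (x, y)) = f x y" if "x \<in> carrier M" "y \<in> carrier N" for x y
  proof -
    have "L (free_gen R (x, y)) = (\<Oplus>\<^bsub>P\<^esub>s\<in>{(x, y)}. free_gen R (x, y) s \<odot>\<^bsub>P\<^esub> f' s)"
      by (rule L[OF gen_closed[OF that]]) (use that in \<open>auto simp: free_gen_def\<close>)
    also have "\<dots> = f x y" using f'c[of "(x, y)"] that by (simp add: free_gen_def f'_def)
    finally show ?thesis .
  qed
  define Ker where "Ker = {p \<in> carrier FM. L p = \<zero>\<^bsub>P\<^esub>}"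
  have Lzero: "L \<zero>\<^bsub>FM\<^esub> = \<zero>\<^bsub>P\<^esub>" unfolding L_def by (simp add: free_module_def)
  have "submodule Ker R FM"
    by (rule F.submoduleI) (auto simp: Ker_def Lzero Ladd Lneg Lsmult)
  moreover have "tensor_relations R M N \<subseteq> Ker"
    unfolding tensor_relations_def Let_def Ker_def
    by (auto simp: F.M.minus_eq gen_closed Ladd Lneg Lgen Lsmult P.M.r_neg bilinear_mapD[OF f])
  ultimately have TRK: "TR \<subseteq> Ker" unfolding tensor_submodule_def by blast
  have lift: "tensor_lift M N P R f (TR +>\<^bsub>FM\<^esub> p) = L p" if p: "p \<in> carrier FM" for p
  proof -
    interpret H: abelian_subgroup TR FM
      using TR_submodule F.M.abelian_group_axioms unfolding submodule_def
      by (intro abelian_subgroupI3 additive_subgroupI) auto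
    define q where "q = (SOME q. q \<in> TR +>\<^bsub>FM\<^esub> p)"
    have q: "q \<in> TR +>\<^bsub>FM\<^esub> p" unfolding q_def by (rule someI[where P = "\<lambda>q. q \<in> TR +>\<^bsub>FM\<^esub> p", OF H.a_rcos_self[OF p]])
    then obtain k where k: "k \<in> TR" "q = k \<oplus>\<^bsub>FM\<^esub> p" unfolding a_r_coset_def' by auto
    then have "L q = L p" using TRK p Ladd[of k p] Lc[OF p] unfolding Ker_def by auto
    then show ?thesis unfolding tensor_lift_def Let_def q_def[symmetric] unfolding L_def f'_def .
  qed
  show "tensor_lift M N P R f (pt x y) = f x y" if "x \<in> carrier M" "y \<in> carrier N" for x y
    unfolding pure_tensor_def using lift[OF gen_closed[OF that]] Lgen[OF that] by simp
  show "tensor_lift M N P R f t \<in> carrier P" if "t \<in> carrier TP" for t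
    using that lift Lc unfolding TP_simps(1) by auto
  show "tensor_lift M N P R f (s \<oplus>\<^bsub>TP\<^esub> t) = tensor_lift M N P R f s \<oplus>\<^bsub>P\<^esub> tensor_lift M N P R f t"
    if "s \<in> carrier TP" "t \<in> carrier TP" for s t
    using that lift Ladd unfolding TP_simps(1) by (auto simp: TP_simps(2))
  show "tensor_lift M N P R f (r \<odot>\<^bsub>TP\<^esub> t) = r \<odot>\<^bsub>P\<^esub> tensor_lift M N P R f t"
    if "r \<in> carrier R" "t \<in> carrier TP" for r t
    using that lift Lsmult unfolding TP_simps(1) by (auto simp: TP_simps(5))
qed

section \<open>Coordinates on a cell ideal\<close>

lemma with_smult_simps [simp]:
  "carrier (with_smult M s) = carrier M" "\<one>\<^bsub>with_smult M s\<^esub> = \<one>\<^bsub>M\<^esub>" "\<zero>\<^bsub>with_smult M s\<^esub> = \<zero>\<^bsub>M\<^esub>"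
  "x \<oplus>\<^bsub>with_smult M s\<^esub> y = x \<oplus>\<^bsub>M\<^esub> y" "x \<otimes>\<^bsub>with_smult M s\<^esub> y = x \<otimes>\<^bsub>M\<^esub> y"
  "a \<odot>\<^bsub>with_smult M s\<^esub> x = s a x"
  unfolding with_smult_def by simp_all

lemma abelian_group_with_smult:
  assumes "abelian_group M" shows "abelian_group (with_smult M s)"
proof -
  interpret M: abelian_group M by fact
  show ?thesis
  proof (rule abelian_groupI)
    fix x assume "x \<in> carrier (with_smult M s)"
    then show "\<exists>y\<in>carrier (with_smult M s). y \<oplus>\<^bsub>with_smult M s\<^esub> x = \<zero>\<^bsub>with_smult M s\<^esub>"
      by (intro bexI[of _ "\<ominus>\<^bsub>M\<^esub> x"]) (simp_all add: M.l_neg)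
  qed (simp_all add: M.a_ac)
qed

lemma regular_module_module: "cring B \<Longrightarrow> module B (regular_module B)"
proof -
  assume "cring B"
  then interpret B: cring B .
  show ?thesis unfolding regular_module_def
    by (rule moduleI)
       (auto simp: B.cring_axioms B.l_distr B.r_distr B.m_assoc intro!: abelian_group_with_smult B.abelian_group_axioms)
qed

definition coord ::
  "('k, 'z) ring_scheme \<Rightarrow> ('k, 'v, 'y) module_scheme \<Rightarrow> nat \<Rightarrow> (nat \<Rightarrow> 'v) \<Rightarrow> nat \<Rightarrow> 'v \<Rightarrow> 'k" where
  "coord K V n v i x =
     (THE c. c \<in> {1..n} \<rightarrow>\<^sub>E carrier K \<and> x = (\<Oplus>\<^bsub>V\<^esub>i\<in>{1..n}. c i \<odot>\<^bsub>V\<^esub> v i)) i"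

locale based_module =
  fixes K :: "('k, 'z) ring_scheme" and V :: "('k, 'v, 'y) module_scheme" and n :: nat and v :: "nat \<Rightarrow> 'v"
  assumes basis: "is_basis K V n v"
begin

lemma V_module: "module K V" using basis unfolding is_basis_def by blast

lemma v_closed [simp]: "i \<in> {1..n} \<Longrightarrow> v i \<in> carrier V" using basis unfolding is_basis_def by blast

lemma ex1_coords:
  "x \<in> carrier V \<Longrightarrow> \<exists>!c. c \<in> {1..n} \<rightarrow>\<^sub>E carrier K \<and> x = (\<Oplus>\<^bsub>V\<^esub>i\<in>{1..n}. c i \<odot>\<^bsub>V\<^esub> v i)"
  using basis unfolding is_basis_def by simp

lemma coord_eqI:
  assumes c: "\<And>i. i \<in> {1..n} \<Longrightarrow> c i \<in> carrier K" and x: "x = (\<Oplus>\<^bsub>V\<^esub>i\<in>{1..n}. c i \<odot>\<^bsub>V\<^esub> v i)"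
    and i: "i \<in> {1..n}"
  shows "coord K V n v i x = c i"
proof -
  interpret V: module K V by (rule V_module)
  let ?c = "restrict c {1..n}"
  have "(\<Oplus>\<^bsub>V\<^esub>i\<in>{1..n}. c i \<odot>\<^bsub>V\<^esub> v i) \<in> carrier V" using c by (intro V.M.finsum_closed) auto
  then have xV: "x \<in> carrier V" using x by simp
  note ex = ex1_coords[OF xV]
  have "(\<Oplus>\<^bsub>V\<^esub>i\<in>{1..n}. c i \<odot>\<^bsub>V\<^esub> v i) = (\<Oplus>\<^bsub>V\<^esub>i\<in>{1..n}. ?c i \<odot>\<^bsub>V\<^esub> v i)"
    using c by (intro V.M.finsum_cong') auto
  then have "?c \<in> {1..n} \<rightarrow>\<^sub>E carrier K \<and> x = (\<Oplus>\<^bsub>V\<^esub>i\<in>{1..n}. ?c i \<odot>\<^bsub>V\<^esub> v i)" using c x by auto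
  then have "(THE c. c \<in> {1..n} \<rightarrow>\<^sub>E carrier K \<and> x = (\<Oplus>\<^bsub>V\<^esub>i\<in>{1..n}. c i \<odot>\<^bsub>V\<^esub> v i)) = ?c"
    by (rule the1_equality[OF ex])
  then show ?thesis unfolding coord_def using i by simp
qed

lemma coord_expansion:
  assumes "x \<in> carrier V"
  shows "\<And>i. i \<in> {1..n} \<Longrightarrow> coord K V n v i x \<in> carrier K"
    and "x = (\<Oplus>\<^bsub>V\<^esub>i\<in>{1..n}. coord K V n v i x \<odot>\<^bsub>V\<^esub> v i)"
proof -
  interpret V: module K V by (rule V_module)
  obtain c where c: "c \<in> {1..n} \<rightarrow>\<^sub>E carrier K" "x = (\<Oplus>\<^bsub>V\<^esub>i\<in>{1..n}. c i \<odot>\<^bsub>V\<^esub> v i)"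
    using ex1_implies_ex[OF ex1_coords[OF assms]] by auto
  have ck: "\<And>i. i \<in> {1..n} \<Longrightarrow> c i \<in> carrier K" using c by blast
  have eq: "coord K V n v i x = c i" if "i \<in> {1..n}" for i by (rule coord_eqI[OF ck c(2) that])
  show "coord K V n v i x \<in> carrier K" if "i \<in> {1..n}" for i using eq ck that by simp
  have "(\<Oplus>\<^bsub>V\<^esub>i\<in>{1..n}. c i \<odot>\<^bsub>V\<^esub> v i) = (\<Oplus>\<^bsub>V\<^esub>i\<in>{1..n}. coord K V n v i x \<odot>\<^bsub>V\<^esub> v i)"
    using eq ck by (intro V.M.finsum_cong') auto
  then show "x = (\<Oplus>\<^bsub>V\<^esub>i\<in>{1..n}. coord K V n v i x \<odot>\<^bsub>V\<^esub> v i)" using c(2) by simp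
qed

lemma coord_add:
  assumes x: "x \<in> carrier V" and y: "y \<in> carrier V" and i: "i \<in> {1..n}"
  shows "coord K V n v i (x \<oplus>\<^bsub>V\<^esub> y) = coord K V n v i x \<oplus>\<^bsub>K\<^esub> coord K V n v i y"
proof (rule coord_eqI[OF _ _ i])
  interpret V: module K V by (rule V_module)
  show "coord K V n v i x \<oplus>\<^bsub>K\<^esub> coord K V n v i y \<in> carrier K" if "i \<in> {1..n}" for i
    using that coord_expansion(1)[OF x] coord_expansion(1)[OF y] by simp
  have "x \<oplus>\<^bsub>V\<^esub> y = (\<Oplus>\<^bsub>V\<^esub>i\<in>{1..n}. coord K V n v i x \<odot>\<^bsub>V\<^esub> v i) \<oplus>\<^bsub>V\<^esub> (\<Oplus>\<^bsub>V\<^esub>i\<in>{1..n}. coord K V n v i y \<odot>\<^bsub>V\<^esub> v i)"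
    using coord_expansion(2)[OF x] coord_expansion(2)[OF y] by simp
  also have "\<dots> = (\<Oplus>\<^bsub>V\<^esub>i\<in>{1..n}. coord K V n v i x \<odot>\<^bsub>V\<^esub> v i \<oplus>\<^bsub>V\<^esub> coord K V n v i y \<odot>\<^bsub>V\<^esub> v i)"
    using coord_expansion(1)[OF x] coord_expansion(1)[OF y] by (intro V.M.finsum_addf[symmetric]) auto
  also have "\<dots> = (\<Oplus>\<^bsub>V\<^esub>i\<in>{1..n}. (coord K V n v i x \<oplus>\<^bsub>K\<^esub> coord K V n v i y) \<odot>\<^bsub>V\<^esub> v i)"
    using coord_expansion(1)[OF x] coord_expansion(1)[OF y]
    by (intro V.M.finsum_cong') (auto simp: V.smult_l_distr)
  finally show "x \<oplus>\<^bsub>V\<^esub> y = (\<Oplus>\<^bsub>V\<^esub>i\<in>{1..n}. (coord K V n v i x \<oplus>\<^bsub>K\<^esub> coord K V n v i y) \<odot>\<^bsub>V\<^esub> v i)" .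
qed

lemma coord_smult:
  assumes k: "k \<in> carrier K" and x: "x \<in> carrier V" and i: "i \<in> {1..n}"
  shows "coord K V n v i (k \<odot>\<^bsub>V\<^esub> x) = k \<otimes>\<^bsub>K\<^esub> coord K V n v i x"
proof (rule coord_eqI[OF _ _ i])
  interpret V: module K V by (rule V_module)
  show "k \<otimes>\<^bsub>K\<^esub> coord K V n v i x \<in> carrier K" if "i \<in> {1..n}" for i
    using that k coord_expansion(1)[OF x] by simp
  have "k \<odot>\<^bsub>V\<^esub> x = k \<odot>\<^bsub>V\<^esub> (\<Oplus>\<^bsub>V\<^esub>i\<in>{1..n}. coord K V n v i x \<odot>\<^bsub>V\<^esub> v i)"
    using coord_expansion(2)[OF x] by simp
  also have "\<dots> = (\<Oplus>\<^bsub>V\<^esub>i\<in>{1..n}. k \<odot>\<^bsub>V\<^esub> (coord K V n v i x \<odot>\<^bsub>V\<^esub> v i))"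
    using k coord_expansion(1)[OF x] by (intro V.finsum_smult_ldistr) auto
  also have "\<dots> = (\<Oplus>\<^bsub>V\<^esub>i\<in>{1..n}. (k \<otimes>\<^bsub>K\<^esub> coord K V n v i x) \<odot>\<^bsub>V\<^esub> v i)"
    using k coord_expansion(1)[OF x] by (intro V.M.finsum_cong') (auto simp: V.smult_assoc1)
  finally show "k \<odot>\<^bsub>V\<^esub> x = (\<Oplus>\<^bsub>V\<^esub>i\<in>{1..n}. (k \<otimes>\<^bsub>K\<^esub> coord K V n v i x) \<odot>\<^bsub>V\<^esub> v i)" .
qed

lemma coord_basis:
  assumes i: "i \<in> {1..n}" and j: "j \<in> {1..n}"
  shows "coord K V n v i (v j) = (if i = j then \<one>\<^bsub>K\<^esub> else \<zero>\<^bsub>K\<^esub>)"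
proof (rule coord_eqI[OF _ _ i])
  interpret V: module K V by (rule V_module)
  show "(if i = j then \<one>\<^bsub>K\<^esub> else \<zero>\<^bsub>K\<^esub>) \<in> carrier K" for i by simp
  have "v j = (\<Oplus>\<^bsub>V\<^esub>i\<in>{1..n}. if j = i then v i else \<zero>\<^bsub>V\<^esub>)"
    by (rule V.M.finsum_singleton[symmetric]) (use j in auto)
  also have "\<dots> = (\<Oplus>\<^bsub>V\<^esub>i\<in>{1..n}. (if i = j then \<one>\<^bsub>K\<^esub> else \<zero>\<^bsub>K\<^esub>) \<odot>\<^bsub>V\<^esub> v i)"
    by (intro V.M.finsum_cong') auto
  finally show "v j = (\<Oplus>\<^bsub>V\<^esub>i\<in>{1..n}. (if i = j then \<one>\<^bsub>K\<^esub> else \<zero>\<^bsub>K\<^esub>) \<odot>\<^bsub>V\<^esub> v i)" .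
qed

lemma basis_induct [consumes 1, case_names zero smult add]:
  assumes x: "x \<in> carrier V" and "P \<zero>\<^bsub>V\<^esub>"
    and "\<And>k i. \<lbrakk>k \<in> carrier K; i \<in> {1..n}\<rbrakk> \<Longrightarrow> P (k \<odot>\<^bsub>V\<^esub> v i)"
    and "\<And>x y. \<lbrakk>x \<in> carrier V; y \<in> carrier V; P x; P y\<rbrakk> \<Longrightarrow> P (x \<oplus>\<^bsub>V\<^esub> y)"
  shows "P x"
proof -
  interpret V: module K V by (rule V_module)
  have "P (\<Oplus>\<^bsub>V\<^esub>i\<in>{1..n}. coord K V n v i x \<odot>\<^bsub>V\<^esub> v i)"
    by (rule V.M.finsum_induct) (use assms coord_expansion(1)[OF x] in auto)
  then show ?thesis using coord_expansion(2)[OF x] by simp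
qed

end

locale cell_data = based_module K V n v
  for K :: "('k, 'z) ring_scheme" and V :: "('k, 'v) module" and n v +
  fixes B :: "('k, 'b) module"
  assumes B: "algebra K B"
begin

abbreviation "TVB \<equiv> tensor K V B"
abbreviation "TBV \<equiv> tensor K B V"
abbreviation "ptVB \<equiv> pure_tensor K V B"
abbreviation "ptBV \<equiv> pure_tensor K B V"
abbreviation "\<Delta> \<equiv> cell_Delta K V B"
abbreviation "\<Delta>' \<equiv> cell_Delta' K V B"
abbreviation "TT \<equiv> cell_tensor K V B"
abbreviation "celt \<equiv> cell_elem K V B"

lemma B_module: "module K B" by (rule algebra.module[OF B])
lemma B_cring: "cring B" by (rule algebra.M_cring[OF B])

sublocale VB: module_pair K V B by (rule module_pair.intro[OF V_module B_module])
sublocale BV: module_pair K B V by (rule module_pair.intro[OF B_module V_module])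

lemma smult_mult:
  assumes "k \<in> carrier K" "b \<in> carrier B" "c \<in> carrier B"
  shows "(k \<odot>\<^bsub>B\<^esub> b) \<otimes>\<^bsub>B\<^esub> c = k \<odot>\<^bsub>B\<^esub> (b \<otimes>\<^bsub>B\<^esub> c)" "b \<otimes>\<^bsub>B\<^esub> (k \<odot>\<^bsub>B\<^esub> c) = k \<odot>\<^bsub>B\<^esub> (b \<otimes>\<^bsub>B\<^esub> c)"
proof -
  interpret B: cring B by (rule B_cring)
  interpret BM: module K B by (rule B_module)
  have 1: "(k \<odot>\<^bsub>B\<^esub> b) \<otimes>\<^bsub>B\<^esub> c = k \<odot>\<^bsub>B\<^esub> (b \<otimes>\<^bsub>B\<^esub> c)" if "b \<in> carrier B" "c \<in> carrier B" for b c
    using algebra.smult_assoc2[OF B assms(1) that] .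
  show "(k \<odot>\<^bsub>B\<^esub> b) \<otimes>\<^bsub>B\<^esub> c = k \<odot>\<^bsub>B\<^esub> (b \<otimes>\<^bsub>B\<^esub> c)" by (rule 1[OF assms(2,3)])
  show "b \<otimes>\<^bsub>B\<^esub> (k \<odot>\<^bsub>B\<^esub> c) = k \<odot>\<^bsub>B\<^esub> (b \<otimes>\<^bsub>B\<^esub> c)"
    using 1[OF assms(3,2)] assms by (metis B.m_comm BM.smult_closed)
qed

lemma Delta_carrier [simp]: "carrier \<Delta> = carrier TVB" "x \<oplus>\<^bsub>\<Delta>\<^esub> y = x \<oplus>\<^bsub>TVB\<^esub> y" "\<zero>\<^bsub>\<Delta>\<^esub> = \<zero>\<^bsub>TVB\<^esub>"
  and Delta'_carrier [simp]: "carrier \<Delta>' = carrier TBV" "x' \<oplus>\<^bsub>\<Delta>'\<^esub> y' = x' \<oplus>\<^bsub>TBV\<^esub> y'" "\<zero>\<^bsub>\<Delta>'\<^esub> = \<zero>\<^bsub>TBV\<^esub>"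
  unfolding cell_Delta_def cell_Delta'_def by simp_all

lemma Delta_smult:
  assumes b: "b \<in> carrier B"
  shows "\<And>w c. \<lbrakk>w \<in> carrier V; c \<in> carrier B\<rbrakk> \<Longrightarrow> b \<odot>\<^bsub>\<Delta>\<^esub> ptVB w c = ptVB w (c \<otimes>\<^bsub>B\<^esub> b)"
    and "\<And>d. d \<in> carrier TVB \<Longrightarrow> b \<odot>\<^bsub>\<Delta>\<^esub> d \<in> carrier TVB"
    and "\<And>d e. \<lbrakk>d \<in> carrier TVB; e \<in> carrier TVB\<rbrakk> \<Longrightarrow> b \<odot>\<^bsub>\<Delta>\<^esub> (d \<oplus>\<^bsub>TVB\<^esub> e) = b \<odot>\<^bsub>\<Delta>\<^esub> d \<oplus>\<^bsub>TVB\<^esub> b \<odot>\<^bsub>\<Delta>\<^esub> e"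
proof -
  interpret B: cring B by (rule B_cring)
  interpret BM: module K B by (rule B_module)
  interpret V: module K V by (rule V_module)
  have "bilinear_map K V B TVB (\<lambda>w c. ptVB w (c \<otimes>\<^bsub>B\<^esub> b))"
    unfolding bilinear_map_def using b
    by (simp add: VB.pure_add_left VB.pure_add_right VB.pure_smult_left VB.pure_smult_right B.l_distr smult_mult)
  note L = VB.tensor_lift[OF VB.TP_module this]
  show "b \<odot>\<^bsub>\<Delta>\<^esub> ptVB w c = ptVB w (c \<otimes>\<^bsub>B\<^esub> b)" if "w \<in> carrier V" "c \<in> carrier B" for w c
    unfolding cell_Delta_def using L(1)[OF that] by simp
  show "b \<odot>\<^bsub>\<Delta>\<^esub> d \<in> carrier TVB" if "d \<in> carrier TVB" for d
    unfolding cell_Delta_def using L(2)[OF that] by simp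
  show "b \<odot>\<^bsub>\<Delta>\<^esub> (d \<oplus>\<^bsub>TVB\<^esub> e) = b \<odot>\<^bsub>\<Delta>\<^esub> d \<oplus>\<^bsub>TVB\<^esub> b \<odot>\<^bsub>\<Delta>\<^esub> e"
    if "d \<in> carrier TVB" "e \<in> carrier TVB" for d e
    unfolding cell_Delta_def using L(3)[OF that] by simp
qed

lemma Delta'_smult:
  assumes b: "b \<in> carrier B"
  shows "\<And>w c. \<lbrakk>w \<in> carrier V; c \<in> carrier B\<rbrakk> \<Longrightarrow> b \<odot>\<^bsub>\<Delta>'\<^esub> ptBV c w = ptBV (b \<otimes>\<^bsub>B\<^esub> c) w"
    and "\<And>d. d \<in> carrier TBV \<Longrightarrow> b \<odot>\<^bsub>\<Delta>'\<^esub> d \<in> carrier TBV"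
    and "\<And>d e. \<lbrakk>d \<in> carrier TBV; e \<in> carrier TBV\<rbrakk> \<Longrightarrow> b \<odot>\<^bsub>\<Delta>'\<^esub> (d \<oplus>\<^bsub>TBV\<^esub> e) = b \<odot>\<^bsub>\<Delta>'\<^esub> d \<oplus>\<^bsub>TBV\<^esub> b \<odot>\<^bsub>\<Delta>'\<^esub> e"
proof -
  interpret B: cring B by (rule B_cring)
  interpret BM: module K B by (rule B_module)
  interpret V: module K V by (rule V_module)
  have "bilinear_map K B V TBV (\<lambda>c w. ptBV (b \<otimes>\<^bsub>B\<^esub> c) w)"
    unfolding bilinear_map_def using b
    by (simp add: BV.pure_add_left BV.pure_add_right BV.pure_smult_left BV.pure_smult_right B.r_distr smult_mult)
  note L = BV.tensor_lift[OF BV.TP_module this]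
  show "b \<odot>\<^bsub>\<Delta>'\<^esub> ptBV c w = ptBV (b \<otimes>\<^bsub>B\<^esub> c) w" if "w \<in> carrier V" "c \<in> carrier B" for w c
    unfolding cell_Delta'_def using L(1)[OF that(2,1)] by simp
  show "b \<odot>\<^bsub>\<Delta>'\<^esub> d \<in> carrier TBV" if "d \<in> carrier TBV" for d
    unfolding cell_Delta'_def using L(2)[OF that] by simp
  show "b \<odot>\<^bsub>\<Delta>'\<^esub> (d \<oplus>\<^bsub>TBV\<^esub> e) = b \<odot>\<^bsub>\<Delta>'\<^esub> d \<oplus>\<^bsub>TBV\<^esub> b \<odot>\<^bsub>\<Delta>'\<^esub> e"
    if "d \<in> carrier TBV" "e \<in> carrier TBV" for d e
    unfolding cell_Delta'_def using L(3)[OF that] by simp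
qed

lemma Delta_module: "module B \<Delta>"
proof -
  interpret B: cring B by (rule B_cring)
  interpret T: module K TVB by (rule VB.TP_module)
  show ?thesis
  proof (rule moduleI)
    show "cring B" by (rule B_cring)
    show "abelian_group \<Delta>" unfolding cell_Delta_def by (rule abelian_group_with_smult[OF T.M.abelian_group_axioms])
    fix a b x y assume a: "a \<in> carrier B" and b: "b \<in> carrier B" and "x \<in> carrier \<Delta>"
    then have x: "x \<in> carrier TVB" by simp
    show "a \<odot>\<^bsub>\<Delta>\<^esub> x \<in> carrier \<Delta>" using Delta_smult(2)[OF a x] by simp
    show "a \<odot>\<^bsub>\<Delta>\<^esub> (x \<oplus>\<^bsub>\<Delta>\<^esub> y) = a \<odot>\<^bsub>\<Delta>\<^esub> x \<oplus>\<^bsub>\<Delta>\<^esub> a \<odot>\<^bsub>\<Delta>\<^esub> y" if "y \<in> carrier \<Delta>"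
      using Delta_smult(3)[OF a x, of y] that by simp
    from x show "(a \<oplus>\<^bsub>B\<^esub> b) \<odot>\<^bsub>\<Delta>\<^esub> x = a \<odot>\<^bsub>\<Delta>\<^esub> x \<oplus>\<^bsub>\<Delta>\<^esub> b \<odot>\<^bsub>\<Delta>\<^esub> x"
    proof (induct rule: VB.tensor_induct)
      case (pure w c)
      then show ?case using a b by (simp add: Delta_smult B.r_distr VB.pure_add_right)
    next
      case (add s t)
      then show ?case using a b by (simp add: Delta_smult T.M.a_ac)
    qed
    from x show "(a \<otimes>\<^bsub>B\<^esub> b) \<odot>\<^bsub>\<Delta>\<^esub> x = a \<odot>\<^bsub>\<Delta>\<^esub> (b \<odot>\<^bsub>\<Delta>\<^esub> x)"
    proof (induct rule: VB.tensor_induct)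
      case (pure w c)
      then show ?case using a b by (simp add: Delta_smult B.m_ac)
    next
      case (add s t)
      then show ?case using a b by (simp add: Delta_smult)
    qed
  next
    fix x assume "x \<in> carrier \<Delta>"
    then have x: "x \<in> carrier TVB" by simp
    from x show "\<one>\<^bsub>B\<^esub> \<odot>\<^bsub>\<Delta>\<^esub> x = x"
      by (induct rule: VB.tensor_induct) (simp_all add: Delta_smult)
  qed
qed

lemma Delta'_module: "module B \<Delta>'"
proof -
  interpret B: cring B by (rule B_cring)
  interpret T: module K TBV by (rule BV.TP_module)
  show ?thesis
  proof (rule moduleI)
    show "cring B" by (rule B_cring)
    show "abelian_group \<Delta>'" unfolding cell_Delta'_def by (rule abelian_group_with_smult[OF T.M.abelian_group_axioms])
    fix a b x y assume a: "a \<in> carrier B" and b: "b \<in> carrier B" and "x \<in> carrier \<Delta>'"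
    then have x: "x \<in> carrier TBV" by simp
    show "a \<odot>\<^bsub>\<Delta>'\<^esub> x \<in> carrier \<Delta>'" using Delta'_smult(2)[OF a x] by simp
    show "a \<odot>\<^bsub>\<Delta>'\<^esub> (x \<oplus>\<^bsub>\<Delta>'\<^esub> y) = a \<odot>\<^bsub>\<Delta>'\<^esub> x \<oplus>\<^bsub>\<Delta>'\<^esub> a \<odot>\<^bsub>\<Delta>'\<^esub> y" if "y \<in> carrier \<Delta>'"
      using Delta'_smult(3)[OF a x, of y] that by simp
    from x show "(a \<oplus>\<^bsub>B\<^esub> b) \<odot>\<^bsub>\<Delta>'\<^esub> x = a \<odot>\<^bsub>\<Delta>'\<^esub> x \<oplus>\<^bsub>\<Delta>'\<^esub> b \<odot>\<^bsub>\<Delta>'\<^esub> x"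
    proof (induct rule: BV.tensor_induct)
      case (pure c w)
      then show ?case using a b by (simp add: Delta'_smult B.l_distr BV.pure_add_left)
    next
      case (add s t)
      then show ?case using a b by (simp add: Delta'_smult T.M.a_ac)
    qed
    from x show "(a \<otimes>\<^bsub>B\<^esub> b) \<odot>\<^bsub>\<Delta>'\<^esub> x = a \<odot>\<^bsub>\<Delta>'\<^esub> (b \<odot>\<^bsub>\<Delta>'\<^esub> x)"
    proof (induct rule: BV.tensor_induct)
      case (pure c w)
      then show ?case using a b by (simp add: Delta'_smult B.m_ac)
    next
      case (add s t)
      then show ?case using a b by (simp add: Delta'_smult)
    qed
  next
    fix x assume "x \<in> carrier \<Delta>'"
    then have x: "x \<in> carrier TBV" by simp
    from x show "\<one>\<^bsub>B\<^esub> \<odot>\<^bsub>\<Delta>'\<^esub> x = x"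
      by (induct rule: BV.tensor_induct) (simp_all add: Delta'_smult)
  qed
qed

sublocale DD: module_pair B \<Delta> \<Delta>' by (rule module_pair.intro[OF Delta_module Delta'_module])

lemma TT_module: "module B TT" unfolding cell_tensor_def by (rule DD.TP_module)

text \<open>The modules \<open>\<Delta>\<close> and \<open>\<Delta>'\<close> are free over \<open>B\<close> on the elements \<open>v\<^sub>i \<otimes> 1\<close> and \<open>1 \<otimes> v\<^sub>i\<close>. The functionals
  \<open>left_coord i\<close> and \<open>right_coord i\<close> are the elements of the dual bases; their products \<open>entry i j\<close> are
  coordinates on \<open>\<Delta> \<otimes>\<^sub>B \<Delta>'\<close>.\<close>

definition left_coord :: "nat \<Rightarrow> ('v \<times> 'b \<Rightarrow> 'k) set \<Rightarrow> 'b" where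
  "left_coord i = tensor_lift V B B K (\<lambda>w c. coord K V n v i w \<odot>\<^bsub>B\<^esub> c)"

definition right_coord :: "nat \<Rightarrow> ('b \<times> 'v \<Rightarrow> 'k) set \<Rightarrow> 'b" where
  "right_coord i = tensor_lift B V B K (\<lambda>c w. coord K V n v i w \<odot>\<^bsub>B\<^esub> c)"

definition entry :: "nat \<Rightarrow> nat \<Rightarrow> ('k, 'v, 'b) cell_tensor \<Rightarrow> 'b" where
  "entry i j = tensor_lift \<Delta> \<Delta>' (regular_module B) B (\<lambda>d d'. left_coord i d \<otimes>\<^bsub>B\<^esub> right_coord j d')"

lemma left_coord:
  assumes i: "i \<in> {1..n}"
  shows "\<And>w c. \<lbrakk>w \<in> carrier V; c \<in> carrier B\<rbrakk> \<Longrightarrow> left_coord i (ptVB w c) = coord K V n v i w \<odot>\<^bsub>B\<^esub> c"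
    and "\<And>d. d \<in> carrier TVB \<Longrightarrow> left_coord i d \<in> carrier B"
    and "\<And>d e. \<lbrakk>d \<in> carrier TVB; e \<in> carrier TVB\<rbrakk> \<Longrightarrow> left_coord i (d \<oplus>\<^bsub>TVB\<^esub> e) = left_coord i d \<oplus>\<^bsub>B\<^esub> left_coord i e"
    and "\<And>b d. \<lbrakk>b \<in> carrier B; d \<in> carrier TVB\<rbrakk> \<Longrightarrow> left_coord i (b \<odot>\<^bsub>\<Delta>\<^esub> d) = b \<otimes>\<^bsub>B\<^esub> left_coord i d"
proof -
  interpret B: cring B by (rule B_cring)
  interpret BM: module K B by (rule B_module)
  interpret V: module K V by (rule V_module)
  have "bilinear_map K V B B (\<lambda>w c. coord K V n v i w \<odot>\<^bsub>B\<^esub> c)"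
    unfolding bilinear_map_def using i coord_expansion(1)
    by (simp add: coord_add coord_smult BM.smult_l_distr BM.smult_r_distr BM.smult_assoc1[symmetric] BM.R.m_comm)
  note L = VB.tensor_lift[OF B_module this, folded left_coord_def]
  show 1: "left_coord i (ptVB w c) = coord K V n v i w \<odot>\<^bsub>B\<^esub> c" if "w \<in> carrier V" "c \<in> carrier B" for w c
    by (rule L(1)[OF that])
  show 2: "left_coord i d \<in> carrier B" if "d \<in> carrier TVB" for d by (rule L(2)[OF that])
  show 3: "left_coord i (d \<oplus>\<^bsub>TVB\<^esub> e) = left_coord i d \<oplus>\<^bsub>B\<^esub> left_coord i e" if "d \<in> carrier TVB" "e \<in> carrier TVB" for d e
    by (rule L(3)[OF that])
  show "left_coord i (b \<odot>\<^bsub>\<Delta>\<^esub> d) = b \<otimes>\<^bsub>B\<^esub> left_coord i d" if b: "b \<in> carrier B" and d: "d \<in> carrier TVB" for b d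
    using d
  proof (induct rule: VB.tensor_induct)
    case (pure w c)
    then show ?case using b coord_expansion(1)[OF _ i] by (simp add: Delta_smult 1 smult_mult B.m_comm)
  next
    case (add s t)
    then show ?case using b by (simp add: Delta_smult 2 3 B.r_distr)
  qed
qed

lemma right_coord:
  assumes i: "i \<in> {1..n}"
  shows "\<And>w c. \<lbrakk>w \<in> carrier V; c \<in> carrier B\<rbrakk> \<Longrightarrow> right_coord i (ptBV c w) = coord K V n v i w \<odot>\<^bsub>B\<^esub> c"
    and "\<And>d. d \<in> carrier TBV \<Longrightarrow> right_coord i d \<in> carrier B"
    and "\<And>d e. \<lbrakk>d \<in> carrier TBV; e \<in> carrier TBV\<rbrakk> \<Longrightarrow> right_coord i (d \<oplus>\<^bsub>TBV\<^esub> e) = right_coord i d \<oplus>\<^bsub>B\<^esub> right_coord i e"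
    and "\<And>b d. \<lbrakk>b \<in> carrier B; d \<in> carrier TBV\<rbrakk> \<Longrightarrow> right_coord i (b \<odot>\<^bsub>\<Delta>'\<^esub> d) = b \<otimes>\<^bsub>B\<^esub> right_coord i d"
proof -
  interpret B: cring B by (rule B_cring)
  interpret BM: module K B by (rule B_module)
  interpret V: module K V by (rule V_module)
  have "bilinear_map K B V B (\<lambda>c w. coord K V n v i w \<odot>\<^bsub>B\<^esub> c)"
    unfolding bilinear_map_def using i coord_expansion(1)
    by (simp add: coord_add coord_smult BM.smult_l_distr BM.smult_r_distr BM.smult_assoc1[symmetric] BM.R.m_comm)
  note L = BV.tensor_lift[OF B_module this, folded right_coord_def]
  show 1: "right_coord i (ptBV c w) = coord K V n v i w \<odot>\<^bsub>B\<^esub> c" if "w \<in> carrier V" "c \<in> carrier B" for w c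
    by (rule L(1)[OF that(2,1)])
  show 2: "right_coord i d \<in> carrier B" if "d \<in> carrier TBV" for d by (rule L(2)[OF that])
  show 3: "right_coord i (d \<oplus>\<^bsub>TBV\<^esub> e) = right_coord i d \<oplus>\<^bsub>B\<^esub> right_coord i e" if "d \<in> carrier TBV" "e \<in> carrier TBV" for d e
    by (rule L(3)[OF that])
  show "right_coord i (b \<odot>\<^bsub>\<Delta>'\<^esub> d) = b \<otimes>\<^bsub>B\<^esub> right_coord i d" if b: "b \<in> carrier B" and d: "d \<in> carrier TBV" for b d
    using d
  proof (induct rule: BV.tensor_induct)
    case (pure c w)
    then show ?case using b coord_expansion(1)[OF _ i] by (simp add: Delta'_smult 1 smult_mult)
  next
    case (add s t)
    then show ?case using b by (simp add: Delta'_smult 2 3 B.r_distr)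
  qed
qed

lemma elem_closed [simp]:
  "\<lbrakk>u \<in> carrier V; b \<in> carrier B; b' \<in> carrier B; w \<in> carrier V\<rbrakk> \<Longrightarrow> celt u b b' w \<in> carrier TT"
  unfolding cell_elem_def cell_tensor_def by simp

lemma entry:
  assumes i: "i \<in> {1..n}" and j: "j \<in> {1..n}"
  shows "\<And>t. t \<in> carrier TT \<Longrightarrow> entry i j t \<in> carrier B"
    and "\<And>s t. \<lbrakk>s \<in> carrier TT; t \<in> carrier TT\<rbrakk> \<Longrightarrow> entry i j (s \<oplus>\<^bsub>TT\<^esub> t) = entry i j s \<oplus>\<^bsub>B\<^esub> entry i j t"
    and "\<And>u b b' w. \<lbrakk>u \<in> carrier V; b \<in> carrier B; b' \<in> carrier B; w \<in> carrier V\<rbrakk> \<Longrightarrow>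
      entry i j (celt u b b' w) = (coord K V n v i u \<odot>\<^bsub>B\<^esub> b) \<otimes>\<^bsub>B\<^esub> (coord K V n v j w \<odot>\<^bsub>B\<^esub> b')"
proof -
  interpret B: cring B by (rule B_cring)
  let ?RB = "regular_module B"
  have RB: "carrier ?RB = carrier B" "\<And>x y. x \<oplus>\<^bsub>?RB\<^esub> y = x \<oplus>\<^bsub>B\<^esub> y" "\<And>x y. x \<odot>\<^bsub>?RB\<^esub> y = x \<otimes>\<^bsub>B\<^esub> y"
    unfolding regular_module_def by simp_all
  have "bilinear_map B \<Delta> \<Delta>' ?RB (\<lambda>d d'. left_coord i d \<otimes>\<^bsub>B\<^esub> right_coord j d')"
    unfolding bilinear_map_def RB Delta_carrier Delta'_carrier
    by (simp add: left_coord[OF i] right_coord[OF j] B.l_distr B.r_distr B.m_assoc B.m_lcomm)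
  note L = DD.tensor_lift[OF regular_module_module[OF B_cring] this, folded entry_def cell_tensor_def, unfolded RB]
  show "entry i j t \<in> carrier B" if "t \<in> carrier TT" for t by (rule L(2)[OF that])
  show "entry i j (s \<oplus>\<^bsub>TT\<^esub> t) = entry i j s \<oplus>\<^bsub>B\<^esub> entry i j t" if "s \<in> carrier TT" "t \<in> carrier TT" for s t
    by (rule L(3)[OF that])
  show "entry i j (celt u b b' w) = (coord K V n v i u \<odot>\<^bsub>B\<^esub> b) \<otimes>\<^bsub>B\<^esub> (coord K V n v j w \<odot>\<^bsub>B\<^esub> b')"
    if "u \<in> carrier V" "b \<in> carrier B" "b' \<in> carrier B" "w \<in> carrier V" for u b b' w
    unfolding cell_elem_def using that by (simp add: L(1) left_coord(1)[OF i] right_coord(1)[OF j])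
qed

lemma elem_add:
  assumes "u \<in> carrier V" "u' \<in> carrier V" "b \<in> carrier B" "c \<in> carrier B" "b' \<in> carrier B" "w \<in> carrier V" "w' \<in> carrier V"
  shows "celt (u \<oplus>\<^bsub>V\<^esub> u') b b' w = celt u b b' w \<oplus>\<^bsub>TT\<^esub> celt u' b b' w"
    and "celt u (b \<oplus>\<^bsub>B\<^esub> c) b' w = celt u b b' w \<oplus>\<^bsub>TT\<^esub> celt u c b' w"
    and "celt u b b' (w \<oplus>\<^bsub>V\<^esub> w') = celt u b b' w \<oplus>\<^bsub>TT\<^esub> celt u b b' w'"
  using assms unfolding cell_elem_def cell_tensor_def
  using DD.pure_add_left DD.pure_add_right
  by (simp_all add: VB.pure_add_left VB.pure_add_right BV.pure_add_right)

lemma elem_zero: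
  shows "\<lbrakk>b \<in> carrier B; b' \<in> carrier B; w \<in> carrier V\<rbrakk> \<Longrightarrow> celt \<zero>\<^bsub>V\<^esub> b b' w = \<zero>\<^bsub>TT\<^esub>"
    and "\<lbrakk>u \<in> carrier V; b' \<in> carrier B; w \<in> carrier V\<rbrakk> \<Longrightarrow> celt u \<zero>\<^bsub>B\<^esub> b' w = \<zero>\<^bsub>TT\<^esub>"
    and "\<lbrakk>u \<in> carrier V; b \<in> carrier B; b' \<in> carrier B\<rbrakk> \<Longrightarrow> celt u b b' \<zero>\<^bsub>V\<^esub> = \<zero>\<^bsub>TT\<^esub>"
  using DD.pure_zero_left DD.pure_zero_right unfolding cell_elem_def cell_tensor_def
  by simp_all

lemma elem_smult:
  assumes "u \<in> carrier V" "b \<in> carrier B" "b' \<in> carrier B" "w \<in> carrier V" "k \<in> carrier K"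
  shows "celt (k \<odot>\<^bsub>V\<^esub> u) b b' w = celt u (k \<odot>\<^bsub>B\<^esub> b) b' w"
    and "celt u b b' (k \<odot>\<^bsub>V\<^esub> w) = celt u b (k \<odot>\<^bsub>B\<^esub> b') w"
  using assms unfolding cell_elem_def
  by (simp_all add: VB.pure_smult_left VB.pure_smult_right BV.pure_smult_left BV.pure_smult_right)

text \<open>The scalar \<open>b'\<close> moves from the right factor to the left one through \<open>\<otimes>\<^sub>B\<close>.\<close>

lemma elem_move:
  assumes "u \<in> carrier V" "b \<in> carrier B" "b' \<in> carrier B" "w \<in> carrier V"
  shows "celt u b b' w = celt u (b \<otimes>\<^bsub>B\<^esub> b') \<one>\<^bsub>B\<^esub> w"
proof -
  interpret B: cring B by (rule B_cring)
  have "celt u b b' w = DD.pt (ptVB u b) (b' \<odot>\<^bsub>\<Delta>'\<^esub> ptBV \<one>\<^bsub>B\<^esub> w)"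
    unfolding cell_elem_def using assms by (simp add: Delta'_smult)
  also have "\<dots> = DD.pt (b' \<odot>\<^bsub>\<Delta>\<^esub> ptVB u b) (ptBV \<one>\<^bsub>B\<^esub> w)"
    using assms by (subst DD.pure_smult_right, simp_all, subst DD.pure_smult_left, simp_all)
  also have "\<dots> = celt u (b \<otimes>\<^bsub>B\<^esub> b') \<one>\<^bsub>B\<^esub> w"
    unfolding cell_elem_def using assms by (simp add: Delta_smult)
  finally show ?thesis .
qed

lemma entry_basis_elem:
  assumes "i \<in> {1..n}" "j \<in> {1..n}" "k \<in> {1..n}" "l \<in> {1..n}" "b \<in> carrier B"
  shows "entry k l (celt (v i) b \<one>\<^bsub>B\<^esub> (v j)) = (if k = i \<and> l = j then b else \<zero>\<^bsub>B\<^esub>)"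
proof -
  interpret B: cring B by (rule B_cring)
  interpret BM: module K B by (rule B_module)
  show ?thesis using assms by (simp add: entry(3) coord_basis)
qed

text \<open>The inverse of the coordinate map \<open>entry\<close>.\<close>

definition assemble :: "(nat \<times> nat \<Rightarrow> 'b) \<Rightarrow> ('k, 'v, 'b) cell_tensor" where
  "assemble C = (\<Oplus>\<^bsub>TT\<^esub>s\<in>{1..n} \<times> {1..n}. celt (v (fst s)) (C s) \<one>\<^bsub>B\<^esub> (v (snd s)))"

lemma assemble_closed:
  assumes "\<And>s. s \<in> {1..n} \<times> {1..n} \<Longrightarrow> C s \<in> carrier B"
  shows "assemble C \<in> carrier TT"
proof -
  interpret B: cring B by (rule B_cring)
  interpret T: module B TT by (rule TT_module)
  show ?thesis unfolding assemble_def
    by (intro T.M.finsum_closed Pi_I elem_closed assms v_closed B.one_closed) auto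
qed

lemma assemble_add:
  assumes C: "\<And>s. s \<in> {1..n} \<times> {1..n} \<Longrightarrow> C s \<in> carrier B" and D: "\<And>s. s \<in> {1..n} \<times> {1..n} \<Longrightarrow> D s \<in> carrier B"
  shows "assemble (\<lambda>s. C s \<oplus>\<^bsub>B\<^esub> D s) = assemble C \<oplus>\<^bsub>TT\<^esub> assemble D"
proof -
  interpret B: cring B by (rule B_cring)
  interpret T: module B TT by (rule TT_module)
  let ?I = "{1..n} \<times> {1..n}"
  have vI: "v (fst s) \<in> carrier V" "v (snd s) \<in> carrier V" if "s \<in> ?I" for s using that by auto
  have "assemble (\<lambda>s. C s \<oplus>\<^bsub>B\<^esub> D s) =
      (\<Oplus>\<^bsub>TT\<^esub>s\<in>?I. celt (v (fst s)) (C s) \<one>\<^bsub>B\<^esub> (v (snd s)) \<oplus>\<^bsub>TT\<^esub> celt (v (fst s)) (D s) \<one>\<^bsub>B\<^esub> (v (snd s)))"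
    unfolding assemble_def
  proof (rule T.M.finsum_cong')
    fix s assume s: "s \<in> ?I"
    show "celt (v (fst s)) (C s \<oplus>\<^bsub>B\<^esub> D s) \<one>\<^bsub>B\<^esub> (v (snd s)) =
        celt (v (fst s)) (C s) \<one>\<^bsub>B\<^esub> (v (snd s)) \<oplus>\<^bsub>TT\<^esub> celt (v (fst s)) (D s) \<one>\<^bsub>B\<^esub> (v (snd s))"
      by (rule elem_add(2)[OF vI(1)[OF s] vI(1)[OF s] C[OF s] D[OF s] B.one_closed vI(2)[OF s] vI(2)[OF s]])
  qed (auto intro!: T.M.a_closed elem_closed C D vI simp del: mem_Sigma_iff)
  also have "\<dots> = assemble C \<oplus>\<^bsub>TT\<^esub> assemble D" unfolding assemble_def
    by (intro T.M.finsum_addf Pi_I elem_closed vI C D B.one_closed)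
  finally show ?thesis .
qed

lemma entry_assemble:
  assumes C: "\<And>s. s \<in> {1..n} \<times> {1..n} \<Longrightarrow> C s \<in> carrier B" and k: "k \<in> {1..n}" and l: "l \<in> {1..n}"
  shows "entry k l (assemble C) = C (k, l)"
proof -
  interpret B: cring B by (rule B_cring)
  interpret T: module B TT by (rule TT_module)
  let ?I = "{1..n} \<times> {1..n}"
  let ?e = "\<lambda>s. celt (v (fst s)) (C s) \<one>\<^bsub>B\<^esub> (v (snd s))"
  have e: "?e s \<in> carrier TT" if "s \<in> ?I" for s
    using that by (intro elem_closed C v_closed B.one_closed) auto
  have z: "entry k l \<zero>\<^bsub>TT\<^esub> = \<zero>\<^bsub>B\<^esub>"
    using entry(2)[OF k l, of "\<zero>\<^bsub>TT\<^esub>" "\<zero>\<^bsub>TT\<^esub>"] entry(1)[OF k l, of "\<zero>\<^bsub>TT\<^esub>"]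
    by (metis B.add.r_cancel_one' T.M.l_zero T.M.zero_closed)
  have "entry k l (finsum TT ?e A) = (\<Oplus>\<^bsub>B\<^esub>s\<in>A. entry k l (?e s))" if "finite A" "A \<subseteq> ?I" for A
    using that
  proof induct
    case empty
    then show ?case using z by simp
  next
    case (insert s A)
    have es: "?e s \<in> carrier TT" and eA: "?e \<in> A \<rightarrow> carrier TT" using insert(4) e by blast+
    have "entry k l (finsum TT ?e (insert s A)) = entry k l (?e s \<oplus>\<^bsub>TT\<^esub> finsum TT ?e A)"
      using T.M.finsum_insert[OF insert(1,2) eA es] by simp
    also have "\<dots> = entry k l (?e s) \<oplus>\<^bsub>B\<^esub> entry k l (finsum TT ?e A)"
      by (rule entry(2)[OF k l es T.M.finsum_closed[OF eA]])
    also have "\<dots> = (\<Oplus>\<^bsub>B\<^esub>s\<in>insert s A. entry k l (?e s))"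
      using insert entry(1)[OF k l] es eA by (subst B.finsum_insert) auto
    finally show ?case .
  qed
  then have "entry k l (assemble C) = (\<Oplus>\<^bsub>B\<^esub>s\<in>?I. entry k l (?e s))" unfolding assemble_def by simp
  also have "\<dots> = (\<Oplus>\<^bsub>B\<^esub>s\<in>?I. if (k, l) = s then C s else \<zero>\<^bsub>B\<^esub>)"
  proof (rule B.finsum_cong')
    fix s assume s: "s \<in> ?I"
    then show "entry k l (?e s) = (if (k, l) = s then C s else \<zero>\<^bsub>B\<^esub>)"
      using entry_basis_elem[OF _ _ k l C[OF s], of "fst s" "snd s"] by (auto simp: mem_Times_iff)
  qed (use C in auto)
  also have "\<dots> = C (k, l)"
    by (rule B.finsum_singleton) (use C k l in auto)
  finally show ?thesis .
qed

text \<open>The set of tensors for which the equation holds is closed under addition, so it is enough to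
  consider the tensors \<open>u \<otimes> b \<otimes>\<^sub>B b' \<otimes> w\<close>, and then to expand \<open>u\<close> and \<open>w\<close> in the basis. For basis vectors
  the matrix of entries has a single nonzero entry.\<close>

theorem assemble_entry:
  assumes "t \<in> carrier TT" shows "assemble (\<lambda>(i, j). entry i j t) = t"
proof -
  interpret B: cring B by (rule B_cring)
  interpret BM: module K B by (rule B_module)
  interpret V: module K V by (rule V_module)
  interpret T: module B TT by (rule TT_module)
  let ?I = "{1..n} \<times> {1..n}"
  let ?E = "\<lambda>t. assemble (\<lambda>(i, j). entry i j t) = t"
  have ec: "(\<lambda>(i, j). entry i j t) s \<in> carrier B" if "s \<in> ?I" "t \<in> carrier TT" for s t
    using that entry(1) by auto
  have Eadd: "?E (s \<oplus>\<^bsub>TT\<^esub> t)" if s: "s \<in> carrier TT" and t: "t \<in> carrier TT" and E: "?E s" "?E t" for s t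
  proof -
    have "assemble (\<lambda>(i, j). entry i j (s \<oplus>\<^bsub>TT\<^esub> t)) =
        assemble (\<lambda>p. (\<lambda>(i, j). entry i j s) p \<oplus>\<^bsub>B\<^esub> (\<lambda>(i, j). entry i j t) p)"
      unfolding assemble_def
    proof (rule T.M.finsum_cong')
      fix p assume p: "p \<in> ?I"
      then show "celt (v (fst p)) ((\<lambda>(i, j). entry i j (s \<oplus>\<^bsub>TT\<^esub> t)) p) \<one>\<^bsub>B\<^esub> (v (snd p)) =
          celt (v (fst p)) ((\<lambda>(i, j). entry i j s) p \<oplus>\<^bsub>B\<^esub> (\<lambda>(i, j). entry i j t) p) \<one>\<^bsub>B\<^esub> (v (snd p))"
        using s t by (auto simp: entry(2))
    qed (use s t entry(1) in auto)
    also have "\<dots> = s \<oplus>\<^bsub>TT\<^esub> t" using assemble_add[of "\<lambda>(i, j). entry i j s" "\<lambda>(i, j). entry i j t"] ec s t E by simp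
    finally show ?thesis .
  qed
  have Ebase: "?E (celt (v i) b \<one>\<^bsub>B\<^esub> (v j))" if i: "i \<in> {1..n}" and j: "j \<in> {1..n}" and b: "b \<in> carrier B" for i j b
  proof -
    let ?f = "\<lambda>s. celt (v (fst s)) b \<one>\<^bsub>B\<^esub> (v (snd s))"
    have "assemble (\<lambda>(k, l). entry k l (celt (v i) b \<one>\<^bsub>B\<^esub> (v j))) = (\<Oplus>\<^bsub>TT\<^esub>s\<in>?I. if (i, j) = s then ?f s else \<zero>\<^bsub>TT\<^esub>)"
      unfolding assemble_def
    proof (rule T.M.finsum_cong')
      fix s assume "s \<in> ?I"
      then obtain k l where s: "s = (k, l)" "k \<in> {1..n}" "l \<in> {1..n}" by blast
      have z: "celt (v k) \<zero>\<^bsub>B\<^esub> \<one>\<^bsub>B\<^esub> (v l) = \<zero>\<^bsub>TT\<^esub>" using s by (intro elem_zero(2)) simp_all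
      show "celt (v (fst s)) ((\<lambda>(k, l). entry k l (celt (v i) b \<one>\<^bsub>B\<^esub> (v j))) s) \<one>\<^bsub>B\<^esub> (v (snd s)) =
          (if (i, j) = s then ?f s else \<zero>\<^bsub>TT\<^esub>)"
        using entry_basis_elem[OF i j s(2,3) b] z s(1) by simp
    qed (use b in auto)
    also have "\<dots> = ?f (i, j)" by (rule T.M.finsum_singleton) (use i j b in auto)
    finally show ?thesis by simp
  qed
  have Ezero: "?E \<zero>\<^bsub>TT\<^esub>"
  proof -
    have "assemble (\<lambda>(i, j). entry i j \<zero>\<^bsub>TT\<^esub>) \<oplus>\<^bsub>TT\<^esub> assemble (\<lambda>(i, j). entry i j \<zero>\<^bsub>TT\<^esub>) = assemble (\<lambda>(i, j). entry i j \<zero>\<^bsub>TT\<^esub>)"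
    proof -
      let ?z = "\<lambda>(i, j). entry i j \<zero>\<^bsub>TT\<^esub>"
      have eq: "?z s \<oplus>\<^bsub>B\<^esub> ?z s = ?z s" if "s \<in> ?I" for s
        using that entry(2)[of "fst s" "snd s" "\<zero>\<^bsub>TT\<^esub>" "\<zero>\<^bsub>TT\<^esub>"] by auto
      have "assemble ?z \<oplus>\<^bsub>TT\<^esub> assemble ?z = assemble (\<lambda>s. ?z s \<oplus>\<^bsub>B\<^esub> ?z s)"
        by (rule assemble_add[symmetric]) (rule ec[OF _ T.M.zero_closed], assumption)+
      also have "\<dots> = assemble ?z" unfolding assemble_def
      proof (rule T.M.finsum_cong')
        show "(\<lambda>s. celt (v (fst s)) (?z s) \<one>\<^bsub>B\<^esub> (v (snd s))) \<in> ?I \<rightarrow> carrier TT"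
        proof
          fix s assume s: "s \<in> ?I"
          then show "celt (v (fst s)) (?z s) \<one>\<^bsub>B\<^esub> (v (snd s)) \<in> carrier TT"
            by (intro elem_closed ec[OF s T.M.zero_closed] B.one_closed v_closed) (simp_all add: mem_Times_iff)
        qed
      qed (simp_all only: eq)
      finally show ?thesis .
    qed
    moreover have "assemble (\<lambda>(i, j). entry i j \<zero>\<^bsub>TT\<^esub>) \<in> carrier TT" by (rule assemble_closed) (rule ec, auto)
    ultimately show ?thesis by (metis T.M.add.r_cancel_one')
  qed
  have Eright: "?E (celt (v i) b b' w)" if "i \<in> {1..n}" "b \<in> carrier B" "b' \<in> carrier B" "w \<in> carrier V" for i b b' w
    using that(4,1-3)
  proof (induct arbitrary: b' rule: basis_induct)
    case zero
    then show ?case using Ezero by (simp add: elem_zero)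
  next
    case (smult k j)
    then show ?case using Ebase by (simp add: elem_smult elem_move[of _ _ "k \<odot>\<^bsub>B\<^esub> b'" for b'])
  next
    case (add x y)
    then show ?case using Eadd by (simp add: elem_add)
  qed
  have Eelem: "?E (celt u b b' w)" if "u \<in> carrier V" "b \<in> carrier B" "b' \<in> carrier B" "w \<in> carrier V" for u b b' w
    using that
  proof (induct arbitrary: b rule: basis_induct)
    case zero
    then show ?case using Ezero by (simp add: elem_zero)
  next
    case (smult k i)
    then show ?case using Eright by (simp add: elem_smult)
  next
    case (add x y)
    then show ?case using Eadd by (simp add: elem_add)
  qed
  have Epure: "?E (DD.pt d d')" if "d \<in> carrier TVB" "d' \<in> carrier TBV" for d d'
    using that
  proof (induct rule: VB.tensor_induct)
    case (pure u b)
    note ub = pure(1,2)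
    from pure(3) show ?case
    proof (induct rule: BV.tensor_induct)
      case (pure b' w)
      then show ?case using Eelem ub unfolding cell_elem_def by simp
    next
      case (add s t)
      have "DD.pt (ptVB u b) (s \<oplus>\<^bsub>TBV\<^esub> t) = DD.pt (ptVB u b) s \<oplus>\<^bsub>TT\<^esub> DD.pt (ptVB u b) t"
        using DD.pure_add_right[of "ptVB u b" s t] add ub unfolding cell_tensor_def by simp
      moreover have "DD.pt (ptVB u b) s \<in> carrier TT" "DD.pt (ptVB u b) t \<in> carrier TT"
        using DD.pure_closed add ub unfolding cell_tensor_def by simp_all
      ultimately show ?case using Eadd add by simp
    qed
  next
    case (add s t)
    have "DD.pt (s \<oplus>\<^bsub>TVB\<^esub> t) d' = DD.pt s d' \<oplus>\<^bsub>TT\<^esub> DD.pt t d'"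
      using DD.pure_add_left[of s t d'] add unfolding cell_tensor_def by simp
    moreover have "DD.pt s d' \<in> carrier TT" "DD.pt t d' \<in> carrier TT"
      using DD.pure_closed add unfolding cell_tensor_def by simp_all
    ultimately show ?case using Eadd add by simp
  qed
  show ?thesis using assms unfolding cell_tensor_def
  proof (induct rule: DD.tensor_induct)
    case (pure d d')
    then show ?case using Epure by simp
  next
    case (add s t)
    then show ?case using Eadd unfolding cell_tensor_def by simp
  qed
qed

end

section \<open>Matrix rings\<close>

lemma (in abelian_monoid) finsum_swap:
  assumes "finite A" "finite B" "\<And>i j. \<lbrakk>i \<in> A; j \<in> B\<rbrakk> \<Longrightarrow> f i j \<in> carrier G"
  shows "(\<Oplus>i\<in>A. \<Oplus>j\<in>B. f i j) = (\<Oplus>j\<in>B. \<Oplus>i\<in>A. f i j)"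
  using assms(1,3)
proof (induct A)
  case empty
  then show ?case by (simp add: finsum_zero)
next
  case (insert a A)
  have c: "(\<lambda>j. f a j) \<in> B \<rightarrow> carrier G" "\<And>j. j \<in> B \<Longrightarrow> (\<lambda>i. f i j) \<in> A \<rightarrow> carrier G"
    "(\<lambda>i. \<Oplus>j\<in>B. f i j) \<in> A \<rightarrow> carrier G"
    using insert(4) by (auto intro!: finsum_closed)
  have "(\<Oplus>i\<in>insert a A. \<Oplus>j\<in>B. f i j) = (\<Oplus>j\<in>B. f a j) \<oplus> (\<Oplus>i\<in>A. \<Oplus>j\<in>B. f i j)"
    using insert(1,2) c by (intro finsum_insert) auto
  also have "(\<Oplus>i\<in>A. \<Oplus>j\<in>B. f i j) = (\<Oplus>j\<in>B. \<Oplus>i\<in>A. f i j)" using insert by simp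
  also have "(\<Oplus>j\<in>B. f a j) \<oplus> \<dots> = (\<Oplus>j\<in>B. f a j \<oplus> (\<Oplus>i\<in>A. f i j))"
    using c by (intro finsum_addf[symmetric]) auto
  also have "\<dots> = (\<Oplus>j\<in>B. \<Oplus>i\<in>insert a A. f i j)"
  proof (rule finsum_cong')
    fix j assume j: "j \<in> B"
    show "f a j \<oplus> (\<Oplus>i\<in>A. f i j) = (\<Oplus>i\<in>insert a A. f i j)"
      using insert(1,2) c(2)[OF j] insert(4)[OF _ j] by (intro finsum_insert[symmetric]) auto
  qed (use insert(4) in \<open>auto intro!: finsum_closed\<close>)
  finally show ?case .
qed

definition matrix_unit :: "('b, 'z) ring_scheme \<Rightarrow> nat \<Rightarrow> nat \<Rightarrow> nat \<Rightarrow> 'b \<Rightarrow> nat \<times> nat \<Rightarrow> 'b" where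
  "matrix_unit B n i j b = restrict (\<lambda>s. if s = (i, j) then b else \<zero>\<^bsub>B\<^esub>) ({1..n} \<times> {1..n})"

context
  fixes B :: "('b, 'z) ring_scheme" and n :: nat
  assumes B: "cring B"
begin

abbreviation (input) "Mat \<equiv> matrix_ring B n"
abbreviation (input) "I2 \<equiv> {1..n} \<times> {1..n}"

lemma matrix_entry_closed: "C \<in> carrier Mat \<Longrightarrow> i \<in> {1..n} \<Longrightarrow> j \<in> {1..n} \<Longrightarrow> C (i, j) \<in> carrier B"
  unfolding matrix_ring_def by auto

lemma matrix_eqI:
  assumes "C \<in> carrier Mat" "D \<in> carrier Mat" "\<And>i j. \<lbrakk>i \<in> {1..n}; j \<in> {1..n}\<rbrakk> \<Longrightarrow> C (i, j) = D (i, j)"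
  shows "C = D"
proof (rule PiE_ext)
  show "C \<in> I2 \<rightarrow>\<^sub>E carrier B" "D \<in> I2 \<rightarrow>\<^sub>E carrier B" using assms(1,2) by (simp_all add: matrix_ring_def)
qed (use assms(3) in auto)

lemma matrix_memI:
  assumes "\<And>i j. \<lbrakk>i \<in> {1..n}; j \<in> {1..n}\<rbrakk> \<Longrightarrow> f (i, j) \<in> carrier B"
  shows "restrict f I2 \<in> carrier Mat"
  using assms unfolding matrix_ring_def by auto

lemma matrix_mult_entry:
  assumes "i \<in> {1..n}" "j \<in> {1..n}"
  shows "(C \<otimes>\<^bsub>Mat\<^esub> D) (i, j) = (\<Oplus>\<^bsub>B\<^esub>k\<in>{1..n}. C (i, k) \<otimes>\<^bsub>B\<^esub> D (k, j))"
  using assms unfolding matrix_ring_def by simp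

lemma matrix_add_entry:
  assumes "i \<in> {1..n}" "j \<in> {1..n}"
  shows "(C \<oplus>\<^bsub>Mat\<^esub> D) (i, j) = C (i, j) \<oplus>\<^bsub>B\<^esub> D (i, j)"
  using assms unfolding matrix_ring_def by simp

lemma matrix_zero_one_entry:
  assumes "i \<in> {1..n}" "j \<in> {1..n}"
  shows "\<zero>\<^bsub>Mat\<^esub> (i, j) = \<zero>\<^bsub>B\<^esub>" "\<one>\<^bsub>Mat\<^esub> (i, j) = (if i = j then \<one>\<^bsub>B\<^esub> else \<zero>\<^bsub>B\<^esub>)"
  using assms unfolding matrix_ring_def by simp_all

lemma matrix_ring_is_ring: "ring Mat"
proof -
  interpret B: cring B by (rule B)
  note ec = matrix_entry_closed and me = matrix_mult_entry and ae = matrix_add_entry and ze = matrix_zero_one_entry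
  have mc: "C \<otimes>\<^bsub>Mat\<^esub> D \<in> carrier Mat" if C: "C \<in> carrier Mat" and D: "D \<in> carrier Mat" for C D
  proof -
    have "(\<Oplus>\<^bsub>B\<^esub>j\<in>{1..n}. C (i, j) \<otimes>\<^bsub>B\<^esub> D (j, k)) \<in> carrier B" if "i \<in> {1..n}" "k \<in> {1..n}" for i k
      by (intro B.finsum_closed Pi_I B.m_closed ec[OF C] ec[OF D] that) simp_all
    then show ?thesis unfolding matrix_ring_def by auto
  qed
  have ac: "C \<oplus>\<^bsub>Mat\<^esub> D \<in> carrier Mat" if C: "C \<in> carrier Mat" and D: "D \<in> carrier Mat" for C D
  proof -
    have "C s \<oplus>\<^bsub>B\<^esub> D s \<in> carrier B" if "s \<in> I2" for s using that ec[OF C] ec[OF D] by auto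
    then show ?thesis unfolding matrix_ring_def by auto
  qed
  have zc: "\<zero>\<^bsub>Mat\<^esub> \<in> carrier Mat" and oc: "\<one>\<^bsub>Mat\<^esub> \<in> carrier Mat" unfolding matrix_ring_def by auto
  show ?thesis
  proof (rule ringI)
    show "abelian_group Mat"
    proof (rule abelian_groupI)
      fix C assume C: "C \<in> carrier Mat"
      let ?N = "restrict (\<lambda>s. \<ominus>\<^bsub>B\<^esub> C s) I2"
      have N: "?N \<in> carrier Mat" using ec[OF C] by (intro matrix_memI) simp
      have "?N \<oplus>\<^bsub>Mat\<^esub> C = \<zero>\<^bsub>Mat\<^esub>"
        by (rule matrix_eqI[OF ac[OF N C] zc]) (use ec[OF C] in \<open>simp add: ae ze B.l_neg\<close>)
      then show "\<exists>D\<in>carrier Mat. D \<oplus>\<^bsub>Mat\<^esub> C = \<zero>\<^bsub>Mat\<^esub>" using N by blast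
      show "\<zero>\<^bsub>Mat\<^esub> \<oplus>\<^bsub>Mat\<^esub> C = C"
        by (rule matrix_eqI[OF ac[OF zc C] C]) (use ec[OF C] in \<open>simp add: ae ze\<close>)
      fix D assume D: "D \<in> carrier Mat"
      show "C \<oplus>\<^bsub>Mat\<^esub> D = D \<oplus>\<^bsub>Mat\<^esub> C"
        by (rule matrix_eqI[OF ac[OF C D] ac[OF D C]]) (use ec[OF C] ec[OF D] in \<open>simp add: ae B.a_comm\<close>)
      fix E assume E: "E \<in> carrier Mat"
      show "C \<oplus>\<^bsub>Mat\<^esub> D \<oplus>\<^bsub>Mat\<^esub> E = C \<oplus>\<^bsub>Mat\<^esub> (D \<oplus>\<^bsub>Mat\<^esub> E)"
        by (rule matrix_eqI[OF ac[OF ac[OF C D] E] ac[OF C ac[OF D E]]])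
           (use ec[OF C] ec[OF D] ec[OF E] in \<open>simp add: ae B.a_assoc\<close>)
    qed (use ac zc in auto)
    show "Group.monoid Mat"
    proof (rule monoidI)
      fix C assume C: "C \<in> carrier Mat"
      show "\<one>\<^bsub>Mat\<^esub> \<otimes>\<^bsub>Mat\<^esub> C = C"
      proof (rule matrix_eqI[OF mc[OF oc C] C])
        fix i k assume i: "i \<in> {1..n}" and k: "k \<in> {1..n}"
        have "(\<Oplus>\<^bsub>B\<^esub>j\<in>{1..n}. \<one>\<^bsub>Mat\<^esub> (i, j) \<otimes>\<^bsub>B\<^esub> C (j, k)) = (\<Oplus>\<^bsub>B\<^esub>j\<in>{1..n}. if i = j then C (j, k) else \<zero>\<^bsub>B\<^esub>)"
          by (rule B.finsum_cong') (use i k ec[OF C] in \<open>auto simp: ze\<close>)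
        also have "\<dots> = C (i, k)" by (rule B.finsum_singleton) (use i k ec[OF C] in auto)
        finally show "(\<one>\<^bsub>Mat\<^esub> \<otimes>\<^bsub>Mat\<^esub> C) (i, k) = C (i, k)" by (simp only: me[OF i k])
      qed
      show "C \<otimes>\<^bsub>Mat\<^esub> \<one>\<^bsub>Mat\<^esub> = C"
      proof (rule matrix_eqI[OF mc[OF C oc] C])
        fix i k assume i: "i \<in> {1..n}" and k: "k \<in> {1..n}"
        have "(\<Oplus>\<^bsub>B\<^esub>j\<in>{1..n}. C (i, j) \<otimes>\<^bsub>B\<^esub> \<one>\<^bsub>Mat\<^esub> (j, k)) = (\<Oplus>\<^bsub>B\<^esub>j\<in>{1..n}. if k = j then C (i, j) else \<zero>\<^bsub>B\<^esub>)"
          by (rule B.finsum_cong') (use i k ec[OF C] in \<open>auto simp: ze\<close>)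
        also have "\<dots> = C (i, k)" by (rule B.finsum_singleton) (use i k ec[OF C] in auto)
        finally show "(C \<otimes>\<^bsub>Mat\<^esub> \<one>\<^bsub>Mat\<^esub>) (i, k) = C (i, k)" by (simp only: me[OF i k])
      qed
      fix D E assume D: "D \<in> carrier Mat" and E: "E \<in> carrier Mat"
      show "C \<otimes>\<^bsub>Mat\<^esub> D \<otimes>\<^bsub>Mat\<^esub> E = C \<otimes>\<^bsub>Mat\<^esub> (D \<otimes>\<^bsub>Mat\<^esub> E)"
      proof (rule matrix_eqI[OF mc[OF mc[OF C D] E] mc[OF C mc[OF D E]]])
        fix i l assume i: "i \<in> {1..n}" and l: "l \<in> {1..n}"
        have c: "C (i, j) \<otimes>\<^bsub>B\<^esub> D (j, k) \<in> carrier B" "D (j, k) \<otimes>\<^bsub>B\<^esub> E (k, l) \<in> carrier B"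
          "C (i, j) \<in> carrier B" "D (j, k) \<in> carrier B" "E (k, l) \<in> carrier B"
          if "j \<in> {1..n}" "k \<in> {1..n}" for j k
          using that i l ec[OF C] ec[OF D] ec[OF E] by simp_all
        have "(\<Oplus>\<^bsub>B\<^esub>k\<in>{1..n}. (C \<otimes>\<^bsub>Mat\<^esub> D) (i, k) \<otimes>\<^bsub>B\<^esub> E (k, l)) =
            (\<Oplus>\<^bsub>B\<^esub>k\<in>{1..n}. \<Oplus>\<^bsub>B\<^esub>j\<in>{1..n}. (C (i, j) \<otimes>\<^bsub>B\<^esub> D (j, k)) \<otimes>\<^bsub>B\<^esub> E (k, l))"
        proof (rule B.finsum_cong')
          fix k assume k: "k \<in> {1..n}"
          show "(C \<otimes>\<^bsub>Mat\<^esub> D) (i, k) \<otimes>\<^bsub>B\<^esub> E (k, l) = (\<Oplus>\<^bsub>B\<^esub>j\<in>{1..n}. (C (i, j) \<otimes>\<^bsub>B\<^esub> D (j, k)) \<otimes>\<^bsub>B\<^esub> E (k, l))"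
            unfolding me[OF i k] using c k by (intro B.finsum_ldistr) auto
        qed (use c in \<open>auto intro!: B.finsum_closed\<close>)
        also have "\<dots> = (\<Oplus>\<^bsub>B\<^esub>j\<in>{1..n}. \<Oplus>\<^bsub>B\<^esub>k\<in>{1..n}. (C (i, j) \<otimes>\<^bsub>B\<^esub> D (j, k)) \<otimes>\<^bsub>B\<^esub> E (k, l))"
          by (rule B.finsum_swap) (use c in auto)
        also have "\<dots> = (\<Oplus>\<^bsub>B\<^esub>j\<in>{1..n}. C (i, j) \<otimes>\<^bsub>B\<^esub> (D \<otimes>\<^bsub>Mat\<^esub> E) (j, l))"
        proof (rule B.finsum_cong')
          fix j assume j: "j \<in> {1..n}"
          have "(\<Oplus>\<^bsub>B\<^esub>k\<in>{1..n}. (C (i, j) \<otimes>\<^bsub>B\<^esub> D (j, k)) \<otimes>\<^bsub>B\<^esub> E (k, l)) = (\<Oplus>\<^bsub>B\<^esub>k\<in>{1..n}. C (i, j) \<otimes>\<^bsub>B\<^esub> (D (j, k) \<otimes>\<^bsub>B\<^esub> E (k, l)))"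
            by (rule B.finsum_cong') (use c j in \<open>auto simp: B.m_assoc\<close>)
          also have "\<dots> = C (i, j) \<otimes>\<^bsub>B\<^esub> (D \<otimes>\<^bsub>Mat\<^esub> E) (j, l)"
            unfolding me[OF j l] using c j by (intro B.finsum_rdistr[symmetric]) auto
          finally show "(\<Oplus>\<^bsub>B\<^esub>k\<in>{1..n}. (C (i, j) \<otimes>\<^bsub>B\<^esub> D (j, k)) \<otimes>\<^bsub>B\<^esub> E (k, l)) = C (i, j) \<otimes>\<^bsub>B\<^esub> (D \<otimes>\<^bsub>Mat\<^esub> E) (j, l)" .
        qed (use c ec[OF mc[OF D E]] l in auto)
        finally show "(C \<otimes>\<^bsub>Mat\<^esub> D \<otimes>\<^bsub>Mat\<^esub> E) (i, l) = (C \<otimes>\<^bsub>Mat\<^esub> (D \<otimes>\<^bsub>Mat\<^esub> E)) (i, l)"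
          by (simp only: me[OF i l])
      qed
    qed (use mc oc in auto)
  next
    fix C D E assume C: "C \<in> carrier Mat" and D: "D \<in> carrier Mat" and E: "E \<in> carrier Mat"
    show "(C \<oplus>\<^bsub>Mat\<^esub> D) \<otimes>\<^bsub>Mat\<^esub> E = C \<otimes>\<^bsub>Mat\<^esub> E \<oplus>\<^bsub>Mat\<^esub> D \<otimes>\<^bsub>Mat\<^esub> E"
    proof (rule matrix_eqI[OF mc[OF ac[OF C D] E] ac[OF mc[OF C E] mc[OF D E]]])
      fix i k assume i: "i \<in> {1..n}" and k: "k \<in> {1..n}"
      have "(\<Oplus>\<^bsub>B\<^esub>j\<in>{1..n}. (C \<oplus>\<^bsub>Mat\<^esub> D) (i, j) \<otimes>\<^bsub>B\<^esub> E (j, k)) =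
          (\<Oplus>\<^bsub>B\<^esub>j\<in>{1..n}. C (i, j) \<otimes>\<^bsub>B\<^esub> E (j, k) \<oplus>\<^bsub>B\<^esub> D (i, j) \<otimes>\<^bsub>B\<^esub> E (j, k))"
        by (rule B.finsum_cong') (use i k ec[OF C] ec[OF D] ec[OF E] in \<open>auto simp: ae B.l_distr\<close>)
      also have "\<dots> = (\<Oplus>\<^bsub>B\<^esub>j\<in>{1..n}. C (i, j) \<otimes>\<^bsub>B\<^esub> E (j, k)) \<oplus>\<^bsub>B\<^esub> (\<Oplus>\<^bsub>B\<^esub>j\<in>{1..n}. D (i, j) \<otimes>\<^bsub>B\<^esub> E (j, k))"
        by (rule B.finsum_addf) (use i k ec[OF C] ec[OF D] ec[OF E] in auto)
      finally show "((C \<oplus>\<^bsub>Mat\<^esub> D) \<otimes>\<^bsub>Mat\<^esub> E) (i, k) = (C \<otimes>\<^bsub>Mat\<^esub> E \<oplus>\<^bsub>Mat\<^esub> D \<otimes>\<^bsub>Mat\<^esub> E) (i, k)"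
        by (simp only: me[OF i k] ae[OF i k])
    qed
    show "E \<otimes>\<^bsub>Mat\<^esub> (C \<oplus>\<^bsub>Mat\<^esub> D) = E \<otimes>\<^bsub>Mat\<^esub> C \<oplus>\<^bsub>Mat\<^esub> E \<otimes>\<^bsub>Mat\<^esub> D"
    proof (rule matrix_eqI[OF mc[OF E ac[OF C D]] ac[OF mc[OF E C] mc[OF E D]]])
      fix i k assume i: "i \<in> {1..n}" and k: "k \<in> {1..n}"
      have "(\<Oplus>\<^bsub>B\<^esub>j\<in>{1..n}. E (i, j) \<otimes>\<^bsub>B\<^esub> (C \<oplus>\<^bsub>Mat\<^esub> D) (j, k)) =
          (\<Oplus>\<^bsub>B\<^esub>j\<in>{1..n}. E (i, j) \<otimes>\<^bsub>B\<^esub> C (j, k) \<oplus>\<^bsub>B\<^esub> E (i, j) \<otimes>\<^bsub>B\<^esub> D (j, k))"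
        by (rule B.finsum_cong') (use i k ec[OF C] ec[OF D] ec[OF E] in \<open>auto simp: ae B.r_distr\<close>)
      also have "\<dots> = (\<Oplus>\<^bsub>B\<^esub>j\<in>{1..n}. E (i, j) \<otimes>\<^bsub>B\<^esub> C (j, k)) \<oplus>\<^bsub>B\<^esub> (\<Oplus>\<^bsub>B\<^esub>j\<in>{1..n}. E (i, j) \<otimes>\<^bsub>B\<^esub> D (j, k))"
        by (rule B.finsum_addf) (use i k ec[OF C] ec[OF D] ec[OF E] in auto)
      finally show "(E \<otimes>\<^bsub>Mat\<^esub> (C \<oplus>\<^bsub>Mat\<^esub> D)) (i, k) = (E \<otimes>\<^bsub>Mat\<^esub> C \<oplus>\<^bsub>Mat\<^esub> E \<otimes>\<^bsub>Mat\<^esub> D) (i, k)"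
        by (simp only: me[OF i k] ae[OF i k])
    qed
  qed
qed

lemma matrix_unit_closed [simp]: "b \<in> carrier B \<Longrightarrow> matrix_unit B n i j b \<in> carrier Mat"
  using cring.cring_simprules(2)[OF B] unfolding matrix_unit_def matrix_ring_def by auto

lemma matrix_unit_mult_left:
  assumes "i \<in> {1..n}" "j \<in> {1..n}" "b \<in> carrier B" "C \<in> carrier Mat" "k \<in> {1..n}" "l \<in> {1..n}"
  shows "(matrix_unit B n i j b \<otimes>\<^bsub>Mat\<^esub> C) (k, l) = (if k = i then b \<otimes>\<^bsub>B\<^esub> C (j, l) else \<zero>\<^bsub>B\<^esub>)"
proof -
  interpret B: cring B by (rule B)
  have "(\<Oplus>\<^bsub>B\<^esub>r\<in>{1..n}. matrix_unit B n i j b (k, r) \<otimes>\<^bsub>B\<^esub> C (r, l)) =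
      (\<Oplus>\<^bsub>B\<^esub>r\<in>{1..n}. if j = r then (if k = i then b \<otimes>\<^bsub>B\<^esub> C (r, l) else \<zero>\<^bsub>B\<^esub>) else \<zero>\<^bsub>B\<^esub>)"
    by (rule B.finsum_cong') (use assms matrix_entry_closed[OF assms(4)] in \<open>auto simp: matrix_unit_def\<close>)
  also have "\<dots> = (if k = i then b \<otimes>\<^bsub>B\<^esub> C (j, l) else \<zero>\<^bsub>B\<^esub>)"
    by (rule B.finsum_singleton) (use assms matrix_entry_closed[OF assms(4)] in auto)
  finally show ?thesis by (simp only: matrix_mult_entry[OF assms(5,6)])
qed

lemma matrix_unit_mult_right:
  assumes "i \<in> {1..n}" "j \<in> {1..n}" "b \<in> carrier B" "C \<in> carrier Mat" "k \<in> {1..n}" "l \<in> {1..n}"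
  shows "(C \<otimes>\<^bsub>Mat\<^esub> matrix_unit B n i j b) (k, l) = (if l = j then C (k, i) \<otimes>\<^bsub>B\<^esub> b else \<zero>\<^bsub>B\<^esub>)"
proof -
  interpret B: cring B by (rule B)
  have "(\<Oplus>\<^bsub>B\<^esub>r\<in>{1..n}. C (k, r) \<otimes>\<^bsub>B\<^esub> matrix_unit B n i j b (r, l)) =
      (\<Oplus>\<^bsub>B\<^esub>r\<in>{1..n}. if i = r then (if l = j then C (k, r) \<otimes>\<^bsub>B\<^esub> b else \<zero>\<^bsub>B\<^esub>) else \<zero>\<^bsub>B\<^esub>)"
    by (rule B.finsum_cong') (use assms matrix_entry_closed[OF assms(4)] in \<open>auto simp: matrix_unit_def\<close>)
  also have "\<dots> = (if l = j then C (k, i) \<otimes>\<^bsub>B\<^esub> b else \<zero>\<^bsub>B\<^esub>)"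
    by (rule B.finsum_singleton) (use assms matrix_entry_closed[OF assms(4)] in auto)
  finally show ?thesis by (simp only: matrix_mult_entry[OF assms(5,6)])
qed

end

section \<open>Left ideals and semisimplicity\<close>

definition left_ideal :: "('a, 'z) ring_scheme \<Rightarrow> 'a set \<Rightarrow> bool" where
  "left_ideal A L \<longleftrightarrow> L \<subseteq> carrier A \<and> \<zero>\<^bsub>A\<^esub> \<in> L \<and> (\<forall>x\<in>L. \<forall>y\<in>L. x \<oplus>\<^bsub>A\<^esub> y \<in> L) \<and>
     (\<forall>a\<in>carrier A. \<forall>x\<in>L. a \<otimes>\<^bsub>A\<^esub> x \<in> L)"

definition has_right_one :: "('a, 'z) ring_scheme \<Rightarrow> 'a set \<Rightarrow> bool" where
  "has_right_one A L \<longleftrightarrow> (\<exists>e\<in>L. \<forall>x\<in>L. x \<otimes>\<^bsub>A\<^esub> e = x)"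

definition minimal_left_ideal :: "('a, 'z) ring_scheme \<Rightarrow> 'a set \<Rightarrow> bool" where
  "minimal_left_ideal A N \<longleftrightarrow> left_ideal A N \<and> N \<noteq> {\<zero>\<^bsub>A\<^esub>} \<and>
     (\<forall>H. left_ideal A H \<and> H \<subseteq> N \<longrightarrow> H = {\<zero>\<^bsub>A\<^esub>} \<or> H = N)"

lemma left_idealD:
  assumes "left_ideal A L"
  shows "x \<in> L \<Longrightarrow> x \<in> carrier A" "\<zero>\<^bsub>A\<^esub> \<in> L" "\<lbrakk>x \<in> L; y \<in> L\<rbrakk> \<Longrightarrow> x \<oplus>\<^bsub>A\<^esub> y \<in> L"
    "\<lbrakk>a \<in> carrier A; x \<in> L\<rbrakk> \<Longrightarrow> a \<otimes>\<^bsub>A\<^esub> x \<in> L"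
  using assms unfolding left_ideal_def by auto

context ring
begin

lemma add_minus_cancel:
  assumes "c \<in> carrier R" "x \<in> carrier R"
  shows "(c \<oplus> x) \<ominus> c = x" "(x \<oplus> c) \<ominus> c = x" "c \<oplus> (x \<ominus> c) = x"
proof -
  show 1: "(x \<oplus> c) \<ominus> c = x" using assms by (simp add: minus_eq a_assoc r_neg)
  then show "(c \<oplus> x) \<ominus> c = x" using assms by (simp add: a_comm)
  have "c \<oplus> (x \<ominus> c) = x \<oplus> (c \<oplus> \<ominus> c)" using assms by (simp add: minus_eq a_lcomm)
  then show "c \<oplus> (x \<ominus> c) = x" using assms by (simp add: r_neg)
qed

lemma left_ideal_uminus:
  assumes L: "left_ideal R L" and x: "x \<in> L" shows "\<ominus> x \<in> L"
proof -
  have "\<ominus> x = (\<ominus> \<one>) \<otimes> x" using left_idealD(1)[OF L x] by (simp add: l_minus)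
  then show ?thesis using left_idealD(4)[OF L _ x, of "\<ominus> \<one>"] by simp
qed

lemma left_ideal_minus:
  assumes L: "left_ideal R L" and "x \<in> L" "y \<in> L" shows "x \<ominus> y \<in> L"
  unfolding minus_eq by (intro left_idealD(3)[OF L] left_ideal_uminus[OF L] assms)

lemma left_ideal_Int: "left_ideal R L \<Longrightarrow> left_ideal R L' \<Longrightarrow> left_ideal R (L \<inter> L')"
  unfolding left_ideal_def by auto

lemma left_ideal_zero: "left_ideal R {\<zero>}" unfolding left_ideal_def by simp

lemma left_ideal_annihilator:
  assumes L: "left_ideal R L" and e: "e \<in> carrier R" shows "left_ideal R {x \<in> L. x \<otimes> e = \<zero>}"
  using L e unfolding left_ideal_def by (auto simp: l_distr m_assoc subset_iff)

lemma left_ideal_add: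
  assumes L: "left_ideal R L" and L': "left_ideal R L'"
  shows "left_ideal R (L <+>\<^bsub>R\<^esub> L')" "L \<subseteq> L <+>\<^bsub>R\<^esub> L'" "L' \<subseteq> L <+>\<^bsub>R\<^esub> L'"
proof -
  note D = left_idealD[OF L] and D' = left_idealD[OF L']
  have I: "x \<oplus> y \<in> L <+>\<^bsub>R\<^esub> L'" if "x \<in> L" "y \<in> L'" for x y
    using that unfolding set_add_def' by blast
  have "(x \<oplus> y) \<oplus> (x' \<oplus> y') \<in> L <+>\<^bsub>R\<^esub> L'" if "x \<in> L" "x' \<in> L" "y \<in> L'" "y' \<in> L'" for x x' y y'
  proof -
    have "(x \<oplus> y) \<oplus> (x' \<oplus> y') = (x \<oplus> x') \<oplus> (y \<oplus> y')" using that D(1) D'(1) by (simp add: a_ac)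
    then show ?thesis using I[OF D(3) D'(3)] that by simp
  qed
  note closed = this
  have mult: "a \<otimes> (x \<oplus> y) \<in> L <+>\<^bsub>R\<^esub> L'" if "a \<in> carrier R" "x \<in> L" "y \<in> L'" for a x y
  proof -
    have "a \<otimes> (x \<oplus> y) = a \<otimes> x \<oplus> a \<otimes> y" using that D(1) D'(1) by (simp add: r_distr)
    then show ?thesis using I[OF D(4) D'(4)] that by simp
  qed
  have E: "\<exists>x\<in>L. \<exists>y\<in>L'. z = x \<oplus> y" if "z \<in> L <+>\<^bsub>R\<^esub> L'" for z
    using that unfolding set_add_def' by blast
  show "left_ideal R (L <+>\<^bsub>R\<^esub> L')" unfolding left_ideal_def
  proof (intro conjI ballI)
    show "L <+>\<^bsub>R\<^esub> L' \<subseteq> carrier R" using D(1) D'(1) unfolding set_add_def' by auto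
    show "\<zero> \<in> L <+>\<^bsub>R\<^esub> L'" using I[OF D(2) D'(2)] by simp
    fix z assume z: "z \<in> L <+>\<^bsub>R\<^esub> L'"
    from E[OF z] obtain x y where xy: "x \<in> L" "y \<in> L'" "z = x \<oplus> y" by blast
    show "a \<otimes> z \<in> L <+>\<^bsub>R\<^esub> L'" if "a \<in> carrier R" for a
      unfolding xy(3) by (rule mult[OF that xy(1,2)])
    fix z' assume z': "z' \<in> L <+>\<^bsub>R\<^esub> L'"
    from E[OF z'] obtain x' y' where xy': "x' \<in> L" "y' \<in> L'" "z' = x' \<oplus> y'" by blast
    show "z \<oplus> z' \<in> L <+>\<^bsub>R\<^esub> L'" unfolding xy(3) xy'(3) by (rule closed[OF xy(1) xy'(1) xy(2) xy'(2)])
  qed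
  show "L \<subseteq> L <+>\<^bsub>R\<^esub> L'"
  proof
    fix x assume "x \<in> L" then show "x \<in> L <+>\<^bsub>R\<^esub> L'" using I[OF _ D'(2), of x] D(1) by simp
  qed
  show "L' \<subseteq> L <+>\<^bsub>R\<^esub> L'"
  proof
    fix x assume "x \<in> L'" then show "x \<in> L <+>\<^bsub>R\<^esub> L'" using I[OF D(2), of x] D'(1) by simp
  qed
qed

lemma left_ideal_Union_chain:
  assumes "C \<noteq> {}" "subset.chain {L. left_ideal R L} C" shows "left_ideal R (\<Union>C)"
proof -
  have C: "left_ideal R L" if "L \<in> C" for L using assms(2) that unfolding pred_on.chain_def by auto
  have "x \<oplus> y \<in> \<Union>C" if xy: "x \<in> \<Union>C" "y \<in> \<Union>C" for x y
  proof -
    obtain L L' where LL: "L \<in> C" "x \<in> L" "L' \<in> C" "y \<in> L'" using xy by blast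
    then have "L \<subseteq> L' \<or> L' \<subseteq> L" using assms(2) unfolding pred_on.chain_def by blast
    then obtain L'' where "L'' \<in> C" "x \<in> L''" "y \<in> L''" using LL by blast
    then show ?thesis using left_idealD(3)[OF C] by blast
  qed
  moreover have "a \<otimes> x \<in> \<Union>C" if "a \<in> carrier R" "x \<in> \<Union>C" for a x
    using that left_idealD(4)[OF C] by blast
  moreover have "\<Union>C \<subseteq> carrier R" using left_idealD(1)[OF C] by blast
  moreover have "\<zero> \<in> \<Union>C" using assms(1) left_idealD(2)[OF C] by blast
  ultimately show ?thesis unfolding left_ideal_def by blast
qed

abbreviation "reg \<equiv> regular_module R"

lemma reg_simps [simp]: "carrier reg = carrier R" "\<zero>\<^bsub>reg\<^esub> = \<zero>" "x \<oplus>\<^bsub>reg\<^esub> y = x \<oplus> y" "a \<odot>\<^bsub>reg\<^esub> x = a \<otimes> x"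
  unfolding regular_module_def by simp_all

text \<open>A simple submodule of the regular module is a minimal left ideal. The definition of simplicity
  refers to the restriction of the regular module to such a left ideal, which is therefore shown to
  be a module with the submodules that one expects.\<close>

lemma left_module_restrict:
  assumes L: "left_ideal R L" shows "left_module R (reg\<lparr>carrier := L\<rparr>)"
proof (intro left_module.intro left_module_axioms.intro)
  note D = left_idealD[OF L]
  show "abelian_group (reg\<lparr>carrier := L\<rparr>)"
  proof (rule abelian_groupI)
    fix x assume "x \<in> carrier (reg\<lparr>carrier := L\<rparr>)"
    then show "\<exists>y\<in>carrier (reg\<lparr>carrier := L\<rparr>). y \<oplus>\<^bsub>reg\<lparr>carrier := L\<rparr>\<^esub> x = \<zero>\<^bsub>reg\<lparr>carrier := L\<rparr>\<^esub>"
      using D(1) left_ideal_uminus[OF L] by (intro bexI[of _ "\<ominus> x"]) (simp_all add: l_neg)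
  qed (use D in \<open>simp_all add: a_ac\<close>)
  show "ring R" by (rule ring_axioms)
qed (use left_idealD[OF L] in \<open>simp_all add: l_distr r_distr m_assoc\<close>)

lemma a_inv_restrict:
  assumes L: "left_ideal R L" and x: "x \<in> L"
  shows "inv\<^bsub>add_monoid (reg\<lparr>carrier := L\<rparr>)\<^esub> x = \<ominus> x"
proof -
  interpret L: left_module R "reg\<lparr>carrier := L\<rparr>" by (rule left_module_restrict[OF L])
  have "\<ominus>\<^bsub>reg\<lparr>carrier := L\<rparr>\<^esub> x = \<ominus> x"
    using x left_ideal_uminus[OF L x] left_idealD(1)[OF L x]
    by (intro L.M.minus_equality) (simp_all add: l_neg)
  then show ?thesis by (simp add: a_inv_def)
qed

lemma left_ideal_carrier: "left_ideal R (carrier R)"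
  unfolding left_ideal_def by auto

lemma submodule_restrict_iff:
  assumes L: "left_ideal R L"
  shows "submodule H R (reg\<lparr>carrier := L\<rparr>) \<longleftrightarrow> left_ideal R H \<and> H \<subseteq> L"
proof
  assume H: "submodule H R (reg\<lparr>carrier := L\<rparr>)"
  then have g: "subgroup H (add_monoid (reg\<lparr>carrier := L\<rparr>))" by (rule submodule.axioms)
  have "H \<subseteq> L" "\<zero> \<in> H" "\<And>x y. x \<in> H \<Longrightarrow> y \<in> H \<Longrightarrow> x \<oplus> y \<in> H"
    using subgroup.subset[OF g] subgroup.one_closed[OF g] subgroup.m_closed[OF g] by simp_all
  moreover have "\<And>a x. a \<in> carrier R \<Longrightarrow> x \<in> H \<Longrightarrow> a \<otimes> x \<in> H"
    using submodule.smult_closed[OF H] by simp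
  ultimately show "left_ideal R H \<and> H \<subseteq> L" using left_idealD(1)[OF L] unfolding left_ideal_def by blast
next
  assume "left_ideal R H \<and> H \<subseteq> L"
  then have H: "left_ideal R H" and HL: "H \<subseteq> L" by auto
  note D = left_idealD[OF H]
  show "submodule H R (reg\<lparr>carrier := L\<rparr>)"
  proof (intro submodule.intro subgroup.intro submodule_axioms.intro)
    fix x assume x: "x \<in> H"
    then show "inv\<^bsub>add_monoid (reg\<lparr>carrier := L\<rparr>)\<^esub> x \<in> H"
      using a_inv_restrict[OF L, of x] HL left_ideal_uminus[OF H x] by auto
  qed (use D HL in simp_all)
qed

lemma reg_restrict: "reg\<lparr>carrier := carrier R\<rparr> = reg"
  unfolding regular_module_def with_smult_def by simp

lemma submodule_reg_iff: "submodule H R reg \<longleftrightarrow> left_ideal R H"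
  using submodule_restrict_iff[OF left_ideal_carrier, of H] unfolding reg_restrict
  by (auto simp: left_ideal_def)

lemma simple_restrict_iff:
  "submodule N R reg \<and> simple_module R (reg\<lparr>carrier := N\<rparr>) \<longleftrightarrow> minimal_left_ideal R N"
  unfolding submodule_reg_iff simple_module_def minimal_left_ideal_def
  using submodule_restrict_iff[of N] left_module_restrict[of N] by auto

lemma a_inv_reg:
  assumes x: "x \<in> carrier R" shows "inv\<^bsub>add_monoid reg\<^esub> x = \<ominus> x"
  using a_inv_restrict[OF left_ideal_carrier x] by (simp add: reg_restrict)

lemma sum_of_left_ideals:
  assumes S: "\<And>N. N \<in> S \<Longrightarrow> left_ideal R N"
  shows "left_ideal R (sum_of reg S (\<lambda>N. N))"
    and "\<And>N. N \<in> S \<Longrightarrow> N \<subseteq> sum_of reg S (\<lambda>N. N)"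
    and "\<And>L. \<lbrakk>left_ideal R L; \<And>N. N \<in> S \<Longrightarrow> N \<subseteq> L\<rbrakk> \<Longrightarrow> sum_of reg S (\<lambda>N. N) \<subseteq> L"
proof -
  let ?U = "\<Union>N\<in>S. N" and ?G = "add_monoid reg"
  have Gmult: "x \<otimes>\<^bsub>?G\<^esub> y = x \<oplus> y" and Gone: "\<one>\<^bsub>?G\<^esub> = \<zero>" for x y by simp_all
  have U: "x \<in> carrier R" if "x \<in> ?U" for x using that left_idealD(1)[OF S] by blast
  have Um: "a \<otimes> x \<in> ?U" if "x \<in> ?U" "a \<in> carrier R" for a x using that left_idealD(4)[OF S] by blast
  have least: "generate ?G ?U \<subseteq> L" if L: "left_ideal R L" "\<And>N. N \<in> S \<Longrightarrow> N \<subseteq> L" for L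
  proof
    fix x assume "x \<in> generate ?G ?U"
    then show "x \<in> L"
    proof induct
      case one show ?case using left_idealD(2)[OF L(1)] by simp
    next
      case (incl h) then show ?case using L(2) by blast
    next
      case (inv h)
      then have "h \<in> L" using L(2) by blast
      then show ?case using a_inv_reg[OF U[OF inv]] left_ideal_uminus[OF L(1)] by simp
    next
      case (eng x y) then show ?case using left_idealD(3)[OF L(1)] by simp
    qed
  qed
  show "sum_of reg S (\<lambda>N. N) \<subseteq> L" if "left_ideal R L" "\<And>N. N \<in> S \<Longrightarrow> N \<subseteq> L" for L
    unfolding sum_of_def by (rule least[OF that])
  show "N \<subseteq> sum_of reg S (\<lambda>N. N)" if "N \<in> S" for N
    unfolding sum_of_def using that by (auto intro: generate.incl)
  have c: "generate ?G ?U \<subseteq> carrier R"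
    by (rule least[OF left_ideal_carrier]) (use left_idealD(1)[OF S] in blast)
  have "a \<otimes> x \<in> generate ?G ?U" if "x \<in> generate ?G ?U" and a: "a \<in> carrier R" for a x
    using that(1)
  proof induct
    case one
    have "a \<otimes> \<one>\<^bsub>?G\<^esub> = \<one>\<^bsub>?G\<^esub>" using a by simp
    then show ?case by (simp only: generate.one)
  next
    case (incl h) then show ?case using Um[OF incl a] by (intro generate.incl)
  next
    case (inv h)
    have "a \<otimes> inv\<^bsub>?G\<^esub> h = inv\<^bsub>?G\<^esub> (a \<otimes> h)"
      using a_inv_reg[OF U[OF inv]] a_inv_reg[of "a \<otimes> h"] a U[OF inv] by (simp add: r_minus)
    then show ?case using generate.inv[OF Um[OF inv a], of ?G] by (simp only:)
  next
    case (eng x y)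
    then have "a \<otimes> (x \<oplus> y) = a \<otimes> x \<oplus> a \<otimes> y" using c a by (intro r_distr) auto
    then show ?case using generate.eng[OF eng(2,4)] by (simp only: Gmult)
  qed
  moreover have "x \<oplus> y \<in> generate ?G ?U" if "x \<in> generate ?G ?U" "y \<in> generate ?G ?U" for x y
    using generate.eng[OF that] by (simp only: Gmult)
  moreover have "\<zero> \<in> generate ?G ?U" using generate.one[of ?G ?U] by (simp only: Gone)
  ultimately show "left_ideal R (sum_of reg S (\<lambda>N. N))"
    using c unfolding sum_of_def left_ideal_def by blast
qed

lemma semisimple_ring_iff:
  "semisimple_ring R \<longleftrightarrow> (\<exists>S. (\<forall>N\<in>S. minimal_left_ideal R N) \<and> is_direct_sum reg S (\<lambda>N. N))"
  unfolding semisimple_ring_def semisimple_module_def simple_restrict_iff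
  using left_module_restrict[OF left_ideal_carrier] by (simp add: reg_restrict)

text \<open>Let \<open>C\<close> be maximal among the left ideals with \<open>A a \<inter> C = 0\<close>. A minimal left ideal that is not
  contained in \<open>A a + C\<close> meets it in \<open>0\<close> and could be added to \<open>C\<close>. Hence \<open>A a + C\<close> contains all minimal
  left ideals, which together generate \<open>A\<close>. If \<open>1 = y a + c\<close> with \<open>c \<in> C\<close>, then \<open>a - a y a = a c\<close> lies in
  \<open>A a \<inter> C\<close>, so it is \<open>0\<close>.\<close>

theorem semisimple_imp_vn_regular:
  assumes "semisimple_ring R" shows "vn_regular R"
  unfolding vn_regular_def
proof
  obtain S where S: "\<And>N. N \<in> S \<Longrightarrow> minimal_left_ideal R N" and sum: "carrier R = sum_of reg S (\<lambda>N. N)"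
    using assms unfolding semisimple_ring_iff is_direct_sum_def by auto
  have SL: "left_ideal R N" if "N \<in> S" for N using S[OF that] unfolding minimal_left_ideal_def by blast
  fix a assume a: "a \<in> carrier R"
  define L where "L = (\<lambda>x. x \<otimes> a) ` carrier R"
  have L: "left_ideal R L"
  proof -
    have "x \<otimes> a \<oplus> y \<otimes> a \<in> L" if "x \<in> carrier R" "y \<in> carrier R" for x y
      using l_distr[OF that a] that unfolding L_def by (metis a_closed imageI)
    moreover have "b \<otimes> (x \<otimes> a) \<in> L" if "x \<in> carrier R" "b \<in> carrier R" for b x
      using m_assoc[OF that(2,1) a] that unfolding L_def by (metis m_closed imageI)
    moreover have "\<zero> \<in> L" using l_null[OF a] unfolding L_def by (metis zero_closed imageI)
    ultimately show ?thesis unfolding left_ideal_def using a unfolding L_def by auto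
  qed
  define F where "F = {C. left_ideal R C \<and> L \<inter> C = {\<zero>}}"
  have "\<exists>M\<in>F. \<forall>Y\<in>F. M \<subseteq> Y \<longrightarrow> Y = M"
  proof (rule subset_Zorn_nonempty)
    have "{\<zero>} \<in> F" unfolding F_def using left_ideal_zero left_idealD(2)[OF L] by auto
    then show "F \<noteq> {}" by blast
    fix C assume C: "C \<noteq> {}" "subset.chain F C"
    then have "subset.chain {L. left_ideal R L} C" unfolding pred_on.chain_def F_def by blast
    then have U: "left_ideal R (\<Union>C)" by (rule left_ideal_Union_chain[OF C(1)])
    have "L \<inter> \<Union>C \<subseteq> {\<zero>}" using C(2) unfolding pred_on.chain_def F_def by blast
    then show "\<Union>C \<in> F" unfolding F_def using U left_idealD(2)[OF U] left_idealD(2)[OF L] by auto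
  qed
  then obtain C where CF: "C \<in> F" and max: "\<And>Y. \<lbrakk>Y \<in> F; C \<subseteq> Y\<rbrakk> \<Longrightarrow> Y = C" by blast
  have C: "left_ideal R C" "L \<inter> C = {\<zero>}" using CF unfolding F_def by auto
  note LC = left_ideal_add[OF L C(1)]
  have "N \<subseteq> L <+>\<^bsub>R\<^esub> C" if N: "N \<in> S" for N
  proof (rule ccontr)
    assume not: "\<not> N \<subseteq> L <+>\<^bsub>R\<^esub> C"
    have NL: "left_ideal R N" by (rule SL[OF N])
    have "left_ideal R (N \<inter> (L <+>\<^bsub>R\<^esub> C))" by (rule left_ideal_Int[OF NL LC(1)])
    then have z: "N \<inter> (L <+>\<^bsub>R\<^esub> C) = {\<zero>}" using S[OF N] not unfolding minimal_left_ideal_def by blast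
    note CN = left_ideal_add[OF C(1) NL]
    have "l = \<zero>" if l: "l \<in> L" "l \<in> C <+>\<^bsub>R\<^esub> N" for l
    proof -
      obtain c x where cx: "c \<in> C" "x \<in> N" "l = c \<oplus> x" using l(2) unfolding set_add_def' by blast
      have carr: "l \<in> carrier R" "c \<in> carrier R" "x \<in> carrier R"
        using cx l left_idealD(1)[OF L] left_idealD(1)[OF C(1)] left_idealD(1)[OF NL] by auto
      have "x = l \<ominus> c" using carr unfolding cx(3) by (simp add: add_minus_cancel)
      moreover have "l \<ominus> c \<in> L <+>\<^bsub>R\<^esub> C"
        using left_ideal_minus[OF LC(1)] LC(2,3) l(1) cx(1) by blast
      ultimately have "x = \<zero>" using z cx(2) by blast
      then have "l \<in> C" using cx carr by simp
      then show ?thesis using C(2) l(1) by blast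
    qed
    then have "L \<inter> (C <+>\<^bsub>R\<^esub> N) = {\<zero>}" using left_idealD(2)[OF L] left_idealD(2)[OF CN(1)] by blast
    then have "C <+>\<^bsub>R\<^esub> N \<in> F" unfolding F_def using CN(1) by simp
    then have "C <+>\<^bsub>R\<^esub> N = C" using CN(2) by (rule max)
    then show False using CN(3) LC(3) not by blast
  qed
  then have "carrier R \<subseteq> L <+>\<^bsub>R\<^esub> C" unfolding sum using sum_of_left_ideals(3)[OF SL LC(1)] by simp
  then obtain l c where lc: "l \<in> L" "c \<in> C" "\<one> = l \<oplus> c" unfolding set_add_def' by blast
  obtain y where y: "y \<in> carrier R" "l = y \<otimes> a" using lc(1) unfolding L_def by blast
  have cc: "c \<in> carrier R" using lc(2) left_idealD(1)[OF C(1)] by blast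
  have "a = a \<otimes> (y \<otimes> a \<oplus> c)" using r_one[OF a] lc(3) unfolding y(2) by metis
  also have "\<dots> = a \<otimes> y \<otimes> a \<oplus> a \<otimes> c" using a y(1) cc by (simp add: r_distr m_assoc)
  finally have eq: "a = a \<otimes> y \<otimes> a \<oplus> a \<otimes> c" .
  have ac: "a \<otimes> c \<in> C" using left_idealD(4)[OF C(1) a lc(2)] .
  have aL: "a \<in> L" unfolding L_def using l_one[OF a] by (metis imageI one_closed)
  have "a \<otimes> y \<otimes> a \<in> L" unfolding L_def using a y(1) by blast
  then have "a \<ominus> a \<otimes> y \<otimes> a \<in> L" by (rule left_ideal_minus[OF L aL])
  moreover have "a \<ominus> a \<otimes> y \<otimes> a = a \<otimes> c"
  proof -
    have "a \<ominus> a \<otimes> y \<otimes> a = (a \<otimes> y \<otimes> a \<oplus> a \<otimes> c) \<ominus> a \<otimes> y \<otimes> a" using eq by simp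
    also have "\<dots> = a \<otimes> c" using a y(1) cc by (simp add: add_minus_cancel)
    finally show ?thesis .
  qed
  ultimately have "a \<otimes> c = \<zero>" using ac C(2) by auto
  then have "a \<otimes> y \<otimes> a = a" using eq a y(1) by simp
  then show "\<exists>y\<in>carrier R. a \<otimes> y \<otimes> a = a" using y(1) by blast
qed

text \<open>The right identity of the union of a chain lies in some member of the chain, and that member is
  then equal to the union.\<close>

lemma left_ideal_maximal_member:
  assumes one: "\<And>L. left_ideal R L \<Longrightarrow> has_right_one R L"
    and F: "F \<noteq> {}" "\<And>L. L \<in> F \<Longrightarrow> left_ideal R L"
  obtains M where "M \<in> F" "\<And>Y. \<lbrakk>Y \<in> F; M \<subseteq> Y\<rbrakk> \<Longrightarrow> Y = M"
proof -
  have "\<exists>M\<in>F. \<forall>Y\<in>F. M \<subseteq> Y \<longrightarrow> Y = M"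
  proof (rule subset_Zorn_nonempty[OF F(1)])
    fix C assume C: "C \<noteq> {}" "subset.chain F C"
    then have "subset.chain {L. left_ideal R L} C" using F(2) unfolding pred_on.chain_def by auto
    then have U: "left_ideal R (\<Union>C)" by (rule left_ideal_Union_chain[OF C(1)])
    then obtain e L where e: "L \<in> C" "e \<in> L" "\<And>x. x \<in> \<Union>C \<Longrightarrow> x \<otimes> e = x"
      using one[OF U] unfolding has_right_one_def by auto
    have LF: "L \<in> F" using C(2) e(1) unfolding pred_on.chain_def by blast
    have "x \<in> L" if x: "x \<in> \<Union>C" for x
      using left_idealD(4)[OF F(2)[OF LF] left_idealD(1)[OF U x] e(2)] e(3)[OF x] by simp
    then have "\<Union>C = L" using e(1) by blast
    then show "\<Union>C \<in> F" using LF by simp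
  qed
  then show ?thesis using that by blast
qed

text \<open>Let \<open>M\<close> be maximal among the left ideals strictly below \<open>D\<close>, with right identity \<open>g\<close>. As
  \<open>x = x g + (x - x g)\<close>, the elements of \<open>D\<close> annihilated by \<open>g\<close> form a complement \<open>N\<close> of \<open>M\<close> in \<open>D\<close>, which is
  minimal because \<open>M\<close> is maximal.\<close>

lemma minimal_left_ideal_exists:
  assumes one: "\<And>L. left_ideal R L \<Longrightarrow> has_right_one R L"
    and D: "left_ideal R D" "D \<noteq> {\<zero>}"
  shows "\<exists>N. minimal_left_ideal R N \<and> N \<subseteq> D"
proof -
  have "{\<zero>} \<in> {M. left_ideal R M \<and> M \<subset> D}" using left_ideal_zero D left_idealD(2)[OF D(1)] by blast
  then obtain M where M: "left_ideal R M" "M \<subset> D"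
    and max: "\<And>Y. \<lbrakk>left_ideal R Y; Y \<subset> D; M \<subseteq> Y\<rbrakk> \<Longrightarrow> Y = M"
    using left_ideal_maximal_member[OF one, of "{M. left_ideal R M \<and> M \<subset> D}"]
    by (metis (mono_tags, lifting) empty_iff mem_Collect_eq)
  obtain g where g: "g \<in> M" "\<And>x. x \<in> M \<Longrightarrow> x \<otimes> g = x" using one[OF M(1)] unfolding has_right_one_def by blast
  have gc: "g \<in> carrier R" using left_idealD(1)[OF M(1) g(1)] .
  define N where "N = {x \<in> D. x \<otimes> g = \<zero>}"
  have N: "left_ideal R N" unfolding N_def by (rule left_ideal_annihilator[OF D(1) gc])
  have "N \<noteq> {\<zero>}"
  proof
    assume N0: "N = {\<zero>}"
    obtain x where x: "x \<in> D" "x \<notin> M" using M(2) by blast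
    have xc: "x \<in> carrier R" using left_idealD(1)[OF D(1) x(1)] .
    have xg: "x \<otimes> g \<in> M" using left_idealD(4)[OF M(1) xc g(1)] .
    have "x \<ominus> x \<otimes> g \<in> D" using left_ideal_minus[OF D(1) x(1)] xg M(2) by blast
    moreover have "(x \<ominus> x \<otimes> g) \<otimes> g = \<zero>"
      using xc gc g(2)[OF g(1)] by (simp add: minus_eq l_distr l_minus m_assoc r_neg)
    ultimately have "x \<ominus> x \<otimes> g = \<zero>" using N0 unfolding N_def by blast
    then have "x = x \<otimes> g" using xc gc by simp
    then show False using xg x(2) by simp
  qed
  moreover have "H = {\<zero>} \<or> H = N" if H: "left_ideal R H" "H \<subseteq> N" for H
  proof (rule disjCI)
    assume "H \<noteq> N"
    show "H = {\<zero>}"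
    proof (rule ccontr)
      assume "H \<noteq> {\<zero>}"
      then obtain h where h: "h \<in> H" "h \<noteq> \<zero>" using left_idealD(2)[OF H(1)] by blast
      note MH = left_ideal_add[OF M(1) H(1)]
      have "h \<notin> M" using g(2)[of h] h H(2) unfolding N_def by auto
      then have "M <+>\<^bsub>R\<^esub> H \<noteq> M" using MH(3) h(1) by blast
      moreover have "M <+>\<^bsub>R\<^esub> H \<subseteq> D"
        using left_idealD(3)[OF D(1)] M(2) H(2) unfolding N_def set_add_def' by blast
      ultimately have MHD: "M <+>\<^bsub>R\<^esub> H = D" using max[OF MH(1) _ MH(2)] by blast
      have "x \<in> H" if x: "x \<in> N" for x
      proof -
        obtain m k where mk: "m \<in> M" "k \<in> H" "x = m \<oplus> k"
          using x MHD unfolding N_def set_add_def' by blast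
        have c: "m \<in> carrier R" "k \<in> carrier R" using mk left_idealD(1)[OF M(1)] left_idealD(1)[OF H(1)] by auto
        have "k \<otimes> g = \<zero>" "x \<otimes> g = \<zero>" using mk(2) H(2) x unfolding N_def by auto
        then have "m = \<zero>" using mk(3) c gc g(2)[OF mk(1)] by (simp add: l_distr)
        then show ?thesis using mk c by simp
      qed
      then show False using \<open>H \<noteq> N\<close> H(2) by blast
    qed
  qed
  ultimately have "minimal_left_ideal R N" unfolding minimal_left_ideal_def using N by blast
  then show ?thesis unfolding N_def by blast
qed

text \<open>Let \<open>U\<close> be maximal among the direct sums of minimal left ideals, with right identity \<open>e\<close>. If \<open>U\<close>
  is not everything, the annihilator of \<open>e\<close> is nonzero, and it meets \<open>U\<close> in \<open>0\<close>. A minimal left ideal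
  in it would extend the direct sum.\<close>

theorem right_ones_imp_semisimple:
  assumes one: "\<And>L. left_ideal R L \<Longrightarrow> has_right_one R L"
  shows "semisimple_ring R"
proof -
  let ?sum = "\<lambda>S. sum_of reg S (\<lambda>N. N)"
  define indep where "indep S \<longleftrightarrow> (\<forall>N\<in>S. minimal_left_ideal R N) \<and>
    (\<forall>N\<in>S. N \<inter> ?sum (S - {N}) = {\<zero>})" for S
  have SL: "left_ideal R N" if "indep S" "N \<in> S" for S N
    using that unfolding indep_def minimal_left_ideal_def by blast
  define F where "F = ?sum ` {S. indep S}"
  have "indep {}" unfolding indep_def by simp
  then have "?sum {} \<in> F" unfolding F_def by (intro imageI) simp
  then have ne: "F \<noteq> {}" by auto
  have FL: "left_ideal R L" if "L \<in> F" for L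
  proof -
    from that obtain S where "L = ?sum S" "indep S" unfolding F_def by (elim imageE) simp
    then show ?thesis using sum_of_left_ideals(1)[OF SL[of S]] by simp
  qed
  obtain U where U: "U \<in> F" and max: "\<And>Y. \<lbrakk>Y \<in> F; U \<subseteq> Y\<rbrakk> \<Longrightarrow> Y = U"
    by (rule left_ideal_maximal_member[OF one ne FL]) blast+
  from U obtain S where S: "indep S" "U = ?sum S" unfolding F_def by (elim imageE) simp
  have UL: "left_ideal R U" unfolding S(2) by (rule sum_of_left_ideals(1)[OF SL[OF S(1)]])
  have "U = carrier R"
  proof (rule ccontr)
    assume UR: "U \<noteq> carrier R"
    obtain e where e: "e \<in> U" "\<And>x. x \<in> U \<Longrightarrow> x \<otimes> e = x" using one[OF UL] unfolding has_right_one_def by blast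
    have ec: "e \<in> carrier R" using left_idealD(1)[OF UL e(1)] .
    let ?D = "{x \<in> carrier R. x \<otimes> e = \<zero>}"
    have D: "left_ideal R ?D" by (rule left_ideal_annihilator[OF left_ideal_carrier ec])
    have "?D \<noteq> {\<zero>}"
    proof
      assume D0: "?D = {\<zero>}"
      have "(\<one> \<ominus> e) \<otimes> e = \<zero>" using ec e(2)[OF e(1)] by (simp add: minus_eq l_distr l_minus r_neg)
      then have "\<one> \<ominus> e = \<zero>" using D0 ec by blast
      then have "\<one> = e" using ec by simp
      then have "carrier R \<subseteq> U" using left_idealD(4)[OF UL _ e(1)] by (metis r_one subsetI)
      then show False using UR left_idealD(1)[OF UL] by blast
    qed
    then obtain N where N: "minimal_left_ideal R N" "N \<subseteq> ?D" using minimal_left_ideal_exists[OF one D] by blast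
    have NL: "left_ideal R N" and N0: "N \<noteq> {\<zero>}" using N(1) unfolding minimal_left_ideal_def by auto
    have NU: "x = \<zero>" if "x \<in> N" "x \<in> U" for x using that N(2) e(2)[of x] by auto
    let ?S = "insert N S"
    have S'L: "left_ideal R N'" if "N' \<in> ?S" for N' using that NL SL[OF S(1)] by blast
    have "indep ?S" unfolding indep_def
    proof (intro conjI ballI)
      show "minimal_left_ideal R N'" if "N' \<in> ?S" for N' using that N(1) S(1) unfolding indep_def by blast
      fix N' assume N': "N' \<in> ?S"
      have zN': "\<zero> \<in> N'" "\<zero> \<in> ?sum (?S - {N'})"
        using left_idealD(2)[OF S'L[OF N']] left_idealD(2)[OF sum_of_left_ideals(1)[of "?S - {N'}"]] S'L by blast+
      have "x = \<zero>" if x: "x \<in> N'" "x \<in> ?sum (?S - {N'})" for x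
      proof (cases "N' = N")
        case True
        have "?sum (?S - {N}) \<subseteq> U" unfolding S(2)
          by (rule sum_of_left_ideals(3))
             (use S'L SL[OF S(1)] sum_of_left_ideals(1,2)[OF SL[OF S(1)]] in auto)
        then show ?thesis using x NU True by blast
      next
        case False
        then have N'S: "N' \<in> S" using N' by blast
        let ?T = "?sum (S - {N'})"
        have SN: "left_ideal R N''" if "N'' \<in> S - {N'}" for N'' using SL[OF S(1)] that by blast
        have T: "left_ideal R ?T" "\<And>N''. N'' \<in> S - {N'} \<Longrightarrow> N'' \<subseteq> ?T"
          by (rule sum_of_left_ideals(1)[OF SN], assumption) (rule sum_of_left_ideals(2)[OF SN])
        have TU: "?T \<subseteq> U" unfolding S(2)
          by (rule sum_of_left_ideals(3)[OF SN])
             (use sum_of_left_ideals(1,2)[OF SL[OF S(1)]] in auto)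
        note TN = left_ideal_add[OF T(1) NL]
        have "?sum (?S - {N'}) \<subseteq> ?T <+>\<^bsub>R\<^esub> N"
        proof (rule sum_of_left_ideals(3)[OF _ TN(1)])
          show "left_ideal R N''" if "N'' \<in> ?S - {N'}" for N'' using that S'L by blast
          show "N'' \<subseteq> ?T <+>\<^bsub>R\<^esub> N" if "N'' \<in> ?S - {N'}" for N''
            using that TN(2,3) T(2)[of N''] by blast
        qed
        then obtain s k where sk: "s \<in> ?T" "k \<in> N" "x = s \<oplus> k" using x(2) unfolding set_add_def' by blast
        have c: "s \<in> carrier R" "k \<in> carrier R" using sk left_idealD(1)[OF T(1)] left_idealD(1)[OF NL] by auto
        have "x \<in> U" using x(1) sum_of_left_ideals(2)[OF SL[OF S(1)] N'S] unfolding S(2) by blast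
        then have "x \<ominus> s \<in> U" using left_ideal_minus[OF UL] sk(1) TU by blast
        moreover have "x \<ominus> s = k" unfolding sk(3) using c by (simp add: add_minus_cancel)
        ultimately have "k = \<zero>" using NU sk(2) by blast
        then have "x \<in> ?T" using sk c by simp
        then show ?thesis using S(1) N'S x(1) unfolding indep_def by blast
      qed
      then show "N' \<inter> ?sum (?S - {N'}) = {\<zero>}" using zN' by blast
    qed
    then have "?sum ?S \<in> F" unfolding F_def by (intro imageI) simp
    moreover have "U \<subseteq> ?sum ?S" unfolding S(2)
    proof (rule sum_of_left_ideals(3)[OF SL[OF S(1)]])
      show "left_ideal R (?sum ?S)" by (rule sum_of_left_ideals(1)[OF S'L])
      show "N' \<subseteq> ?sum ?S" if "N' \<in> S" for N'
        by (rule sum_of_left_ideals(2)[OF S'L]) (simp_all add: that)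
    qed
    ultimately have "?sum ?S = U" by (rule max)
    moreover have "N \<subseteq> ?sum ?S" by (rule sum_of_left_ideals(2)[OF S'L]) simp_all
    ultimately have "N \<subseteq> U" by simp
    then show False using NU N0 left_idealD(2)[OF NL] by blast
  qed
  then have "is_direct_sum reg S (\<lambda>N. N)" using S unfolding is_direct_sum_def indep_def by simp
  then show ?thesis using S(1) unfolding semisimple_ring_iff indep_def by blast
qed

text \<open>Let \<open>e\<close> be a right identity of \<open>L \<inter> I0\<close> and let \<open>K\<close> be the left ideal of all \<open>x \<in> L\<close> with \<open>x e = 0\<close>,
  so that \<open>x - x e \<in> K\<close> for all \<open>x \<in> L\<close>. An element \<open>y\<close> of \<open>K\<close> that is a right identity of \<open>K\<close> modulo \<open>I0\<close>
  is one outright: for \<open>x \<in> K\<close> the difference \<open>x y - x\<close> lies in \<open>L \<inter> I0\<close>, so it is fixed by \<open>e\<close>, but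
  it is also annihilated by \<open>e\<close>. Now \<open>e + y - e y\<close> is a right identity of \<open>L\<close>.\<close>

lemma right_one_step:
  assumes I0: "left_ideal R I0"
    and Q0: "\<And>L. \<lbrakk>left_ideal R L; L \<subseteq> I0\<rbrakk> \<Longrightarrow> has_right_one R L"
    and mod: "\<And>L. \<lbrakk>left_ideal R L; L \<subseteq> I1\<rbrakk> \<Longrightarrow> \<exists>y\<in>L. \<forall>x\<in>L. x \<otimes> y \<ominus> x \<in> I0"
    and L: "left_ideal R L" "L \<subseteq> I1"
  shows "has_right_one R L"
proof -
  have "left_ideal R (L \<inter> I0)" by (rule left_ideal_Int[OF L(1) I0])
  then obtain e where e: "e \<in> L" "e \<in> I0" "\<And>x. \<lbrakk>x \<in> L; x \<in> I0\<rbrakk> \<Longrightarrow> x \<otimes> e = x"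
    using Q0[of "L \<inter> I0"] unfolding has_right_one_def by blast
  have ec: "e \<in> carrier R" and ee: "e \<otimes> e = e" using left_idealD(1)[OF L(1) e(1)] e(3)[OF e(1,2)] .
  let ?K = "{x \<in> L. x \<otimes> e = \<zero>}"
  have K: "left_ideal R ?K" by (rule left_ideal_annihilator[OF L(1) ec])
  obtain y where y: "y \<in> L" "y \<otimes> e = \<zero>" and ymod: "\<And>x. x \<in> ?K \<Longrightarrow> x \<otimes> y \<ominus> x \<in> I0"
    using mod[OF K] L(2) by blast
  have yc: "y \<in> carrier R" using left_idealD(1)[OF L(1) y(1)] .
  have ky: "x \<otimes> y = x" if x: "x \<in> L" "x \<otimes> e = \<zero>" for x
  proof -
    have xc: "x \<in> carrier R" using left_idealD(1)[OF L(1) x(1)] .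
    have "x \<otimes> y \<ominus> x \<in> L" using left_ideal_minus[OF L(1) left_idealD(4)[OF L(1) xc y(1)] x(1)] .
    then have "x \<otimes> y \<ominus> x = (x \<otimes> y \<ominus> x) \<otimes> e" using e(3) ymod x by simp
    also have "\<dots> = \<zero>" using xc yc ec x(2) y(2) by (simp add: minus_eq l_distr l_minus m_assoc)
    finally show ?thesis using xc yc by simp
  qed
  let ?e = "e \<oplus> (y \<ominus> e \<otimes> y)"
  have "?e \<in> L" using L(1) e(1) y(1) ec by (intro left_idealD(3) left_ideal_minus left_idealD(4))
  moreover have "x \<otimes> ?e = x" if x: "x \<in> L" for x
  proof -
    have xc: "x \<in> carrier R" using left_idealD(1)[OF L(1) x] .
    have xe: "x \<ominus> x \<otimes> e \<in> L" using left_ideal_minus[OF L(1) x left_idealD(4)[OF L(1) xc e(1)]] .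
    have "(x \<ominus> x \<otimes> e) \<otimes> e = \<zero>" using xc ec ee by (simp add: minus_eq l_distr l_minus m_assoc r_neg)
    then have "(x \<ominus> x \<otimes> e) \<otimes> y = x \<ominus> x \<otimes> e" by (rule ky[OF xe])
    moreover have "x \<otimes> ?e = x \<otimes> e \<oplus> (x \<ominus> x \<otimes> e) \<otimes> y"
      using xc ec yc by (simp add: minus_eq l_distr r_distr l_minus r_minus m_assoc)
    ultimately have "x \<otimes> ?e = x \<otimes> e \<oplus> (x \<ominus> x \<otimes> e)" by simp
    also have "\<dots> = x" using xc ec by (simp add: add_minus_cancel)
    finally show ?thesis .
  qed
  ultimately show ?thesis unfolding has_right_one_def by blast
qed

end

section \<open>Twisted matrix rings as layers\<close>

text \<open>One layer \<open>J0 \<subseteq> J1\<close> of a chain of ideals, in coordinates: \<open>\<mu>\<close> identifies \<open>J1 / J0\<close> with the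
  \<open>n \<times> n\<close> matrices over \<open>B\<close>, in such a way that multiplication becomes \<open>X \<Phi> Y\<close>.\<close>

locale matrix_layer =
  fixes A :: "('a, 'y) ring_scheme" and J0 J1 :: "'a set" and B :: "('b, 'z) ring_scheme" and n :: nat
    and \<Phi> :: "nat \<times> nat \<Rightarrow> 'b" and \<mu> :: "'a \<Rightarrow> nat \<times> nat \<Rightarrow> 'b"
  assumes J0: "ideal J0 A" and J1: "ideal J1 A" and J01: "J0 \<subseteq> J1" and B: "cring B"
    and form_closed: "\<Phi> \<in> carrier (matrix_ring B n)"
    and mu_closed: "x \<in> J1 \<Longrightarrow> \<mu> x \<in> carrier (matrix_ring B n)"
    and mu_onto: "C \<in> carrier (matrix_ring B n) \<Longrightarrow> \<exists>x\<in>J1. \<mu> x = C"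
    and mu_add: "\<lbrakk>x \<in> J1; y \<in> J1\<rbrakk> \<Longrightarrow> \<mu> (x \<oplus>\<^bsub>A\<^esub> y) = \<mu> x \<oplus>\<^bsub>matrix_ring B n\<^esub> \<mu> y"
    and mu_zero_iff: "x \<in> J1 \<Longrightarrow> \<mu> x = \<zero>\<^bsub>matrix_ring B n\<^esub> \<longleftrightarrow> x \<in> J0"
    and mu_mult: "\<lbrakk>x \<in> J1; y \<in> J1\<rbrakk> \<Longrightarrow>
      \<mu> (x \<otimes>\<^bsub>A\<^esub> y) = \<mu> x \<otimes>\<^bsub>matrix_ring B n\<^esub> \<Phi> \<otimes>\<^bsub>matrix_ring B n\<^esub> \<mu> y"
begin

abbreviation "M \<equiv> matrix_ring B n"

lemma M_ring: "ring M" by (rule matrix_ring_is_ring[OF B])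

text \<open>Regularity is inherited by the ideal \<open>J1\<close>: if \<open>x = x y x\<close>, then also \<open>x = x (y x y) x\<close>, where
  \<open>y x y\<close> lies in \<open>J1\<close> together with \<open>x\<close>.\<close>

lemma regular_twisted:
  assumes reg: "vn_regular A" and C: "C \<in> carrier M"
  shows "\<exists>D\<in>carrier M. C = C \<otimes>\<^bsub>M\<^esub> (\<Phi> \<otimes>\<^bsub>M\<^esub> D \<otimes>\<^bsub>M\<^esub> \<Phi>) \<otimes>\<^bsub>M\<^esub> C"
proof -
  interpret M: ring M by (rule M_ring)
  interpret J1: ideal J1 A by (rule J1)
  obtain x where x: "x \<in> J1" "\<mu> x = C" using mu_onto[OF C] by blast
  then have xA: "x \<in> carrier A" using J1.a_Hcarr by blast
  then obtain y where y: "y \<in> carrier A" "x \<otimes>\<^bsub>A\<^esub> y \<otimes>\<^bsub>A\<^esub> x = x" using reg unfolding vn_regular_def by blast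
  let ?z = "y \<otimes>\<^bsub>A\<^esub> x \<otimes>\<^bsub>A\<^esub> y"
  have z: "?z \<in> J1" using J1.I_l_closed[OF x(1) y(1)] J1.I_r_closed y(1) by blast
  have xz: "x \<otimes>\<^bsub>A\<^esub> ?z \<in> J1" using J1.I_l_closed[OF z xA] .
  have "x \<otimes>\<^bsub>A\<^esub> ?z \<otimes>\<^bsub>A\<^esub> x = (x \<otimes>\<^bsub>A\<^esub> y \<otimes>\<^bsub>A\<^esub> x) \<otimes>\<^bsub>A\<^esub> y \<otimes>\<^bsub>A\<^esub> x" using xA y(1) by (simp add: J1.m_assoc)
  then have "x = x \<otimes>\<^bsub>A\<^esub> ?z \<otimes>\<^bsub>A\<^esub> x" using y(2) by simp
  then have "C = C \<otimes>\<^bsub>M\<^esub> \<Phi> \<otimes>\<^bsub>M\<^esub> \<mu> ?z \<otimes>\<^bsub>M\<^esub> \<Phi> \<otimes>\<^bsub>M\<^esub> C"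
    using mu_mult[OF xz x(1)] mu_mult[OF x(1) z] x(2) by simp
  then show ?thesis using C mu_closed[OF z] form_closed
    by (intro bexI[of _ "\<mu> ?z"]) (simp_all add: M.m_assoc)
qed

text \<open>For \<open>C = 1\<close> the previous lemma gives \<open>1 = \<Phi> D \<Phi>\<close>, so \<open>\<Phi>\<close> has the left inverse \<open>\<Phi> D\<close> and the
  right inverse \<open>D \<Phi>\<close>, which must agree.\<close>

theorem vn_regular_imp_form_invertible:
  assumes reg: "vn_regular A" shows "\<Phi> \<in> Units M"
proof -
  interpret M: ring M by (rule M_ring)
  obtain D where D: "D \<in> carrier M" and eq: "\<one>\<^bsub>M\<^esub> = \<one>\<^bsub>M\<^esub> \<otimes>\<^bsub>M\<^esub> (\<Phi> \<otimes>\<^bsub>M\<^esub> D \<otimes>\<^bsub>M\<^esub> \<Phi>) \<otimes>\<^bsub>M\<^esub> \<one>\<^bsub>M\<^esub>"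
    using regular_twisted[OF reg M.one_closed] by blast
  have 1: "(\<Phi> \<otimes>\<^bsub>M\<^esub> D) \<otimes>\<^bsub>M\<^esub> \<Phi> = \<one>\<^bsub>M\<^esub>" "\<Phi> \<otimes>\<^bsub>M\<^esub> (D \<otimes>\<^bsub>M\<^esub> \<Phi>) = \<one>\<^bsub>M\<^esub>"
    using eq D form_closed by (simp_all add: M.m_assoc)
  have "\<Phi> \<otimes>\<^bsub>M\<^esub> D = (\<Phi> \<otimes>\<^bsub>M\<^esub> D) \<otimes>\<^bsub>M\<^esub> (\<Phi> \<otimes>\<^bsub>M\<^esub> (D \<otimes>\<^bsub>M\<^esub> \<Phi>))" using 1(2) D form_closed by simp
  also have "\<dots> = (\<Phi> \<otimes>\<^bsub>M\<^esub> D \<otimes>\<^bsub>M\<^esub> \<Phi>) \<otimes>\<^bsub>M\<^esub> (D \<otimes>\<^bsub>M\<^esub> \<Phi>)" using D form_closed by (simp add: M.m_assoc)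
  also have "\<dots> = D \<otimes>\<^bsub>M\<^esub> \<Phi>" using 1(1) D form_closed by simp
  finally have "\<Phi> \<otimes>\<^bsub>M\<^esub> (\<Phi> \<otimes>\<^bsub>M\<^esub> D) = \<one>\<^bsub>M\<^esub>" using 1(2) by simp
  then show ?thesis unfolding Units_def using 1(1) D form_closed by blast
qed

text \<open>For the matrix \<open>C\<close> whose only entry is \<open>b\<close>, in position \<open>(1, 1)\<close>, the product \<open>C E C\<close> has the
  entry \<open>b E\<^sub>1\<^sub>1 b\<close> in that position.\<close>

theorem vn_regular_imp_base_regular:
  assumes reg: "vn_regular A" and n: "1 \<le> n" shows "vn_regular B"
  unfolding vn_regular_def
proof
  fix b assume b: "b \<in> carrier B"
  interpret B: cring B by (rule B)
  interpret M: ring M by (rule M_ring)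
  have 1: "1 \<in> {1..n}" using n by simp
  let ?C = "matrix_unit B n 1 1 b"
  have C: "?C \<in> carrier M" using matrix_unit_closed[OF B b] .
  obtain D where D: "D \<in> carrier M" and eq: "?C = ?C \<otimes>\<^bsub>M\<^esub> (\<Phi> \<otimes>\<^bsub>M\<^esub> D \<otimes>\<^bsub>M\<^esub> \<Phi>) \<otimes>\<^bsub>M\<^esub> ?C"
    using regular_twisted[OF reg C] by blast
  let ?E = "\<Phi> \<otimes>\<^bsub>M\<^esub> D \<otimes>\<^bsub>M\<^esub> \<Phi>"
  have E: "?E \<in> carrier M" using D form_closed by simp
  have e: "?E (1, 1) \<in> carrier B" by (rule matrix_entry_closed[OF B E 1 1])
  have "?C (1, 1) = b" unfolding matrix_unit_def using 1 by simp
  moreover have "(?C \<otimes>\<^bsub>M\<^esub> ?E \<otimes>\<^bsub>M\<^esub> ?C) (1, 1) = (?C \<otimes>\<^bsub>M\<^esub> ?E) (1, 1) \<otimes>\<^bsub>B\<^esub> b"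
    using matrix_unit_mult_right[OF B 1 1 b M.m_closed[OF C E] 1 1] by simp
  moreover have "(?C \<otimes>\<^bsub>M\<^esub> ?E) (1, 1) = b \<otimes>\<^bsub>B\<^esub> ?E (1, 1)"
    using matrix_unit_mult_left[OF B 1 1 b E 1 1] by simp
  ultimately have "b \<otimes>\<^bsub>B\<^esub> ?E (1, 1) \<otimes>\<^bsub>B\<^esub> b = b" using eq by metis
  then show "\<exists>c\<in>carrier B. b \<otimes>\<^bsub>B\<^esub> c \<otimes>\<^bsub>B\<^esub> b = b" using e by blast
qed

end

lemma (in cring) left_ideal_imp_ideal:
  assumes "left_ideal R I" shows "ideal I R"
proof (rule idealI[OF ring_axioms])
  note D = left_idealD[OF assms]
  show "subgroup I (add_monoid R)"
    by (rule add.subgroupI) (use D left_ideal_uminus[OF assms] in \<open>auto simp: a_inv_def\<close>)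
  show "x \<otimes> a \<in> I" if "a \<in> I" "x \<in> carrier R" for a x using D(4) that by blast
  show "a \<otimes> x \<in> I" if "a \<in> I" "x \<in> carrier R" for a x
    unfolding m_comm[OF D(1)[OF that(1)] that(2)] by (rule D(4)[OF that(2,1)])
qed

lemma matrix_mult_zero_column:
  assumes B: "cring B" and C: "C \<in> carrier (matrix_ring B n)" and i: "i \<in> {1..n}" and l: "l \<in> {1..n}"
    and z: "\<And>p. p \<in> {1..n} \<Longrightarrow> D (p, l) = \<zero>\<^bsub>B\<^esub>"
  shows "(C \<otimes>\<^bsub>matrix_ring B n\<^esub> D) (i, l) = \<zero>\<^bsub>B\<^esub>"
proof -
  interpret B: cring B by (rule B)
  show ?thesis unfolding matrix_mult_entry[OF B i l]
    by (rule B.add.finprod_one_eqI) (use z matrix_entry_closed[OF B C i] in simp)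
qed

context matrix_layer
begin

lemma mu_minus_zero:
  assumes x: "x \<in> J1" and y: "y \<in> J1" and i: "i \<in> {1..n}" and l: "l \<in> {1..n}" and eq: "\<mu> x (i, l) = \<mu> y (i, l)"
  shows "\<mu> (x \<ominus>\<^bsub>A\<^esub> y) (i, l) = \<zero>\<^bsub>B\<^esub>"
proof -
  interpret B: cring B by (rule B)
  interpret A: ring A by (rule ideal.axioms(2)[OF J1])
  interpret J1: ideal J1 A by (rule J1)
  have xy: "x \<ominus>\<^bsub>A\<^esub> y \<in> J1" using x y by (simp add: A.minus_eq)
  have c: "x \<in> carrier A" "y \<in> carrier A" using x y J1.a_Hcarr by auto
  have "\<mu> x = \<mu> (x \<ominus>\<^bsub>A\<^esub> y) \<oplus>\<^bsub>M\<^esub> \<mu> y"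
    using mu_add[OF xy y] c by (simp add: A.minus_eq A.a_assoc A.l_neg)
  then have "\<mu> y (i, l) = \<mu> (x \<ominus>\<^bsub>A\<^esub> y) (i, l) \<oplus>\<^bsub>B\<^esub> \<mu> y (i, l)"
    using matrix_add_entry[OF B i l] eq by simp
  then show ?thesis
    using matrix_entry_closed[OF B mu_closed[OF xy] i l] matrix_entry_closed[OF B mu_closed[OF y] i l]
    by (metis B.add.r_cancel_one')
qed

lemma mu_eqI:
  assumes x: "x \<in> J1" and y: "y \<in> J1" and d: "x \<ominus>\<^bsub>A\<^esub> y \<in> J0" shows "\<mu> x = \<mu> y"
proof -
  interpret M: ring M by (rule M_ring)
  interpret A: ring A by (rule ideal.axioms(2)[OF J1])
  interpret J1: ideal J1 A by (rule J1)
  have xy: "x \<ominus>\<^bsub>A\<^esub> y \<in> J1" using x y by (simp add: A.minus_eq)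
  have c: "x \<in> carrier A" "y \<in> carrier A" using x y J1.a_Hcarr by auto
  have "\<mu> x = \<mu> (x \<ominus>\<^bsub>A\<^esub> y) \<oplus>\<^bsub>M\<^esub> \<mu> y"
    using mu_add[OF xy y] c by (simp add: A.minus_eq A.a_assoc A.l_neg)
  moreover have "\<mu> (x \<ominus>\<^bsub>A\<^esub> y) = \<zero>\<^bsub>M\<^esub>" using mu_zero_iff[OF xy] d by simp
  ultimately show ?thesis using mu_closed[OF y] by simp
qed

text \<open>These left ideals interpolate between \<open>J0\<close>, for \<open>k = 0\<close>, and \<open>J1\<close>, for \<open>k = n\<close>. The \<open>k\<close>-th column
  identifies each successive quotient with \<open>B\<^sup>n\<close>.\<close>

definition columns :: "nat \<Rightarrow> 'a set" where
  "columns k = {x \<in> J1. \<forall>i\<in>{1..n}. \<forall>l\<in>{1..n}. k < l \<longrightarrow> \<mu> x (i, l) = \<zero>\<^bsub>B\<^esub>}"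

lemma columns_0: "columns 0 = J0"
proof -
  interpret M: ring M by (rule M_ring)
  have "x \<in> J0" if x: "x \<in> J1" and z: "\<And>i l. i \<in> {1..n} \<Longrightarrow> l \<in> {1..n} \<Longrightarrow> 0 < l \<Longrightarrow> \<mu> x (i, l) = \<zero>\<^bsub>B\<^esub>" for x
  proof -
    have "\<mu> x = \<zero>\<^bsub>M\<^esub>"
      by (rule matrix_eqI[OF B mu_closed[OF x] M.zero_closed]) (use z in \<open>simp add: matrix_zero_one_entry[OF B]\<close>)
    then show ?thesis using mu_zero_iff[OF x] by simp
  qed
  moreover have "x \<in> J1 \<and> (\<forall>i\<in>{1..n}. \<forall>l\<in>{1..n}. \<mu> x (i, l) = \<zero>\<^bsub>B\<^esub>)" if x: "x \<in> J0" for x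
  proof -
    have x1: "x \<in> J1" using x J01 by blast
    then have "\<mu> x = \<zero>\<^bsub>M\<^esub>" using mu_zero_iff x by blast
    then show ?thesis using x1 matrix_zero_one_entry(1)[OF B] by simp
  qed
  ultimately show ?thesis unfolding columns_def by auto
qed

lemma columns_mono: "k \<le> k' \<Longrightarrow> columns k \<subseteq> columns k'"
  unfolding columns_def by auto

lemma columns_n: "columns n = J1" unfolding columns_def by auto

text \<open>If \<open>\<Phi>\<close> has a left inverse \<open>\<Psi>\<close>, then ordinary multiplication by any matrix \<open>C\<close> is realised by the
  action of an element of \<open>J1\<close>, namely one with the matrix \<open>C \<Psi>\<close>.\<close>

lemma mu_mult_inverse:
  assumes P: "\<Psi> \<in> carrier M" "\<Psi> \<otimes>\<^bsub>M\<^esub> \<Phi> = \<one>\<^bsub>M\<^esub>"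
    and x: "x \<in> J1" and C: "C \<in> carrier M" and z: "z \<in> J1" "\<mu> z = C \<otimes>\<^bsub>M\<^esub> \<Psi>"
  shows "\<mu> (z \<otimes>\<^bsub>A\<^esub> x) = C \<otimes>\<^bsub>M\<^esub> \<mu> x"
proof -
  interpret M: ring M by (rule M_ring)
  have "\<mu> (z \<otimes>\<^bsub>A\<^esub> x) = C \<otimes>\<^bsub>M\<^esub> (\<Psi> \<otimes>\<^bsub>M\<^esub> \<Phi>) \<otimes>\<^bsub>M\<^esub> \<mu> x"
    using mu_mult[OF z(1) x] z(2) P(1) C form_closed by (simp add: M.m_assoc)
  then show ?thesis using P(2) C by simp
qed

text \<open>An element \<open>u\<close> with matrix \<open>\<Psi>\<close> is a left identity of \<open>J1\<close> modulo \<open>J0\<close>. So \<open>a x\<close> is congruent to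
  \<open>(a u) x\<close>, whose matrix is the product of some matrix and \<open>\<mu> x\<close>.\<close>

lemma columns_left_ideal:
  assumes P: "\<Psi> \<in> carrier M" "\<Psi> \<otimes>\<^bsub>M\<^esub> \<Phi> = \<one>\<^bsub>M\<^esub>"
  shows "left_ideal A (columns k)"
proof -
  interpret B: cring B by (rule B)
  interpret M: ring M by (rule M_ring)
  interpret A: ring A by (rule ideal.axioms(2)[OF J1])
  interpret J1: ideal J1 A by (rule J1)
  have c: "x \<in> carrier A" if "x \<in> J1" for x using that J1.a_Hcarr by blast
  from mu_onto[OF P(1)] obtain u where u: "u \<in> J1" "\<mu> u = \<Psi>" by (elim bexE)
  have mu_left: "\<mu> (a \<otimes>\<^bsub>A\<^esub> x) = \<mu> (a \<otimes>\<^bsub>A\<^esub> u) \<otimes>\<^bsub>M\<^esub> \<Phi> \<otimes>\<^bsub>M\<^esub> \<mu> x" if a: "a \<in> carrier A" and x: "x \<in> J1" for a x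
  proof -
    have ux: "u \<otimes>\<^bsub>A\<^esub> x \<in> J1" "a \<otimes>\<^bsub>A\<^esub> (u \<otimes>\<^bsub>A\<^esub> x) \<in> J1" "a \<otimes>\<^bsub>A\<^esub> x \<in> J1" "a \<otimes>\<^bsub>A\<^esub> u \<in> J1"
      by (intro J1.I_l_closed u(1) x a c)+
    have "\<mu> (u \<otimes>\<^bsub>A\<^esub> x) = \<one>\<^bsub>M\<^esub> \<otimes>\<^bsub>M\<^esub> \<mu> x"
      by (rule mu_mult_inverse[OF P x M.one_closed u(1)]) (use u(2) P(1) in simp)
    then have eq: "\<mu> (u \<otimes>\<^bsub>A\<^esub> x) = \<mu> x" using mu_closed[OF x] by simp
    have d: "u \<otimes>\<^bsub>A\<^esub> x \<ominus>\<^bsub>A\<^esub> x \<in> J1" using ux(1) x by (simp add: A.minus_eq)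
    have "\<mu> (u \<otimes>\<^bsub>A\<^esub> x \<ominus>\<^bsub>A\<^esub> x) = \<zero>\<^bsub>M\<^esub>"
      by (rule matrix_eqI[OF B mu_closed[OF d] M.zero_closed])
         (simp only: mu_minus_zero[OF ux(1) x] eq matrix_zero_one_entry(1)[OF B])
    then have "u \<otimes>\<^bsub>A\<^esub> x \<ominus>\<^bsub>A\<^esub> x \<in> J0" using mu_zero_iff[OF d] by simp
    then have "a \<otimes>\<^bsub>A\<^esub> (u \<otimes>\<^bsub>A\<^esub> x \<ominus>\<^bsub>A\<^esub> x) \<in> J0" using ideal.I_l_closed[OF J0] a by blast
    moreover have "a \<otimes>\<^bsub>A\<^esub> (u \<otimes>\<^bsub>A\<^esub> x \<ominus>\<^bsub>A\<^esub> x) = a \<otimes>\<^bsub>A\<^esub> (u \<otimes>\<^bsub>A\<^esub> x) \<ominus>\<^bsub>A\<^esub> a \<otimes>\<^bsub>A\<^esub> x"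
      using a c[OF x] c[OF u(1)] by (simp add: A.minus_eq A.r_distr A.r_minus)
    ultimately have "\<mu> (a \<otimes>\<^bsub>A\<^esub> (u \<otimes>\<^bsub>A\<^esub> x)) = \<mu> (a \<otimes>\<^bsub>A\<^esub> x)" using mu_eqI[OF ux(2,3)] by simp
    moreover have "a \<otimes>\<^bsub>A\<^esub> (u \<otimes>\<^bsub>A\<^esub> x) = (a \<otimes>\<^bsub>A\<^esub> u) \<otimes>\<^bsub>A\<^esub> x"
      using a c[OF x] c[OF u(1)] by (simp add: A.m_assoc)
    ultimately show ?thesis using mu_mult[OF ux(4) x] by simp
  qed
  show ?thesis unfolding left_ideal_def
  proof (intro conjI ballI)
    show "columns k \<subseteq> carrier A" unfolding columns_def using c by blast
    have z: "\<zero>\<^bsub>A\<^esub> \<in> J0" by (rule additive_subgroup.zero_closed[OF ideal.axioms(1)[OF J0]])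
    then show "\<zero>\<^bsub>A\<^esub> \<in> columns k" using columns_mono[of 0 k] columns_0 by auto
    fix x assume x: "x \<in> columns k"
    then have x1: "x \<in> J1" unfolding columns_def by blast
    show "x \<oplus>\<^bsub>A\<^esub> y \<in> columns k" if "y \<in> columns k" for y
      using that x unfolding columns_def by (simp add: mu_add matrix_add_entry[OF B])
    show "a \<otimes>\<^bsub>A\<^esub> x \<in> columns k" if a: "a \<in> carrier A" for a
    proof -
      have au: "a \<otimes>\<^bsub>A\<^esub> u \<in> J1" using J1.I_l_closed[OF u(1) a] .
      have "\<mu> (a \<otimes>\<^bsub>A\<^esub> x) (i, l) = \<zero>\<^bsub>B\<^esub>" if "i \<in> {1..n}" "l \<in> {1..n}" "k < l" for i l
        unfolding mu_left[OF a x1]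
        by (rule matrix_mult_zero_column[OF B])
           (use that x mu_closed[OF au] form_closed in \<open>auto simp: columns_def\<close>)
      then show ?thesis unfolding columns_def using J1.I_l_closed[OF x1 a] by blast
    qed
  qed
qed

text \<open>By \<open>right_one_step\<close> the \<open>k\<close>-th column can be treated on its own. Let \<open>L\<close> be a left ideal of elements
  supported in the first \<open>c = k + 1\<close> columns. As ordinary matrices act, the entries in column \<open>c\<close> of all
  \<open>\<mu> x\<close>, \<open>x \<in> L\<close>, form an ideal \<open>b\<close> of \<open>B\<close>, and already the entries in position \<open>(1, c)\<close> exhaust it. Let \<open>e\<close>
  be its identity, and let \<open>y \<in> L\<close> be such that \<open>\<Phi> \<mu> y\<close> has the column \<open>c\<close> equal to \<open>e\<close> times the
  \<open>c\<close>-th unit vector. Then the column \<open>c\<close> of \<open>\<mu> (x y) = \<mu> x \<Phi> \<mu> y\<close> is \<open>e\<close> times the one of \<open>\<mu> x\<close>, which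
  is the latter itself.\<close>

theorem right_ones_lift:
  assumes inv: "\<Phi> \<in> Units M"
    and ones: "\<And>I. ideal I B \<Longrightarrow> \<exists>e\<in>I. \<forall>b\<in>I. b \<otimes>\<^bsub>B\<^esub> e = b"
    and Q0: "\<And>L. \<lbrakk>left_ideal A L; L \<subseteq> J0\<rbrakk> \<Longrightarrow> has_right_one A L"
    and L: "left_ideal A L" "L \<subseteq> J1"
  shows "has_right_one A L"
proof -
  interpret B: cring B by (rule B)
  interpret M: ring M by (rule M_ring)
  interpret A: ring A by (rule ideal.axioms(2)[OF J1])
  interpret J1: ideal J1 A by (rule J1)
  obtain \<Psi> where P: "\<Psi> \<in> carrier M" "\<Psi> \<otimes>\<^bsub>M\<^esub> \<Phi> = \<one>\<^bsub>M\<^esub>" "\<Phi> \<otimes>\<^bsub>M\<^esub> \<Psi> = \<one>\<^bsub>M\<^esub>"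
    using inv unfolding Units_def by blast
  have "has_right_one A L" if "k \<le> n" "left_ideal A L" "L \<subseteq> columns k" for k L
    using that
  proof (induct k arbitrary: L)
    case 0
    then show ?case using Q0 columns_0 by simp
  next
    case (Suc k)
    let ?c = "Suc k"
    have c: "?c \<in> {1..n}" and 1: "1 \<in> {1..n}" using Suc(2) by auto
    show ?case
    proof (rule A.right_one_step[OF columns_left_ideal[OF P(1,2), of k] _ _ Suc(3,4)])
      show "has_right_one A L" if "left_ideal A L" "L \<subseteq> columns k" for L
        using Suc(1)[OF _ that] Suc(2) by simp
      fix L assume L: "left_ideal A L" and Lc: "L \<subseteq> columns ?c"
      note D = left_idealD[OF L]
      have LJ: "x \<in> J1" if "x \<in> L" for x using that Lc unfolding columns_def by blast
      have ec: "\<mu> x (i, l) \<in> carrier B" if "x \<in> L" "i \<in> {1..n}" "l \<in> {1..n}" for x i l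
        using matrix_entry_closed[OF B mu_closed[OF LJ]] that by blast
      have act: "\<exists>y\<in>L. \<mu> y = C \<otimes>\<^bsub>M\<^esub> \<mu> x" if x: "x \<in> L" and C: "C \<in> carrier M" for x C
      proof -
        obtain z where z: "z \<in> J1" "\<mu> z = C \<otimes>\<^bsub>M\<^esub> \<Psi>" using mu_onto[OF M.m_closed[OF C P(1)]] by blast
        have "z \<otimes>\<^bsub>A\<^esub> x \<in> L" by (rule D(4)[OF J1.a_Hcarr[OF z(1)] x])
        then show ?thesis using mu_mult_inverse[OF P(1,2) LJ[OF x] C z] by blast
      qed
      define b where "b = (\<lambda>x. \<mu> x (1, ?c)) ` L"
      have row: "\<exists>y\<in>L. \<mu> y (1, ?c) = r \<otimes>\<^bsub>B\<^esub> \<mu> x (i, ?c)" if x: "x \<in> L" and i: "i \<in> {1..n}" and r: "r \<in> carrier B" for x i r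
      proof -
        from act[OF x matrix_unit_closed[OF B r]]
        obtain y where y: "y \<in> L" "\<mu> y = matrix_unit B n 1 i r \<otimes>\<^bsub>M\<^esub> \<mu> x" by blast
        have "\<mu> y (1, ?c) = r \<otimes>\<^bsub>B\<^esub> \<mu> x (i, ?c)"
          unfolding y(2) using matrix_unit_mult_left[OF B 1 i r mu_closed[OF LJ[OF x]] 1 c] by simp
        then show ?thesis using y(1) by blast
      qed
      have "left_ideal B b" unfolding left_ideal_def
      proof (intro conjI ballI)
        show "b \<subseteq> carrier B" unfolding b_def using ec 1 c by blast
        have "\<zero>\<^bsub>B\<^esub> = \<zero>\<^bsub>B\<^esub> \<otimes>\<^bsub>B\<^esub> \<mu> \<zero>\<^bsub>A\<^esub> (1, ?c)" using ec[OF D(2) 1 c] by simp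
        then show "\<zero>\<^bsub>B\<^esub> \<in> b" unfolding b_def using row[OF D(2) 1 B.zero_closed] by force
        fix s assume "s \<in> b"
        then obtain x where x: "x \<in> L" "s = \<mu> x (1, ?c)" unfolding b_def by blast
        show "s \<oplus>\<^bsub>B\<^esub> t \<in> b" if "t \<in> b" for t
        proof -
          obtain y where y: "y \<in> L" "t = \<mu> y (1, ?c)" using \<open>t \<in> b\<close> unfolding b_def by blast
          have "s \<oplus>\<^bsub>B\<^esub> t = \<mu> (x \<oplus>\<^bsub>A\<^esub> y) (1, ?c)"
            using mu_add[OF LJ[OF x(1)] LJ[OF y(1)]] matrix_add_entry[OF B 1 c] x(2) y(2) by simp
          then show ?thesis unfolding b_def using D(3)[OF x(1) y(1)] by blast
        qed
        show "r \<otimes>\<^bsub>B\<^esub> s \<in> b" if r: "r \<in> carrier B" for r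
          using row[OF x(1) 1 r] x(2) unfolding b_def by force
      qed
      then have "ideal b B" by (rule B.left_ideal_imp_ideal)
      then obtain e where e: "e \<in> b" "\<And>s. s \<in> b \<Longrightarrow> s \<otimes>\<^bsub>B\<^esub> e = s" using ones by blast
      obtain x0 where x0: "x0 \<in> L" "e = \<mu> x0 (1, ?c)" using e(1) unfolding b_def by blast
      have entry_b: "\<mu> x (i, ?c) \<in> b" if "x \<in> L" "i \<in> {1..n}" for x i
        using row[OF that B.one_closed] ec[OF that c] unfolding b_def by force
      let ?U = "matrix_unit B n ?c 1 \<one>\<^bsub>B\<^esub>"
      have U: "?U \<in> carrier M" by (rule matrix_unit_closed[OF B B.one_closed])
      \<comment> \<open>Multiplication by \<open>?U\<close> moves the first row of \<open>\<mu> x0\<close>, which contains \<open>e\<close>, to the row \<open>?c\<close>.\<close>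
      obtain y where y: "y \<in> L" "\<mu> y = \<Psi> \<otimes>\<^bsub>M\<^esub> ?U \<otimes>\<^bsub>M\<^esub> \<mu> x0"
        using act[OF x0(1), of "\<Psi> \<otimes>\<^bsub>M\<^esub> ?U"] P(1) U by auto
      have x0M: "\<mu> x0 \<in> carrier M" by (rule mu_closed[OF LJ[OF x0(1)]])
      have "x \<otimes>\<^bsub>A\<^esub> y \<ominus>\<^bsub>A\<^esub> x \<in> columns k" if x: "x \<in> L" for x
      proof -
        have xM: "\<mu> x \<in> carrier M" by (rule mu_closed[OF LJ[OF x]])
        have xyL: "x \<otimes>\<^bsub>A\<^esub> y \<in> L" using D(4)[OF D(1)[OF x] y(1)] .
        have dL: "x \<otimes>\<^bsub>A\<^esub> y \<ominus>\<^bsub>A\<^esub> x \<in> L" by (rule A.left_ideal_minus[OF L xyL x])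
        have "\<mu> (x \<otimes>\<^bsub>A\<^esub> y) = \<mu> x \<otimes>\<^bsub>M\<^esub> (\<Phi> \<otimes>\<^bsub>M\<^esub> \<Psi>) \<otimes>\<^bsub>M\<^esub> (?U \<otimes>\<^bsub>M\<^esub> \<mu> x0)"
          using mu_mult[OF LJ[OF x] LJ[OF y(1)]] y(2) xM form_closed P(1) U x0M by (simp add: M.m_assoc)
        then have xy: "\<mu> (x \<otimes>\<^bsub>A\<^esub> y) = \<mu> x \<otimes>\<^bsub>M\<^esub> (?U \<otimes>\<^bsub>M\<^esub> \<mu> x0)" using P(3) xM by simp
        have "\<mu> (x \<otimes>\<^bsub>A\<^esub> y) (i, ?c) = \<mu> x (i, ?c)" if i: "i \<in> {1..n}" for i
        proof -
          have "\<mu> (x \<otimes>\<^bsub>A\<^esub> y) (i, ?c) = (\<Oplus>\<^bsub>B\<^esub>p\<in>{1..n}. \<mu> x (i, p) \<otimes>\<^bsub>B\<^esub> (?U \<otimes>\<^bsub>M\<^esub> \<mu> x0) (p, ?c))"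
            unfolding xy by (rule matrix_mult_entry[OF B i c])
          also have "\<dots> = (\<Oplus>\<^bsub>B\<^esub>p\<in>{1..n}. if ?c = p then \<mu> x (i, p) \<otimes>\<^bsub>B\<^esub> e else \<zero>\<^bsub>B\<^esub>)"
          proof (rule B.finsum_cong')
            fix p assume p: "p \<in> {1..n}"
            show "\<mu> x (i, p) \<otimes>\<^bsub>B\<^esub> (?U \<otimes>\<^bsub>M\<^esub> \<mu> x0) (p, ?c) = (if ?c = p then \<mu> x (i, p) \<otimes>\<^bsub>B\<^esub> e else \<zero>\<^bsub>B\<^esub>)"
              using matrix_unit_mult_left[OF B c 1 B.one_closed x0M p c] ec[OF x0(1) 1 c] ec[OF x i p] x0(2) by auto
          qed (use ec[OF x i] ec[OF x0(1) 1 c] x0(2) in auto)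
          also have "\<dots> = \<mu> x (i, ?c) \<otimes>\<^bsub>B\<^esub> e"
            by (rule B.finsum_singleton) (use c ec[OF x i] ec[OF x0(1) 1 c] x0(2) in auto)
          also have "\<dots> = \<mu> x (i, ?c)" by (rule e(2)[OF entry_b[OF x i]])
          finally show ?thesis .
        qed
        then have col: "\<mu> (x \<otimes>\<^bsub>A\<^esub> y \<ominus>\<^bsub>A\<^esub> x) (i, ?c) = \<zero>\<^bsub>B\<^esub>" if "i \<in> {1..n}" for i
          using mu_minus_zero[OF LJ[OF xyL] LJ[OF x] that c] that by simp
        have "x \<otimes>\<^bsub>A\<^esub> y \<ominus>\<^bsub>A\<^esub> x \<in> columns ?c" using dL Lc by blast
        then have "\<mu> (x \<otimes>\<^bsub>A\<^esub> y \<ominus>\<^bsub>A\<^esub> x) (i, l) = \<zero>\<^bsub>B\<^esub>" if "i \<in> {1..n}" "l \<in> {1..n}" "k < l" for i l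
          using that col[OF that(1)] unfolding columns_def by (cases "l = ?c") simp_all
        then show ?thesis using LJ[OF dL] unfolding columns_def by blast
      qed
      then show "\<exists>y\<in>L. \<forall>x\<in>L. x \<otimes>\<^bsub>A\<^esub> y \<ominus>\<^bsub>A\<^esub> x \<in> columns k" using y(1) by blast
    qed
  qed
  from this[OF le_refl L(1)] show ?thesis using L(2) columns_n by simp
qed

end

section \<open>Layers of cellular algebras\<close>

context cell_data
begin

definition entries :: "('k, 'v, 'b) cell_tensor \<Rightarrow> nat \<times> nat \<Rightarrow> 'b" where
  "entries t = restrict (\<lambda>(i, j). entry i j t) ({1..n} \<times> {1..n})"

abbreviation "MB \<equiv> matrix_ring B n"

lemma entries_closed: "t \<in> carrier TT \<Longrightarrow> entries t \<in> carrier MB"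
  unfolding entries_def by (rule matrix_memI[OF B_cring]) (simp add: entry(1))

lemma entries_entry: "\<lbrakk>i \<in> {1..n}; j \<in> {1..n}\<rbrakk> \<Longrightarrow> entries t (i, j) = entry i j t"
  unfolding entries_def by simp

lemma entries_add:
  assumes "s \<in> carrier TT" "t \<in> carrier TT"
  shows "entries (s \<oplus>\<^bsub>TT\<^esub> t) = entries s \<oplus>\<^bsub>MB\<^esub> entries t"
proof -
  interpret T: module B TT by (rule TT_module)
  interpret MB: ring MB by (rule matrix_ring_is_ring[OF B_cring])
  show ?thesis
    by (rule matrix_eqI[OF B_cring, where n = n])
       (use assms in \<open>simp_all add: entries_closed entries_entry entry(2) matrix_add_entry[OF B_cring]\<close>)
qed

lemma entries_assemble:
  assumes "C \<in> carrier MB" shows "entries (assemble C) = C"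
proof -
  have C: "C s \<in> carrier B" if "s \<in> {1..n} \<times> {1..n}" for s
    using that matrix_entry_closed[OF B_cring assms] by auto
  show ?thesis
  proof (rule matrix_eqI[OF B_cring entries_closed[OF assemble_closed[OF C]] assms])
    fix i j assume ij: "i \<in> {1..n}" "j \<in> {1..n}"
    show "entries (assemble C) (i, j) = C (i, j)"
      unfolding entries_entry[OF ij] by (rule entry_assemble[OF C ij])
  qed
qed

lemma assemble_entries:
  assumes t: "t \<in> carrier TT" shows "assemble (entries t) = t"
proof -
  interpret B: cring B by (rule B_cring)
  interpret T: module B TT by (rule TT_module)
  have "assemble (entries t) = assemble (\<lambda>(i, j). entry i j t)"
    unfolding assemble_def
  proof (rule T.M.finsum_cong')
    show "(\<lambda>s. celt (v (fst s)) ((\<lambda>(i, j). entry i j t) s) \<one>\<^bsub>B\<^esub> (v (snd s))) \<in> {1..n} \<times> {1..n} \<rightarrow> carrier TT"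
      using entry(1)[OF _ _ t] by auto
  qed (auto simp: entries_entry)
  then show ?thesis using assemble_entry[OF t] by simp
qed

lemma entries_basis_elem:
  assumes "i \<in> {1..n}" "j \<in> {1..n}" "b \<in> carrier B"
  shows "entries (celt (v i) b \<one>\<^bsub>B\<^esub> (v j)) = matrix_unit B n i j b"
proof -
  interpret B: cring B by (rule B_cring)
  show ?thesis
    by (rule matrix_eqI[OF B_cring entries_closed matrix_unit_closed[OF B_cring]])
       (use assms in \<open>auto simp: entries_entry entry_basis_elem matrix_unit_def\<close>)
qed

lemma tensor_basis_induct [consumes 1, case_names zero elem add]:
  assumes t: "t \<in> carrier TT" and "P \<zero>\<^bsub>TT\<^esub>"
    and "\<And>i j b. \<lbrakk>i \<in> {1..n}; j \<in> {1..n}; b \<in> carrier B\<rbrakk> \<Longrightarrow> P (celt (v i) b \<one>\<^bsub>B\<^esub> (v j))"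
    and "\<And>s t. \<lbrakk>s \<in> carrier TT; t \<in> carrier TT; P s; P t\<rbrakk> \<Longrightarrow> P (s \<oplus>\<^bsub>TT\<^esub> t)"
  shows "P t"
proof -
  interpret B: cring B by (rule B_cring)
  interpret T: module B TT by (rule TT_module)
  have e: "entries t s \<in> carrier B" "v (fst s) \<in> carrier V" "v (snd s) \<in> carrier V" if "s \<in> {1..n} \<times> {1..n}" for s
    using that matrix_entry_closed[OF B_cring entries_closed[OF t]] by auto
  have "P (assemble (entries t))" unfolding assemble_def
  proof (rule T.M.finsum_induct[where P = P])
    show "(\<lambda>s. celt (v (fst s)) (entries t s) \<one>\<^bsub>B\<^esub> (v (snd s))) \<in> {1..n} \<times> {1..n} \<rightarrow> carrier TT"
      using e by (intro Pi_I elem_closed B.one_closed)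
    show "P (celt (v (fst s)) (entries t s) \<one>\<^bsub>B\<^esub> (v (snd s)))" if "s \<in> {1..n} \<times> {1..n}" for s
      using that e(1)[OF that] by (intro assms(3)) auto
  qed (use assms in auto)
  then show ?thesis using assemble_entries[OF t] by simp
qed

context
  fixes L :: "('k, 'a) module" and J :: "'a set" and \<alpha> :: "'a \<Rightarrow> ('k, 'v, 'b) cell_tensor"
    and \<phi> :: "('v \<times> 'v \<Rightarrow> 'k) set \<Rightarrow> 'b"
  assumes J: "ideal J L" and bij: "bij_betw \<alpha> J (carrier TT)"
    and al_add: "\<And>x y. \<lbrakk>x \<in> J; y \<in> J\<rbrakk> \<Longrightarrow> \<alpha> (x \<oplus>\<^bsub>L\<^esub> y) = \<alpha> x \<oplus>\<^bsub>TT\<^esub> \<alpha> y"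
    and form: "is_cell_form K L J V B \<alpha> \<phi>"
begin

abbreviation (input) "\<Phi> \<equiv> form_matrix K V n v \<phi>"

lemma form_matrix_closed: "\<Phi> \<in> carrier MB"
proof -
  interpret VV: module_pair K V V by (rule module_pair.intro[OF V_module V_module])
  have "\<phi> \<in> carrier (tensor K V V) \<rightarrow> carrier B" using form unfolding is_cell_form_def linear_maps_def by blast
  then have "\<phi> (VV.pt (v s) (v t)) \<in> carrier B" if "s \<in> {1..n}" "t \<in> {1..n}" for s t
    using that VV.pure_closed by (simp add: Pi_def)
  then show ?thesis unfolding form_matrix_def by (intro matrix_memI[OF B_cring]) simp
qed

text \<open>Both sides are additive in \<open>x\<close> and in \<open>y\<close>. For basis tensors the equation is the defining
  property of the bilinear form.\<close>

lemma cell_entries_mult: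
  assumes x: "x \<in> J" and y: "y \<in> J"
  shows "entries (\<alpha> (x \<otimes>\<^bsub>L\<^esub> y)) = entries (\<alpha> x) \<otimes>\<^bsub>MB\<^esub> \<Phi> \<otimes>\<^bsub>MB\<^esub> entries (\<alpha> y)"
proof -
  interpret J: ideal J L by (rule J)
  interpret B: cring B by (rule B_cring)
  interpret T: module B TT by (rule TT_module)
  interpret MB: ring MB by (rule matrix_ring_is_ring[OF B_cring])
  note Jc = J.a_Hcarr
  have zJ: "\<zero>\<^bsub>L\<^esub> \<in> J" by (rule additive_subgroup.zero_closed[OF J.is_additive_subgroup])
  have ac: "\<alpha> x \<in> carrier TT" if "x \<in> J" for x using bij_betwE[OF bij] that by blast
  have inj: "x = y" if "x \<in> J" "y \<in> J" "\<alpha> x = \<alpha> y" for x y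
    using bij that unfolding bij_betw_def inj_on_def by blast
  have onto: "\<exists>x\<in>J. \<alpha> x = t" if "t \<in> carrier TT" for t
    using bij that unfolding bij_betw_def by (metis imageE)
  have a0: "\<alpha> \<zero>\<^bsub>L\<^esub> = \<zero>\<^bsub>TT\<^esub>"
    using al_add[OF zJ zJ] ac[OF zJ] by (metis J.l_zero J.zero_closed T.M.add.r_cancel_one')
  have e0: "entries \<zero>\<^bsub>TT\<^esub> = \<zero>\<^bsub>MB\<^esub>"
    using entries_add[OF T.M.zero_closed T.M.zero_closed] entries_closed[OF T.M.zero_closed]
    by (metis MB.add.r_cancel_one' T.M.l_zero T.M.zero_closed)
  have fc: "\<Phi> \<in> carrier MB" by (rule form_matrix_closed)
  have ec: "entries (\<alpha> x) \<in> carrier MB" if "x \<in> J" for x using entries_closed[OF ac[OF that]] .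
  have cl: "x \<otimes>\<^bsub>L\<^esub> y \<in> J" if "x \<in> J" "y \<in> J" for x y using J.I_l_closed[OF that(2) Jc[OF that(1)]] .
  let ?F = "\<lambda>x y. entries (\<alpha> (x \<otimes>\<^bsub>L\<^esub> y)) = entries (\<alpha> x) \<otimes>\<^bsub>MB\<^esub> \<Phi> \<otimes>\<^bsub>MB\<^esub> entries (\<alpha> y)"
  have base: "?F x y" if x: "x \<in> J" "\<alpha> x = celt (v i) b \<one>\<^bsub>B\<^esub> (v j)" and y: "y \<in> J" "\<alpha> y = celt (v k) c \<one>\<^bsub>B\<^esub> (v l)"
    and ij: "i \<in> {1..n}" "j \<in> {1..n}" "k \<in> {1..n}" "l \<in> {1..n}" and bc: "b \<in> carrier B" "c \<in> carrier B"
    for x y i j k l b c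
  proof -
    have Fjk: "\<Phi> (j, k) \<in> carrier B" by (rule matrix_entry_closed[OF B_cring fc ij(2,3)])
    have "\<alpha> (x \<otimes>\<^bsub>L\<^esub> y) = celt (v i) (b \<otimes>\<^bsub>B\<^esub> \<phi> (pure_tensor K V V (v j) (v k)) \<otimes>\<^bsub>B\<^esub> c) \<one>\<^bsub>B\<^esub> (v l)"
      using form x y ij bc v_closed unfolding is_cell_form_def by blast
    also have "\<phi> (pure_tensor K V V (v j) (v k)) = \<Phi> (j, k)" unfolding form_matrix_def using ij by simp
    finally have "entries (\<alpha> (x \<otimes>\<^bsub>L\<^esub> y)) = matrix_unit B n i l (b \<otimes>\<^bsub>B\<^esub> \<Phi> (j, k) \<otimes>\<^bsub>B\<^esub> c)"
      using entries_basis_elem[OF ij(1,4)] bc Fjk by simp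
    moreover have "matrix_unit B n i j b \<otimes>\<^bsub>MB\<^esub> \<Phi> \<otimes>\<^bsub>MB\<^esub> matrix_unit B n k l c = matrix_unit B n i l (b \<otimes>\<^bsub>B\<^esub> \<Phi> (j, k) \<otimes>\<^bsub>B\<^esub> c)"
    proof (rule matrix_eqI[OF B_cring])
      have U: "matrix_unit B n i j b \<otimes>\<^bsub>MB\<^esub> \<Phi> \<in> carrier MB"
        using matrix_unit_closed[OF B_cring bc(1)] fc by simp
      show "matrix_unit B n i j b \<otimes>\<^bsub>MB\<^esub> \<Phi> \<otimes>\<^bsub>MB\<^esub> matrix_unit B n k l c \<in> carrier MB"
        using U matrix_unit_closed[OF B_cring bc(2)] by simp
      show "matrix_unit B n i l (b \<otimes>\<^bsub>B\<^esub> \<Phi> (j, k) \<otimes>\<^bsub>B\<^esub> c) \<in> carrier MB"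
        using matrix_unit_closed[OF B_cring] bc Fjk by simp
      fix p q assume p: "p \<in> {1..n}" and q: "q \<in> {1..n}"
      show "(matrix_unit B n i j b \<otimes>\<^bsub>MB\<^esub> \<Phi> \<otimes>\<^bsub>MB\<^esub> matrix_unit B n k l c) (p, q) =
          matrix_unit B n i l (b \<otimes>\<^bsub>B\<^esub> \<Phi> (j, k) \<otimes>\<^bsub>B\<^esub> c) (p, q)"
        unfolding matrix_unit_mult_right[OF B_cring ij(3,4) bc(2) U p q]
          matrix_unit_mult_left[OF B_cring ij(1,2) bc(1) fc p ij(3)]
        using bc p q by (simp add: matrix_unit_def)
    qed
    ultimately show ?thesis using x(2) y(2) entries_basis_elem ij bc by simp
  qed
  have zero_left: "?F \<zero>\<^bsub>L\<^esub> y" if "y \<in> J" for y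
    using that ec[OF that] fc Jc[OF that] by (simp add: a0 e0)
  have zero_right: "?F x \<zero>\<^bsub>L\<^esub>" if "x \<in> J" for x
    using that ec[OF that] fc Jc[OF that] by (simp add: a0 e0)
  have add_left: "?F (x \<oplus>\<^bsub>L\<^esub> x') y" if xJ: "x \<in> J" "x' \<in> J" "y \<in> J" and F: "?F x y" "?F x' y" for x x' y
  proof -
    have "(x \<oplus>\<^bsub>L\<^esub> x') \<otimes>\<^bsub>L\<^esub> y = x \<otimes>\<^bsub>L\<^esub> y \<oplus>\<^bsub>L\<^esub> x' \<otimes>\<^bsub>L\<^esub> y" using xJ Jc by (intro J.l_distr) auto
    then have "entries (\<alpha> ((x \<oplus>\<^bsub>L\<^esub> x') \<otimes>\<^bsub>L\<^esub> y)) = entries (\<alpha> (x \<otimes>\<^bsub>L\<^esub> y)) \<oplus>\<^bsub>MB\<^esub> entries (\<alpha> (x' \<otimes>\<^bsub>L\<^esub> y))"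
      using al_add[OF cl cl] entries_add[OF ac[OF cl] ac[OF cl]] xJ by simp
    also have "\<dots> = (entries (\<alpha> x) \<oplus>\<^bsub>MB\<^esub> entries (\<alpha> x')) \<otimes>\<^bsub>MB\<^esub> \<Phi> \<otimes>\<^bsub>MB\<^esub> entries (\<alpha> y)"
      unfolding F using ec xJ fc by (simp add: MB.l_distr)
    also have "entries (\<alpha> x) \<oplus>\<^bsub>MB\<^esub> entries (\<alpha> x') = entries (\<alpha> (x \<oplus>\<^bsub>L\<^esub> x'))"
      using al_add[OF xJ(1,2)] entries_add[OF ac ac] xJ by simp
    finally show ?thesis .
  qed
  have add_right: "?F x (y \<oplus>\<^bsub>L\<^esub> y')" if xJ: "x \<in> J" "y \<in> J" "y' \<in> J" and F: "?F x y" "?F x y'" for x y y'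
  proof -
    have "x \<otimes>\<^bsub>L\<^esub> (y \<oplus>\<^bsub>L\<^esub> y') = x \<otimes>\<^bsub>L\<^esub> y \<oplus>\<^bsub>L\<^esub> x \<otimes>\<^bsub>L\<^esub> y'" using xJ Jc by (intro J.r_distr) auto
    then have "entries (\<alpha> (x \<otimes>\<^bsub>L\<^esub> (y \<oplus>\<^bsub>L\<^esub> y'))) = entries (\<alpha> (x \<otimes>\<^bsub>L\<^esub> y)) \<oplus>\<^bsub>MB\<^esub> entries (\<alpha> (x \<otimes>\<^bsub>L\<^esub> y'))"
      using al_add[OF cl cl] entries_add[OF ac[OF cl] ac[OF cl]] xJ by simp
    also have "\<dots> = entries (\<alpha> x) \<otimes>\<^bsub>MB\<^esub> \<Phi> \<otimes>\<^bsub>MB\<^esub> (entries (\<alpha> y) \<oplus>\<^bsub>MB\<^esub> entries (\<alpha> y'))"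
      unfolding F using ec xJ fc by (simp add: MB.r_distr)
    also have "entries (\<alpha> y) \<oplus>\<^bsub>MB\<^esub> entries (\<alpha> y') = entries (\<alpha> (y \<oplus>\<^bsub>L\<^esub> y'))"
      using al_add[OF xJ(2,3)] entries_add[OF ac ac] xJ by simp
    finally show ?thesis .
  qed
  have right: "?F x y" if x: "x \<in> J" "\<alpha> x = celt (v i) b \<one>\<^bsub>B\<^esub> (v j)" and ij: "i \<in> {1..n}" "j \<in> {1..n}" "b \<in> carrier B"
    and y: "y \<in> J" for x i b j y
  proof -
    have "\<forall>y\<in>J. \<alpha> y = t \<longrightarrow> ?F x y" if "t \<in> carrier TT" for t
      using that
    proof (induct rule: tensor_basis_induct)
      case zero
      then show ?case using inj[OF _ zJ] a0 zero_right[OF x(1)] by metis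
    next
      case (elem k l c)
      then show ?case using base[OF x _ _ ij(1,2) elem(1,2) ij(3) elem(3)] by blast
    next
      case (add s t)
      obtain y y' where yy: "y \<in> J" "\<alpha> y = s" "y' \<in> J" "\<alpha> y' = t" using onto add(1,2) by meson
      have "?F x (y \<oplus>\<^bsub>L\<^esub> y')" using add_right[OF x(1) yy(1,3)] add(3,4) yy by blast
      moreover have "\<alpha> (y \<oplus>\<^bsub>L\<^esub> y') = s \<oplus>\<^bsub>TT\<^esub> t" using al_add yy by simp
      moreover have "y \<oplus>\<^bsub>L\<^esub> y' \<in> J" using yy by simp
      ultimately show ?case using inj by metis
    qed
    then show ?thesis using ac[OF y] y by blast
  qed
  have "\<forall>x\<in>J. \<alpha> x = s \<longrightarrow> ?F x y" if "s \<in> carrier TT" for s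
    using that
  proof (induct rule: tensor_basis_induct)
    case zero
    then show ?case using inj[OF _ zJ] a0 zero_left[OF y] by metis
  next
    case (elem i j b)
    then show ?case using right y by blast
  next
    case (add s t)
    obtain x x' where xx: "x \<in> J" "\<alpha> x = s" "x' \<in> J" "\<alpha> x' = t" using onto add(1,2) by meson
    have "?F (x \<oplus>\<^bsub>L\<^esub> x') y" using add_left[OF xx(1,3) y] add(3,4) xx by blast
    moreover have "\<alpha> (x \<oplus>\<^bsub>L\<^esub> x') = s \<oplus>\<^bsub>TT\<^esub> t" using al_add xx by simp
    moreover have "x \<oplus>\<^bsub>L\<^esub> x' \<in> J" using xx by simp
    ultimately show ?case using inj by metis
  qed
  then show ?thesis using ac[OF x] x by blast
qed

end

end

lemma quot_module_ring_simps:
  "carrier (quot_module A I) = carrier (A Quot I)" "x \<oplus>\<^bsub>quot_module A I\<^esub> y = x \<oplus>\<^bsub>A Quot I\<^esub> y"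
  "x \<otimes>\<^bsub>quot_module A I\<^esub> y = x \<otimes>\<^bsub>A Quot I\<^esub> y"
  unfolding quot_module_def by simp_all

lemma affine_cell_idealD:
  assumes "affine_cell_ideal K L star J V B \<sigma> act \<alpha>"
  shows "ideal J L" "affine_algebra K B" "bij_betw \<alpha> J (carrier (cell_tensor K V B))"
    "\<And>x y. \<lbrakk>x \<in> J; y \<in> J\<rbrakk> \<Longrightarrow> \<alpha> (x \<oplus>\<^bsub>L\<^esub> y) = \<alpha> x \<oplus>\<^bsub>cell_tensor K V B\<^esub> \<alpha> y"
proof -
  note a = assms[unfolded affine_cell_ideal_def]
  show "ideal J L" using a by (elim conjE) assumption
  show "affine_algebra K B" using a by (elim conjE) assumption
  show "bij_betw \<alpha> J (carrier (cell_tensor K V B))" using a by (elim conjE) assumption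
  have "\<forall>x\<in>J. \<forall>y\<in>J. \<alpha> (x \<oplus>\<^bsub>L\<^esub> y) = \<alpha> x \<oplus>\<^bsub>cell_tensor K V B\<^esub> \<alpha> y"
    using a by (elim conjE) assumption
  then show "\<And>x y. \<lbrakk>x \<in> J; y \<in> J\<rbrakk> \<Longrightarrow> \<alpha> (x \<oplus>\<^bsub>L\<^esub> y) = \<alpha> x \<oplus>\<^bsub>cell_tensor K V B\<^esub> \<alpha> y"
    by simp
qed

theorem cell_layer_matrix_layer:
  assumes I0: "ideal I0 A" and I1: "ideal I1 A" and I01: "I0 \<subseteq> I1"
    and cell: "affine_cell_ideal K (quot_module A I0) star ((\<lambda>x. I0 +>\<^bsub>A\<^esub> x) ` I1) V B \<sigma> act \<alpha>"
    and form: "is_cell_form K (quot_module A I0) ((\<lambda>x. I0 +>\<^bsub>A\<^esub> x) ` I1) V B \<alpha> \<phi>"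
    and basis: "is_basis K V n v"
  shows "matrix_layer A I0 I1 B n (form_matrix K V n v \<phi>) (\<lambda>x. cell_data.entries K V n v B (\<alpha> (I0 +>\<^bsub>A\<^esub> x)))"
proof -
  let ?L = "quot_module A I0" and ?J = "(\<lambda>x. I0 +>\<^bsub>A\<^esub> x) ` I1"
  note cellD = affine_cell_idealD[OF cell]
  have "algebra K B" using cellD(2) unfolding affine_algebra_def by (rule conjunct1)
  then interpret C: cell_data K V n v B using basis by (simp add: cell_data_def cell_data_axioms_def based_module_def)
  interpret I0: ideal I0 A by (rule I0)
  interpret I1: ideal I1 A by (rule I1)
  interpret T: module B C.TT by (rule C.TT_module)
  interpret MB: ring C.MB by (rule matrix_ring_is_ring[OF C.B_cring])
  note J = cellD(1) and bij = cellD(3) and add = cellD(4)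
  have c: "x \<in> carrier A" if "x \<in> I1" for x using that I1.a_Hcarr by blast
  note hom = I0.rcos_ring_hom
  have madd: "(I0 +>\<^bsub>A\<^esub> x) \<oplus>\<^bsub>?L\<^esub> (I0 +>\<^bsub>A\<^esub> y) = I0 +>\<^bsub>A\<^esub> (x \<oplus>\<^bsub>A\<^esub> y)"
    and mmult: "(I0 +>\<^bsub>A\<^esub> x) \<otimes>\<^bsub>?L\<^esub> (I0 +>\<^bsub>A\<^esub> y) = I0 +>\<^bsub>A\<^esub> (x \<otimes>\<^bsub>A\<^esub> y)" if "x \<in> I1" "y \<in> I1" for x y
    unfolding quot_module_ring_simps using ring_hom_add[OF hom] ring_hom_mult[OF hom] c that by simp_all
  have ac: "\<alpha> (I0 +>\<^bsub>A\<^esub> x) \<in> carrier C.TT" if "x \<in> I1" for x using bij_betwE[OF bij] that by blast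
  let ?m = "\<lambda>x. C.entries (\<alpha> (I0 +>\<^bsub>A\<^esub> x))"
  have m_add: "?m (x \<oplus>\<^bsub>A\<^esub> y) = ?m x \<oplus>\<^bsub>C.MB\<^esub> ?m y" if xy: "x \<in> I1" "y \<in> I1" for x y
    using madd[OF xy, symmetric] add C.entries_add[OF ac ac] xy by simp
  have zI: "\<zero>\<^bsub>A\<^esub> \<in> I1" "\<zero>\<^bsub>A\<^esub> \<in> I0"
    by (rule additive_subgroup.zero_closed[OF I1.is_additive_subgroup])
       (rule additive_subgroup.zero_closed[OF I0.is_additive_subgroup])
  have m0: "?m \<zero>\<^bsub>A\<^esub> = \<zero>\<^bsub>C.MB\<^esub>"
    using m_add[OF zI(1) zI(1)] C.entries_closed[OF ac[OF zI(1)]]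
    by (metis I0.l_zero I0.zero_closed MB.add.r_cancel_one')
  have m_inj: "I0 +>\<^bsub>A\<^esub> x = I0 +>\<^bsub>A\<^esub> y" if xy: "x \<in> I1" "y \<in> I1" "?m x = ?m y" for x y
  proof -
    have "\<alpha> (I0 +>\<^bsub>A\<^esub> x) = \<alpha> (I0 +>\<^bsub>A\<^esub> y)"
      using C.assemble_entries[OF ac[OF xy(1)]] C.assemble_entries[OF ac[OF xy(2)]] xy(3) by metis
    then show ?thesis using bij xy(1,2) unfolding bij_betw_def inj_on_def by blast
  qed
  show ?thesis
  proof (rule matrix_layer.intro)
    show "ideal I0 A" "ideal I1 A" "I0 \<subseteq> I1" "cring B" by (fact I0 I1 I01 C.B_cring)+
    show "form_matrix K V n v \<phi> \<in> carrier C.MB" by (rule C.form_matrix_closed[OF J bij add form])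
    show "?m x \<in> carrier C.MB" if "x \<in> I1" for x by (rule C.entries_closed[OF ac[OF that]])
    show "\<exists>x\<in>I1. ?m x = D" if D: "D \<in> carrier C.MB" for D
    proof -
      have "C.assemble D \<in> carrier C.TT"
        by (rule C.assemble_closed) (use matrix_entry_closed[OF C.B_cring D] in auto)
      then obtain x where "x \<in> I1" "\<alpha> (I0 +>\<^bsub>A\<^esub> x) = C.assemble D"
        using bij unfolding bij_betw_def by (metis (no_types, lifting) imageE)
      then show ?thesis using C.entries_assemble[OF D] by (intro bexI[of _ x]) simp_all
    qed
    show "?m (x \<oplus>\<^bsub>A\<^esub> y) = ?m x \<oplus>\<^bsub>C.MB\<^esub> ?m y" if "x \<in> I1" "y \<in> I1" for x y by (rule m_add[OF that])
    show "?m x = \<zero>\<^bsub>C.MB\<^esub> \<longleftrightarrow> x \<in> I0" if x: "x \<in> I1" for x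
    proof
      assume "?m x = \<zero>\<^bsub>C.MB\<^esub>"
      then have "I0 +>\<^bsub>A\<^esub> x = I0 +>\<^bsub>A\<^esub> \<zero>\<^bsub>A\<^esub>" using m_inj[OF x zI(1)] m0 by simp
      then have "I0 +>\<^bsub>A\<^esub> x = I0" using I0.a_rcos_zero[OF I0 zI(2)] by simp
      then show "x \<in> I0" using I0.rcos_const_imp_mem[OF c[OF x]] by simp
    next
      assume "x \<in> I0"
      then have "I0 +>\<^bsub>A\<^esub> x = I0 +>\<^bsub>A\<^esub> \<zero>\<^bsub>A\<^esub>" using I0.a_rcos_zero[OF I0] zI(2) by simp
      then show "?m x = \<zero>\<^bsub>C.MB\<^esub>" using m0 by simp
    qed
    show "?m (x \<otimes>\<^bsub>A\<^esub> y) = ?m x \<otimes>\<^bsub>C.MB\<^esub> form_matrix K V n v \<phi> \<otimes>\<^bsub>C.MB\<^esub> ?m y" if xy: "x \<in> I1" "y \<in> I1" for x y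
      using C.cell_entries_mult[OF J bij add form, of "I0 +>\<^bsub>A\<^esub> x" "I0 +>\<^bsub>A\<^esub> y"] mmult[OF xy] xy by simp
  qed
qed

section \<open>The criterion for semisimplicity\<close>

lemma spec_algebra_cring:
  assumes "\<And>j. j \<in> {1..m} \<Longrightarrow> cring (B j)"
  shows "cring (spec_algebra m B)"
    and "vn_regular (spec_algebra m B) \<longleftrightarrow> (\<forall>j\<in>{1..m}. vn_regular (B j))"
proof -
  have set: "set (map B [1..<Suc m]) = B ` {1..m}" by auto
  have "cring (spec_algebra m B) \<and> (vn_regular (spec_algebra m B) \<longleftrightarrow> (\<forall>R\<in>set (map B [1..<Suc m]). vn_regular R))"
    unfolding spec_algebra_def by (rule RDirProd_list_vn_regular_iff) (use assms set in auto)
  then show "cring (spec_algebra m B)"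
    and "vn_regular (spec_algebra m B) \<longleftrightarrow> (\<forall>j\<in>{1..m}. vn_regular (B j))"
    unfolding set by auto
qed

lemma spec_algebra_nonzero:
  assumes m: "1 \<le> m" and cr: "\<And>j. j \<in> {1..m} \<Longrightarrow> cring (B j)" and nz: "carrier (B 1) \<noteq> {\<zero>\<^bsub>B 1\<^esub>}"
  shows "carrier (spec_algebra m B) \<noteq> {\<zero>\<^bsub>spec_algebra m B\<^esub>}"
proof
  interpret S: cring "spec_algebra m B" by (rule spec_algebra_cring(1)[OF cr])
  interpret B1: cring "B 1" using cr m by simp
  assume "carrier (spec_algebra m B) = {\<zero>\<^bsub>spec_algebra m B\<^esub>}"
  then have "\<one>\<^bsub>spec_algebra m B\<^esub> = \<zero>\<^bsub>spec_algebra m B\<^esub>" using S.one_closed by blast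
  moreover have "map B [1..<Suc m] = B 1 # map B [Suc 1..<Suc m]"
    using m upt_conv_Cons[of 1 "Suc m"] by (simp del: upt_Suc)
  ultimately have "\<one>\<^bsub>B 1\<^esub> = \<zero>\<^bsub>B 1\<^esub>"
    unfolding spec_algebra_def by (simp add: RDirProd_list_one RDirProd_list_zero)
  then show False using nz B1.carrier_one_zero by blast
qed

theorem theorem3p10:
  fixes K :: "('k, 'z) ring_scheme"
    and A :: "('k, 'a) module" and star :: "'a \<Rightarrow> 'a"
    and m :: nat and J' :: "nat \<Rightarrow> 'a set"
    and V :: "nat \<Rightarrow> ('k, 'v) module" and B :: "nat \<Rightarrow> ('k, 'b) module"
    and \<sigma> :: "nat \<Rightarrow> 'b \<Rightarrow> 'b"
    and act :: "nat \<Rightarrow> 'a set \<Rightarrow> ('v \<times> 'b \<Rightarrow> 'k) set \<Rightarrow> ('v \<times> 'b \<Rightarrow> 'k) set"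
    and \<alpha> :: "nat \<Rightarrow> 'a set \<Rightarrow> ('k, 'v, 'b) cell_tensor"
    and \<phi> :: "nat \<Rightarrow> ('v \<times> 'v \<Rightarrow> 'k) set \<Rightarrow> 'b"
    and n :: "nat \<Rightarrow> nat" and v :: "nat \<Rightarrow> nat \<Rightarrow> 'v"
  assumes "field K"
    and "affine_cellular K A star m J' V B \<sigma> act \<alpha>"
    and "\<And>j. j \<in> {1..m} \<Longrightarrow>
           is_cell_form K (layer_algebra A J' j) (layer_ideal A J' j) (V j) (B j) (\<alpha> j) (\<phi> j)"
    and "\<And>j. j \<in> {1..m} \<Longrightarrow> is_basis K (V j) (n j) (v j)"
  shows "semisimple_ring A \<longleftrightarrow>
           (reduced_ring (spec_algebra m B) \<and> krull_dim (spec_algebra m B) = 0) \<and>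
           (\<forall>j\<in>{1..m}. form_matrix K (V j) (n j) (v j) (\<phi> j) \<in> Units (matrix_ring (B j) (n j)))"
proof -
  note cellular = assms(2)[unfolded affine_cellular_def]
  have alg: "assoc_algebra K A" and m: "1 \<le> m" and sum: "is_direct_sum A {1..m} J'"
    using cellular by simp_all
  interpret A: ring A using alg unfolding assoc_algebra_def by blast
  let ?I = "cell_chain A J'"
  have layer: "ideal (?I j) A" "?I (j - 1) \<subset> ?I j"
    "affine_cell_ideal K (layer_algebra A J' j) ((`) star) (layer_ideal A J' j) (V j) (B j) (\<sigma> j) (act j) (\<alpha> j)"
    if "j \<in> {1..m}" for j
    using cellular that by simp_all
  have I0: "?I 0 = {\<zero>\<^bsub>A\<^esub>}"
    unfolding cell_chain_def sum_of_def using group.generate_empty[OF A.a_group] by simp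
  have Im: "?I m = carrier A"
    using sum unfolding cell_chain_def is_direct_sum_def by simp
  have ideal: "ideal (?I j) A" if "j \<le> m" for j
    using layer(1)[of j] I0 A.zeroideal that by (cases "j = 0") auto
  let ?\<Phi> = "\<lambda>j. form_matrix K (V j) (n j) (v j) (\<phi> j)"
  have ml: "\<exists>\<mu>. matrix_layer A (?I (j - 1)) (?I j) (B j) (n j) (?\<Phi> j) \<mu>" if j: "j \<in> {1..m}" for j
  proof -
    have "?I (j - 1) \<subseteq> ?I j" using layer(2)[OF j] by blast
    moreover have "ideal (?I (j - 1)) A" by (rule ideal) (use j in auto)
    ultimately show ?thesis
      using cell_layer_matrix_layer[OF _ layer(1)[OF j] _
          layer(3)[OF j, unfolded layer_algebra_def layer_ideal_def]
          assms(3)[OF j, unfolded layer_algebra_def layer_ideal_def] assms(4)[OF j]]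
      by blast
  qed
  have aff: "affine_algebra K (B j)" if "j \<in> {1..m}" for j by (rule affine_cell_idealD(2)[OF layer(3)[OF that]])
  have cr: "cring (B j)" if "j \<in> {1..m}" for j
    using aff[OF that] algebra.M_cring unfolding affine_algebra_def by blast
  have nonzero: "1 \<le> n j \<and> carrier (B j) \<noteq> {\<zero>\<^bsub>B j\<^esub>}" if j: "j \<in> {1..m}" for j
  proof -
    obtain \<mu> where "matrix_layer A (?I (j - 1)) (?I j) (B j) (n j) (?\<Phi> j) \<mu>" using ml[OF j] by blast
    then interpret L: matrix_layer A "?I (j - 1)" "?I j" "B j" "n j" "?\<Phi> j" \<mu> .
    interpret M: ring L.M by (rule L.M_ring)
    obtain x where x: "x \<in> ?I j" "x \<notin> ?I (j - 1)" using layer(2)[OF j] by blast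
    then have "\<mu> x \<noteq> \<zero>\<^bsub>L.M\<^esub>" using L.mu_zero_iff by blast
    then obtain i l where il: "i \<in> {1..n j}" "l \<in> {1..n j}" "\<mu> x (i, l) \<noteq> \<zero>\<^bsub>B j\<^esub>"
      using matrix_eqI[OF L.B L.mu_closed[OF x(1)] M.zero_closed] matrix_zero_one_entry(1)[OF L.B] by metis
    then show ?thesis using matrix_entry_closed[OF L.B L.mu_closed[OF x(1)] il(1,2)] by auto
  qed
  have one_m: "1 \<in> {1..m}" using m by simp
  interpret S: cring "spec_algebra m B" by (rule spec_algebra_cring(1)[OF cr])
  have spec_nz: "carrier (spec_algebra m B) \<noteq> {\<zero>\<^bsub>spec_algebra m B\<^esub>}"
    by (rule spec_algebra_nonzero[OF m]) (use cr nonzero[OF one_m] in simp_all)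
  have spec_reg: "vn_regular (spec_algebra m B) \<longleftrightarrow> (\<forall>j\<in>{1..m}. vn_regular (B j))"
    by (rule spec_algebra_cring(2)[OF cr])
  have spec: "reduced_ring (spec_algebra m B) \<and> krull_dim (spec_algebra m B) = 0 \<longleftrightarrow> (\<forall>j\<in>{1..m}. vn_regular (B j))"
    unfolding S.reduced_dim_0_iff_vn_regular spec_reg using spec_nz by simp
  show ?thesis unfolding spec
  proof
    assume "semisimple_ring A"
    then have reg: "vn_regular A" by (rule A.semisimple_imp_vn_regular)
    have "vn_regular (B j) \<and> ?\<Phi> j \<in> Units (matrix_ring (B j) (n j))" if j: "j \<in> {1..m}" for j
    proof -
      obtain \<mu> where L: "matrix_layer A (?I (j - 1)) (?I j) (B j) (n j) (?\<Phi> j) \<mu>" using ml[OF j] by blast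
      show ?thesis
        using matrix_layer.vn_regular_imp_base_regular[OF L reg] matrix_layer.vn_regular_imp_form_invertible[OF L reg]
          nonzero[OF j] by blast
    qed
    then show "(\<forall>j\<in>{1..m}. vn_regular (B j)) \<and> (\<forall>j\<in>{1..m}. ?\<Phi> j \<in> Units (matrix_ring (B j) (n j)))" by blast
  next
    assume a: "(\<forall>j\<in>{1..m}. vn_regular (B j)) \<and> (\<forall>j\<in>{1..m}. ?\<Phi> j \<in> Units (matrix_ring (B j) (n j)))"
    have "has_right_one A L" if "j \<le> m" "left_ideal A L" "L \<subseteq> ?I j" for j L
      using that
    proof (induct j arbitrary: L)
      case 0
      then have "L = {\<zero>\<^bsub>A\<^esub>}" using left_idealD(2)[OF 0(2)] I0 by blast
      then show ?case unfolding has_right_one_def by simp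
    next
      case (Suc j)
      then have j: "Suc j \<in> {1..m}" by simp
      obtain \<mu> where "matrix_layer A (?I (Suc j - 1)) (?I (Suc j)) (B (Suc j)) (n (Suc j)) (?\<Phi> (Suc j)) \<mu>"
        using ml[OF j] by blast
      then have L: "matrix_layer A (?I j) (?I (Suc j)) (B (Suc j)) (n (Suc j)) (?\<Phi> (Suc j)) \<mu>" by simp
      interpret Bj: cring "B (Suc j)" by (rule cr[OF j])
      have ones: "\<exists>e\<in>I. \<forall>b\<in>I. b \<otimes>\<^bsub>B (Suc j)\<^esub> e = b" if "ideal I (B (Suc j))" for I
        by (rule Bj.vn_regular_noetherian_ideal_has_one[OF _ _ that])
           (use a j affine_algebra_noetherian[OF assms(1) aff[OF j]] in auto)
      show ?case
      proof (rule matrix_layer.right_ones_lift[OF L _ ones _ Suc(3,4)])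
        show "?\<Phi> (Suc j) \<in> Units (matrix_ring (B (Suc j)) (n (Suc j)))" using a j by blast
        show "has_right_one A L" if "left_ideal A L" "L \<subseteq> ?I j" for L
          using Suc(1)[OF _ that] Suc(2) by simp
      qed
    qed
    from this[OF le_refl] have "has_right_one A L" if "left_ideal A L" for L
      using that left_idealD(1)[OF that] Im by blast
    then show "semisimple_ring A" by (rule A.right_ones_imp_semisimple)
  qed
qed

end
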